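(* Assume the classes $\exists\mathbb{R}_{\sin}$ and $\exists\mathbb{R}^{<}_{\sin}$ are taken to be closed under computable reductions. Then $\Sigma^0_1\subseteq\exists\mathbb{R}_{\sin}\subseteq\Sigma^0_3$ and $\exists\mathbb{R}^{<}_{\sin}=\Sigma^0_1$.
   Context: $\mathbb{R}_{\sin}$ is $(\mathbb{R},+,\times,<,=,0,1,\sin)$ and $\mathbb{R}^<_{\sin}$ is the same structure without equality. $\exists\mathbb{R}_{\sin}$ (resp. $\exists\mathbb{R}^<_{\sin}$) is the class of decision problems reducible to the set of existential sentences (built from atoms $t<t'$ and, for $\exists\mathbb{R}_{\sin}$, $t=t'$, using only $\land,\lor,\exists$) true in $\mathbb{R}_{\sin}$ (resp. $\mathbb{R}^<_{\sin}$); here, as assumed in the claim, the reductions allowed are computable many-one reductions. $\Sigma^0_k$ is the $k$-th existential level of the arithmetical hierarchy. *)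

theory Defs
  imports Complex_Main "HOL-Library.Nat_Bijection"
begin

text \<open>
  Kleene's general recursive functions: the least class of total functions on tuples of naturals
  that contains the initial functions and is closed under composition, primitive recursion, and
  minimization of regular functions, i.e. those for which the minimum always exists. A function of
  arity \<open>n\<close> is modelled on \<open>nat list\<close>; only its values on lists of length \<open>n\<close> matter, which the
  rule \<open>rec_ext\<close> makes explicit.
\<close>

inductive recursive :: "nat \<Rightarrow> (nat list \<Rightarrow> nat) \<Rightarrow> bool" where
  rec_zero: "recursive n (\<lambda>xs. 0)"
| rec_succ: "recursive 1 (\<lambda>xs. Suc (hd xs))"
| rec_proj: "i < n \<Longrightarrow> recursive n (\<lambda>xs. xs ! i)"
| rec_comp: "recursive (length gs) f \<Longrightarrow> \<forall>g \<in> set gs. recursive n g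
    \<Longrightarrow> recursive n (\<lambda>xs. f (map (\<lambda>g. g xs) gs))"
| rec_prim: "recursive n f \<Longrightarrow> recursive (Suc (Suc n)) g
    \<Longrightarrow> recursive (Suc n) (\<lambda>xs. rec_nat (f (tl xs)) (\<lambda>y r. g (y # r # tl xs)) (hd xs))"
| rec_mu: "recursive (Suc n) f \<Longrightarrow> \<forall>xs. length xs = n \<longrightarrow> (\<exists>y. f (y # xs) = 0)
    \<Longrightarrow> recursive n (\<lambda>xs. LEAST y. f (y # xs) = 0)"
| rec_ext: "recursive n f \<Longrightarrow> \<forall>xs. length xs = n \<longrightarrow> f xs = g xs \<Longrightarrow> recursive n g"

definition computable :: "(nat \<Rightarrow> nat) \<Rightarrow> bool" where
  "computable f \<longleftrightarrow> recursive 1 (\<lambda>xs. f (hd xs))"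

definition decidable_rel :: "nat \<Rightarrow> (nat list \<Rightarrow> bool) \<Rightarrow> bool" where
  "decidable_rel n R \<longleftrightarrow> recursive n (\<lambda>xs. if R xs then 1 else 0)"

fun sigma_rel pi_rel :: "nat \<Rightarrow> nat \<Rightarrow> (nat list \<Rightarrow> bool) \<Rightarrow> bool" where
  "sigma_rel 0 n R \<longleftrightarrow> decidable_rel n R"
| "sigma_rel (Suc k) n R \<longleftrightarrow>
     (\<exists>S. pi_rel k (Suc n) S \<and> (\<forall>xs. length xs = n \<longrightarrow> (R xs \<longleftrightarrow> (\<exists>y. S (y # xs)))))"
| "pi_rel 0 n R \<longleftrightarrow> decidable_rel n R"
| "pi_rel (Suc k) n R \<longleftrightarrow>
     (\<exists>S. sigma_rel k (Suc n) S \<and> (\<forall>xs. length xs = n \<longrightarrow> (R xs \<longleftrightarrow> (\<forall>y. S (y # xs)))))"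

text \<open>Decision problems are sets of natural numbers.\<close>

definition Sigma0 :: "nat \<Rightarrow> nat set set" where
  "Sigma0 k = {A. sigma_rel k 1 (\<lambda>xs. hd xs \<in> A)}"

definition many_one_reducible :: "nat set \<Rightarrow> nat set \<Rightarrow> bool" (infix "\<le>\<^sub>m" 50) where
  "A \<le>\<^sub>m B \<longleftrightarrow> (\<exists>f. computable f \<and> (\<forall>x. x \<in> A \<longleftrightarrow> f x \<in> B))"

datatype sin_term =
    Var nat
  | Zero
  | One
  | Add sin_term sin_term
  | Mult sin_term sin_term
  | Sin sin_term

datatype ex_formula =
    Less sin_term sin_term
  | Equal sin_term sin_term
  | Conj ex_formula ex_formula
  | Disj ex_formula ex_formula
  | Exists nat ex_formula

primrec term_vars :: "sin_term \<Rightarrow> nat set" where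
  "term_vars (Var i) = {i}"
| "term_vars Zero = {}"
| "term_vars One = {}"
| "term_vars (Add s t) = term_vars s \<union> term_vars t"
| "term_vars (Mult s t) = term_vars s \<union> term_vars t"
| "term_vars (Sin t) = term_vars t"

primrec free_vars :: "ex_formula \<Rightarrow> nat set" where
  "free_vars (Less s t) = term_vars s \<union> term_vars t"
| "free_vars (Equal s t) = term_vars s \<union> term_vars t"
| "free_vars (Conj p q) = free_vars p \<union> free_vars q"
| "free_vars (Disj p q) = free_vars p \<union> free_vars q"
| "free_vars (Exists i p) = free_vars p - {i}"

definition sentence :: "ex_formula \<Rightarrow> bool" where
  "sentence p \<longleftrightarrow> free_vars p = {}"

primrec equality_free :: "ex_formula \<Rightarrow> bool" where
  "equality_free (Less s t) \<longleftrightarrow> True"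
| "equality_free (Equal s t) \<longleftrightarrow> False"
| "equality_free (Conj p q) \<longleftrightarrow> equality_free p \<and> equality_free q"
| "equality_free (Disj p q) \<longleftrightarrow> equality_free p \<and> equality_free q"
| "equality_free (Exists i p) \<longleftrightarrow> equality_free p"

primrec term_val :: "(nat \<Rightarrow> real) \<Rightarrow> sin_term \<Rightarrow> real" where
  "term_val e (Var i) = e i"
| "term_val e Zero = 0"
| "term_val e One = 1"
| "term_val e (Add s t) = term_val e s + term_val e t"
| "term_val e (Mult s t) = term_val e s * term_val e t"
| "term_val e (Sin t) = sin (term_val e t)"

primrec holds :: "(nat \<Rightarrow> real) \<Rightarrow> ex_formula \<Rightarrow> bool" where
  "holds e (Less s t) \<longleftrightarrow> term_val e s < term_val e t"
| "holds e (Equal s t) \<longleftrightarrow> term_val e s = term_val e t"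
| "holds e (Conj p q) \<longleftrightarrow> holds e p \<and> holds e q"
| "holds e (Disj p q) \<longleftrightarrow> holds e p \<or> holds e q"
| "holds e (Exists i p) \<longleftrightarrow> (\<exists>x. holds (e(i := x)) p)"

lemma term_val_cong:
  "(\<And>i. i \<in> term_vars t \<Longrightarrow> e i = e' i) \<Longrightarrow> term_val e t = term_val e' t"
  by (induction t) auto

lemma holds_cong:
  "(\<And>i. i \<in> free_vars p \<Longrightarrow> e i = e' i) \<Longrightarrow> holds e p = holds e' p"
proof (induction p arbitrary: e e')
  case (Less s t)
  then show ?case using term_val_cong[of s e e'] term_val_cong[of t e e'] by simp
next
  case (Equal s t)
  then show ?case using term_val_cong[of s e e'] term_val_cong[of t e e'] by simp
next
  case (Conj p q)
  then show ?case by (metis UnCI free_vars.simps(3) holds.simps(3))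
next
  case (Disj p q)
  then show ?case by (metis UnCI free_vars.simps(4) holds.simps(4))
next
  case (Exists i p)
  have "holds (e(i := x)) p = holds (e'(i := x)) p" for x
    by (rule Exists.IH) (use Exists.prems in auto)
  then show ?case by simp
qed

definition true_sentence :: "ex_formula \<Rightarrow> bool" where
  "true_sentence p \<longleftrightarrow> sentence p \<and> (\<forall>e. holds e p)"

lemma true_sentence_iff_holds: "sentence p \<Longrightarrow> true_sentence p \<longleftrightarrow> holds e p"
  unfolding true_sentence_def sentence_def by (metis empty_iff holds_cong)

text \<open>
  An explicit Goedel numbering is used, because the numbering provided by the class \<open>countable\<close>
  need not be effective.
\<close>

primrec term_code :: "sin_term \<Rightarrow> nat" where
  "term_code (Var i) = prod_encode (0, i)"
| "term_code Zero = prod_encode (1, 0)"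
| "term_code One = prod_encode (2, 0)"
| "term_code (Add s t) = prod_encode (3, prod_encode (term_code s, term_code t))"
| "term_code (Mult s t) = prod_encode (4, prod_encode (term_code s, term_code t))"
| "term_code (Sin t) = prod_encode (5, term_code t)"

primrec formula_code :: "ex_formula \<Rightarrow> nat" where
  "formula_code (Less s t) = prod_encode (0, prod_encode (term_code s, term_code t))"
| "formula_code (Equal s t) = prod_encode (1, prod_encode (term_code s, term_code t))"
| "formula_code (Conj p q) = prod_encode (2, prod_encode (formula_code p, formula_code q))"
| "formula_code (Disj p q) = prod_encode (3, prod_encode (formula_code p, formula_code q))"
| "formula_code (Exists i p) = prod_encode (4, prod_encode (i, formula_code p))"

lemma term_code_inject: "term_code s = term_code t \<longleftrightarrow> s = t"
proof (induction s arbitrary: t)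
  case (Var i) then show ?case by (cases t) auto
next
  case Zero then show ?case by (cases t) auto
next
  case One then show ?case by (cases t) auto
next
  case (Add s1 s2) then show ?case by (cases t) auto
next
  case (Mult s1 s2) then show ?case by (cases t) auto
next
  case (Sin s) then show ?case by (cases t) auto
qed

lemma formula_code_inject: "formula_code p = formula_code q \<longleftrightarrow> p = q"
proof (induction p arbitrary: q)
  case (Less s t) then show ?case by (cases q) (auto simp: term_code_inject)
next
  case (Equal s t) then show ?case by (cases q) (auto simp: term_code_inject)
next
  case (Conj p1 p2) then show ?case by (cases q) auto
next
  case (Disj p1 p2) then show ?case by (cases q) auto
next
  case (Exists i p) then show ?case by (cases q) auto
qed

definition Th_sin :: "nat set" where
  "Th_sin = {formula_code p | p. true_sentence p}"

definition Th_sin_less :: "nat set" where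
  "Th_sin_less = {formula_code p | p. equality_free p \<and> true_sentence p}"

definition ER_sin :: "nat set set" where
  "ER_sin = {A. A \<le>\<^sub>m Th_sin}"

definition ER_sin_less :: "nat set set" where
  "ER_sin_less = {A. A \<le>\<^sub>m Th_sin_less}"

end

theory Submission
  imports Defs "HOL-Library.Infinite_Set"
begin

text \<open>
  Upper bounds: a true existential sentence has bounded witnesses and a positive margin in its strict
  inequalities, and by compactness it holds if it holds, for a fixed bound and margin, up to every
  positive error. Truth up to an error is an open condition, so it is witnessed by rational numbers
  and by derivations with rational intervals. Hence truth has the form \<open>\<exists>M. \<forall>d. \<exists>w\<close>. Without
  equations an error is not needed and two existential quantifiers remain.

  Lower bounds: a recursively enumerable set is accepted by a nondeterministic counter program. The
  digits of a few natural numbers describe a run of the program, and the run is correct if these numbers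
  satisfy linear equations and bitwise comparisons. Bitwise comparison reduces to the parity of binomial
  coefficients and thus to powers. The sine yields powers: if \<open>e\<^sup>i\<^sup>\<theta> = (u + i)\<^sup>2 / (u\<^sup>2 + 1)\<close> with \<open>u\<close>
  even, then \<open>(u\<^sup>2 + 1)\<^sup>n\<close> is the exact denominator of \<open>e\<^sup>i\<^sup>n\<^sup>\<theta>\<close>. The zeros of the sine single out the
  natural numbers. In strict sentences all equations are replaced by approximations. These can be
  rounded as soon as the precision is high enough compared with all numbers involved, among them a bound
  for \<open>(u\<^sup>2 + 1)\<^sup>n\<close>, which comes from Pell's equation.
\<close>

section \<open>Computability of coded operations\<close>

text \<open>Both lower bounds come from one reduction, whose sentences are equality-free. The
  obstacle is that a strict sentence pins down no real number, so each relation between naturals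
  must tolerate an error. Sums and products do so easily. An exponential relation
  \<open>m * e^(i n \<theta>) = A + i B\<close> is harder: an approximate solution is recognized as
  exact by clearing the denominator \<open>(u * u + 1) ^ n\<close>, so the error must be small
  compared with the very power that is to be defined. Pell's equation breaks this circle. Only the
  residues and the growth of its solutions are used; they force some variable \<open>y\<close> above
  the power, and the precision is chosen relative to a bound on all variables, \<open>y\<close>
  among them. Hence the strong and the weak reading of constraints: the sentence is implied by the
  strong one and implies the weak one. In the upper bounds one parameter \<open>M\<close> serves as
  bound on the witnesses and as margin of strict inequalities, while \<open>d\<close> measures the
  error. In equality-free formulas \<open>d = M\<close> may be taken; margin and error then cancel,
  and the quantifier over \<open>d\<close> disappears.\<close>

named_theorems rec_intros

lemma recursive_cong:
  assumes "recursive n f" "\<And>xs. length xs = n \<Longrightarrow> f xs = g xs"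
  shows "recursive n g"
  using assms rec_ext by blast

lemma recursive_comp1:
  assumes "recursive 1 (\<lambda>xs. F (hd xs))" "recursive n g"
  shows "recursive n (\<lambda>xs. F (g xs))"
  using rec_comp[of "[g]" "\<lambda>xs. F (hd xs)" n] assms by simp

lemma recursive_comp2:
  assumes "recursive 2 (\<lambda>xs. F (xs ! 0) (xs ! 1))" "recursive n f" "recursive n g"
  shows "recursive n (\<lambda>xs. F (f xs) (g xs))"
  using rec_comp[of "[f, g]" "\<lambda>xs. F (xs ! 0) (xs ! 1)" n] assms by (simp add: numeral_2_eq_2)

lemma recursive_Cons:
  assumes "recursive (Suc n) F" "recursive n g"
  shows "recursive n (\<lambda>xs. F (g xs # xs))"
proof -
  let ?ps = "map (\<lambda>i xs. xs ! i) [0..<n]"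
  have "recursive n (\<lambda>xs. F (map (\<lambda>g. g xs) (g # ?ps)))"
    by (rule rec_comp) (use assms in \<open>auto intro: rec_proj\<close>)
  then show ?thesis
    by (rule recursive_cong) (auto simp: comp_def intro!: arg_cong[where f = F] nth_equalityI)
qed

lemma recursive_tl:
  assumes "recursive n f"
  shows "recursive (Suc n) (\<lambda>xs. f (tl xs))"
proof -
  let ?ps = "map (\<lambda>i xs. xs ! Suc i) [0..<n]"
  have "recursive (Suc n) (\<lambda>xs. f (map (\<lambda>g. g xs) ?ps))"
    by (rule rec_comp) (use assms in \<open>auto intro: rec_proj\<close>)
  then show ?thesis
    by (rule recursive_cong)
      (auto simp: comp_def nth_tl intro!: arg_cong[where f = f] nth_equalityI)
qed

lemma recursive_rec_nat:
  assumes "recursive n b" "recursive (Suc (Suc n)) g" "recursive n c"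
  shows "recursive n (\<lambda>xs. rec_nat (b xs) (\<lambda>y r. g (y # r # xs)) (c xs))"
  using recursive_Cons[OF rec_prim[OF assms(1,2)] assms(3)] by simp

lemma recursive_Suc [rec_intros]: "recursive n f \<Longrightarrow> recursive n (\<lambda>xs. Suc (f xs))"
  by (rule recursive_comp1[OF rec_succ])

lemma recursive_const [rec_intros]: "recursive n (\<lambda>xs. c)"
  by (induction c) (auto intro: rec_zero recursive_Suc)

lemmas recursive_nth [rec_intros] = rec_proj

lemma recursive_hd [rec_intros]: "0 < n \<Longrightarrow> recursive n hd"
  by (rule recursive_cong[OF rec_proj[of 0]]) (auto simp: hd_conv_nth)

lemma recursive_nat_rec:
  assumes "recursive n b" "recursive 2 (\<lambda>xs. g (xs ! 0) (xs ! 1))" "recursive n c"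
  shows "recursive n (\<lambda>xs. rec_nat (b xs) g (c xs))"
proof -
  have "recursive (Suc (Suc n)) (\<lambda>xs. g (xs ! 0) (xs ! 1))"
    by (rule recursive_comp2[OF assms(2)]; intro rec_intros; simp)
  from recursive_rec_nat[OF assms(1) this assms(3)] show ?thesis by simp
qed

lemma recursive_add [rec_intros]:
  assumes "recursive n f" "recursive n g"
  shows "recursive n (\<lambda>xs. f xs + g xs)"
proof -
  have "recursive n (\<lambda>xs. rec_nat (g xs) (\<lambda>y r. Suc r) (f xs))"
    by (intro recursive_nat_rec rec_intros assms) simp
  moreover have "rec_nat b (\<lambda>y r. Suc r) a = a + b" for a b :: nat by (induction a) auto
  ultimately show ?thesis by simp
qed

lemma recursive_mult [rec_intros]:
  assumes "recursive n f" "recursive n g"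
  shows "recursive n (\<lambda>xs. f xs * g xs)"
proof -
  let ?h = "\<lambda>ys::nat list. ys ! 1 + g (tl (tl ys))"
  have "recursive (Suc (Suc n)) ?h"
    by (intro recursive_add recursive_nth recursive_tl assms) auto
  from recursive_rec_nat[OF recursive_const[of n 0] this assms(1)]
  have "recursive n (\<lambda>xs. rec_nat 0 (\<lambda>y r. r + g xs) (f xs))" by simp
  moreover have "rec_nat 0 (\<lambda>y r. r + b) a = a * b" for a b :: nat by (induction a) auto
  ultimately show ?thesis by simp
qed

lemma recursive_diff [rec_intros]:
  assumes "recursive n f" "recursive n g"
  shows "recursive n (\<lambda>xs. f xs - g xs)"
proof -
  have pred: "recursive m (\<lambda>xs. h xs - 1)" if "recursive m h" for m h
  proof -
    have "recursive m (\<lambda>xs. rec_nat 0 (\<lambda>y r. y) (h xs))"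
      by (intro recursive_nat_rec rec_intros that) simp
    moreover have "rec_nat 0 (\<lambda>y r. y) a = a - 1" for a :: nat by (cases a) auto
    ultimately show ?thesis by simp
  qed
  have "recursive n (\<lambda>xs. rec_nat (f xs) (\<lambda>y r. r - 1) (g xs))"
    by (intro recursive_nat_rec pred rec_intros assms) simp
  moreover have "rec_nat b (\<lambda>y r. r - 1) a = b - a" for a b :: nat by (induction a) auto
  ultimately show ?thesis by simp
qed

lemma decidable_rel_cong:
  assumes "decidable_rel n P" "\<And>xs. length xs = n \<Longrightarrow> P xs = Q xs"
  shows "decidable_rel n Q"
  using assms unfolding decidable_rel_def by (auto elim: recursive_cong)

lemma decidable_zero [rec_intros]: "recursive n f \<Longrightarrow> decidable_rel n (\<lambda>xs. f xs = 0)"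
  unfolding decidable_rel_def
  by (rule recursive_cong[OF recursive_diff[OF recursive_const[of n 1]], of f]) auto

lemma decidable_not [rec_intros]: "decidable_rel n P \<Longrightarrow> decidable_rel n (\<lambda>xs. \<not> P xs)"
  using decidable_zero[of n "\<lambda>xs. if P xs then 1 else 0"]
  by (auto simp: decidable_rel_def[of n P] elim: decidable_rel_cong)

lemma decidable_conj [rec_intros]:
  assumes "decidable_rel n P" "decidable_rel n Q"
  shows "decidable_rel n (\<lambda>xs. P xs \<and> Q xs)"
  unfolding decidable_rel_def
  by (rule recursive_cong[OF recursive_mult[OF assms[unfolded decidable_rel_def]]]) auto

lemma decidable_disj [rec_intros]:
  assumes "decidable_rel n P" "decidable_rel n Q"
  shows "decidable_rel n (\<lambda>xs. P xs \<or> Q xs)"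
  by (rule decidable_rel_cong[OF decidable_not[OF decidable_conj
          [OF decidable_not[OF assms(1)] decidable_not[OF assms(2)]]]]) auto

lemma decidable_le [rec_intros]:
  assumes "recursive n f" "recursive n g"
  shows "decidable_rel n (\<lambda>xs. f xs \<le> g xs)"
  by (rule decidable_rel_cong[OF decidable_zero[OF recursive_diff[OF assms]]]) auto

lemma decidable_less [rec_intros]:
  assumes "recursive n f" "recursive n g"
  shows "decidable_rel n (\<lambda>xs. f xs < g xs)"
  by (rule decidable_rel_cong[OF decidable_not[OF decidable_le[OF assms(2,1)]]]) auto

lemma decidable_eq [rec_intros]:
  assumes "recursive n f" "recursive n g"
  shows "decidable_rel n (\<lambda>xs. f xs = g xs)"
  by (rule decidable_rel_cong[OF decidable_conj[OF decidable_le[OF assms] decidable_le[OF assms(2,1)]]])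
    auto

text \<open>Primitive recursion sums the values of the characteristic function below the bound; a
  witness exists iff the sum is not zero.\<close>

lemma decidable_ex_less:
  assumes "decidable_rel (Suc n) P" "recursive n b"
  shows "decidable_rel n (\<lambda>xs. \<exists>y<b xs. P (y # xs))"
proof -
  define p :: "nat list \<Rightarrow> nat" where "p xs = (if P xs then 1 else 0)" for xs
  have p: "recursive (Suc n) p" using assms(1) unfolding decidable_rel_def p_def .
  \<comment> \<open>The recursion step sees counter, accumulator and parameters; the accumulator has
    to be skipped before \<open>p\<close> is applied.\<close>
  have "recursive (Suc (Suc n)) (\<lambda>ys. (\<lambda>xs. p (hd ys # xs)) (tl (tl ys)))"
  proof -
    let ?ps = "hd # map (\<lambda>i xs. xs ! Suc (Suc i)) [0..<n]"
    have "recursive (Suc (Suc n)) (\<lambda>xs. p (map (\<lambda>g. g xs) ?ps))"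
      by (rule rec_comp) (use p in \<open>auto intro!: rec_intros\<close>)
    then show ?thesis
      by (rule recursive_cong)
        (auto simp: comp_def nth_tl intro!: arg_cong[where f = p] nth_equalityI)
  qed
  then have "recursive (Suc (Suc n)) (\<lambda>ys. ys ! 1 + p (hd ys # tl (tl ys)))"
    by (intro rec_intros) simp_all
  from recursive_rec_nat[OF recursive_const[of n 0] this assms(2)]
  have "recursive n (\<lambda>xs. rec_nat 0 (\<lambda>y r. r + p (y # xs)) (b xs))" by simp
  then have "decidable_rel n (\<lambda>xs. \<not> rec_nat 0 (\<lambda>y r. r + p (y # xs)) (b xs) = 0)" by (intro rec_intros)
  moreover have "rec_nat 0 (\<lambda>y r. r + p (y # xs)) m = 0 \<longleftrightarrow> \<not> (\<exists>y<m. P (y # xs))" for xs m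
    by (induction m) (auto simp: p_def less_Suc_eq)
  ultimately show ?thesis by simp
qed

lemma recursive_Least:
  assumes "decidable_rel (Suc n) P" "\<And>xs. length xs = n \<Longrightarrow> \<exists>y. P (y # xs)"
  shows "recursive n (\<lambda>xs. LEAST y. P (y # xs))"
proof -
  have "recursive (Suc n) (\<lambda>xs. if \<not> P xs then 1 else 0)"
    using decidable_not[OF assms(1)] unfolding decidable_rel_def .
  moreover have "(if \<not> b then 1 else 0) = (0::nat) \<longleftrightarrow> b" for b by simp
  ultimately show ?thesis using rec_mu[of n "\<lambda>xs. if \<not> P xs then 1 else 0"] assms(2) by presburger
qed

lemma recursive_prod_encode [rec_intros]:
  assumes "recursive n f" "recursive n g"
  shows "recursive n (\<lambda>xs. prod_encode (f xs, g xs))"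
proof -
  have "recursive n (\<lambda>xs. rec_nat 0 (\<lambda>y r. r + Suc y) (f xs + g xs) + f xs)"
    by (intro recursive_add recursive_nat_rec recursive_Suc assms recursive_nth recursive_const) auto
  moreover have "rec_nat 0 (\<lambda>y r. r + Suc y) a = triangle a" for a by (induction a) auto
  ultimately show ?thesis by (simp add: prod_encode_def)
qed

definition pfst :: "nat \<Rightarrow> nat" where "pfst z = fst (prod_decode z)"
definition psnd :: "nat \<Rightarrow> nat" where "psnd z = snd (prod_decode z)"

lemma pfst_encode [simp]: "pfst (prod_encode (a, b)) = a" by (simp add: pfst_def)
lemma psnd_encode [simp]: "psnd (prod_encode (a, b)) = b" by (simp add: psnd_def)
lemma encode_pfst_psnd [simp]: "prod_encode (pfst z, psnd z) = z"
  by (simp add: pfst_def psnd_def)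

lemma recursive_pfst [rec_intros]:
  assumes "recursive n f"
  shows "recursive n (\<lambda>xs. pfst (f xs))"
proof (rule recursive_comp1[OF _ assms])
  have "decidable_rel 2 (\<lambda>xs. \<exists>y<Suc (xs ! 1). prod_encode ((y # xs) ! 1, (y # xs) ! 0) = (y # xs) ! 2)"
    by (intro decidable_ex_less rec_intros) simp_all
  then have "recursive 1 (\<lambda>xs. LEAST a. \<exists>y<Suc ((a # xs) ! 1).
      prod_encode ((y # a # xs) ! 1, (y # a # xs) ! 0) = (y # a # xs) ! 2)"
    (is "recursive 1 ?f")
  proof (intro recursive_Least)
    fix xs :: "nat list"
    have "\<exists>y<Suc (xs ! 0). prod_encode (pfst (xs ! 0), y) = xs ! 0"
      using le_prod_encode_2[of "psnd (xs ! 0)" "pfst (xs ! 0)"]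
      by (intro exI[of _ "psnd (xs ! 0)"]) (simp add: less_Suc_eq_le)
    then show "\<exists>a. \<exists>y<Suc ((a # xs) ! 1). prod_encode ((y # a # xs) ! 1, (y # a # xs) ! 0) = (y # a # xs) ! 2"
      by auto
  qed (simp add: numeral_2_eq_2)
  then show "recursive 1 (\<lambda>xs. pfst (hd xs))"
  proof (rule recursive_cong)
    fix xs :: "nat list" assume "length xs = 1"
    then obtain z where [simp]: "xs = [z]" by (auto simp: length_Suc_conv)
    show "?f xs = pfst (hd xs)"
    proof (rule Least_equality)
      show "\<exists>y<Suc ((pfst (hd xs) # xs) ! 1). prod_encode ((y # pfst (hd xs) # xs) ! 1,
          (y # pfst (hd xs) # xs) ! 0) = (y # pfst (hd xs) # xs) ! 2"
        using le_prod_encode_2[of "psnd z" "pfst z"]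
        by (auto intro!: exI[of _ "psnd z"] simp: less_Suc_eq_le)
    qed auto
  qed
qed

lemma recursive_psnd [rec_intros]:
  assumes "recursive n f"
  shows "recursive n (\<lambda>xs. psnd (f xs))"
proof (rule recursive_comp1[OF _ assms])
  have "decidable_rel 2 (\<lambda>xs. prod_encode (pfst (xs ! 1), xs ! 0) = xs ! 1)"
    by (intro rec_intros) simp_all
  then have "recursive 1 (\<lambda>xs. LEAST a. prod_encode (pfst ((a # xs) ! 1), (a # xs) ! 0) = (a # xs) ! 1)"
    (is "recursive 1 ?f")
  proof (intro recursive_Least)
    show "\<exists>a. prod_encode (pfst ((a # xs) ! 1), (a # xs) ! 0) = (a # xs) ! 1"
      for xs :: "nat list"
      by (auto intro!: exI[of _ "psnd (xs ! 0)"])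
  qed (simp add: numeral_2_eq_2)
  then show "recursive 1 (\<lambda>xs. psnd (hd xs))"
  proof (rule recursive_cong)
    fix xs :: "nat list" assume "length xs = 1"
    then obtain z where [simp]: "xs = [z]" by (auto simp: length_Suc_conv)
    show "?f xs = psnd (hd xs)"
      by (rule Least_equality) (auto, metis psnd_encode order_refl)
  qed
qed

section \<open>Inductively generated sets of numbers\<close>

text \<open>Every rule has exactly two premises; 0 is the only axiom and doubles as dummy premise of
  rules that need fewer.\<close>

inductive derivable :: "(nat \<Rightarrow> nat \<Rightarrow> nat \<Rightarrow> bool) \<Rightarrow> nat \<Rightarrow> bool" for R where
  derivable_0: "derivable R 0"
| derivable_step: "derivable R y \<Longrightarrow> derivable R z \<Longrightarrow> R x y z \<Longrightarrow> derivable R x"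

text \<open>The predecessors undo the \<open>Suc\<close> that \<open>list_encode\<close> puts around
  the pair of head and tail.\<close>

definition code_nth :: "nat \<Rightarrow> nat \<Rightarrow> nat" where
  "code_nth w i = pfst (rec_nat w (\<lambda>y r. psnd (r - 1)) i - 1)"

lemma code_nth_list_encode: "i < length xs \<Longrightarrow> code_nth (list_encode xs) i = xs ! i"
proof -
  have "rec_nat (list_encode xs) (\<lambda>y r. psnd (r - 1)) i = list_encode (drop i xs)" if "i \<le> length xs"
    using that
  proof (induction i)
    case (Suc i)
    then have "drop i xs = xs ! i # drop (Suc i) xs" by (simp add: Cons_nth_drop_Suc)
    with Suc show ?case by simp
  qed simp
  moreover assume "i < length xs"
  moreover from this have "drop i xs = xs ! i # drop (Suc i) xs" by (simp add: Cons_nth_drop_Suc)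
  ultimately show ?thesis by (simp add: code_nth_def)
qed

lemma recursive_code_nth [rec_intros]:
  assumes "recursive n f" "recursive n g"
  shows "recursive n (\<lambda>xs. code_nth (f xs) (g xs))"
  unfolding code_nth_def by (intro rec_intros recursive_nat_rec assms) simp_all

lemma decidable_comp3:
  assumes "decidable_rel 3 (\<lambda>xs. R (xs ! 0) (xs ! 1) (xs ! 2))"
    "recursive n f" "recursive n g" "recursive n h"
  shows "decidable_rel n (\<lambda>xs. R (f xs) (g xs) (h xs))"
  using rec_comp[of "[f, g, h]" "\<lambda>xs. if R (xs ! 0) (xs ! 1) (xs ! 2) then 1 else 0" n] assms
  unfolding decidable_rel_def by (simp add: numeral_3_eq_3 numeral_2_eq_2)

primrec justified :: "(nat \<Rightarrow> nat \<Rightarrow> nat \<Rightarrow> bool) \<Rightarrow> nat list \<Rightarrow> bool" where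
  "justified R [] \<longleftrightarrow> True"
| "justified R (x # xs) \<longleftrightarrow> justified R xs \<and> (x = 0 \<or> (\<exists>y\<in>set xs. \<exists>z\<in>set xs. R x y z))"

lemma justified_append: "justified R xs \<Longrightarrow> justified R ys \<Longrightarrow> justified R (xs @ ys)"
  by (induction xs) auto

lemma justified_nth:
  "justified R xs \<Longrightarrow> i < length xs \<Longrightarrow>
    xs ! i = 0 \<or> (\<exists>j<length xs. \<exists>k<length xs. i < j \<and> i < k \<and> R (xs ! i) (xs ! j) (xs ! k))"
proof (induction xs arbitrary: i)
  case (Cons x xs)
  let ?ys = "x # xs"
  show ?case
  proof (cases i)
    case 0
    from Cons.prems(1) consider "x = 0" | y z where "y \<in> set xs" "z \<in> set xs" "R x y z" by auto
    then show ?thesis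
    proof cases
      case 2
      then obtain j k where "j < length xs" "k < length xs" "xs ! j = y" "xs ! k = z"
        by (auto simp: in_set_conv_nth)
      with 2 0 have "Suc j < length ?ys \<and> Suc k < length ?ys \<and> i < Suc j \<and> i < Suc k \<and>
        R (?ys ! i) (?ys ! Suc j) (?ys ! Suc k)" by simp
      then show ?thesis by blast
    qed (simp add: 0)
  next
    case (Suc i')
    with Cons.prems Cons.IH[of i'] consider "xs ! i' = 0"
      | j k where "j < length xs" "k < length xs" "i' < j" "i' < k" "R (xs ! i') (xs ! j) (xs ! k)"
      by auto
    then show ?thesis
    proof cases
      case 2
      with Suc have "Suc j < length ?ys \<and> Suc k < length ?ys \<and> i < Suc j \<and> i < Suc k \<and>
        R (?ys ! i) (?ys ! Suc j) (?ys ! Suc k)" by simp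
      then show ?thesis by blast
    qed (simp add: Suc)
  qed
qed simp

text \<open>A derivation tree is flattened with each conclusion to the left of its premises, so that
  derivations of two premises can simply be appended.\<close>

lemma derivable_justified: "derivable R x \<Longrightarrow> \<exists>xs. justified R (x # xs)"
proof (induction rule: derivable.induct)
  case derivable_0
  have "justified R (0 # [])" by simp
  then show ?case by blast
next
  case (derivable_step y z x)
  then obtain ys zs where "justified R (y # ys)" "justified R (z # zs)" by blast
  then have "justified R ((y # ys) @ (z # zs))" by (rule justified_append)
  then have "justified R (x # (y # ys) @ (z # zs))" using derivable_step.hyps by auto
  then show ?case by blast
qed

text \<open>The length is stored beside the list code, since \<open>code_nth\<close> returns a value
  at every index, even beyond the end of the list.\<close>

definition derivation :: "(nat \<Rightarrow> nat \<Rightarrow> nat \<Rightarrow> bool) \<Rightarrow> nat \<Rightarrow> nat \<Rightarrow> bool" where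
  "derivation R w x \<longleftrightarrow> 0 < pfst w \<and> x = code_nth (psnd w) 0 \<and>
    (\<forall>i<pfst w. code_nth (psnd w) i = 0 \<or>
      (\<exists>j<pfst w. \<exists>k<pfst w. i < j \<and> i < k \<and>
        R (code_nth (psnd w) i) (code_nth (psnd w) j) (code_nth (psnd w) k)))"

text \<open>Turns an inductive definition into one existential quantifier over a decidable relation;
  the quantifier count of the upper bounds rests on this.\<close>

lemma derivable_iff_derivation: "derivable R x \<longleftrightarrow> (\<exists>w. derivation R w x)"
proof
  assume "derivable R x"
  then obtain ys where ys: "justified R ys" "0 < length ys" "ys ! 0 = x"
    using derivable_justified[of R x] by (metis length_pos_if_in_set list.set_intros(1) nth_Cons_0)
  have nth: "code_nth (list_encode ys) i = ys ! i" if "i < length ys" for i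
    using that by (rule code_nth_list_encode)
  have "code_nth (list_encode ys) i = 0 \<or> (\<exists>j<length ys. \<exists>k<length ys. i < j \<and> i < k \<and>
      R (code_nth (list_encode ys) i) (code_nth (list_encode ys) j) (code_nth (list_encode ys) k))"
    if "i < length ys" for i
    using justified_nth[OF ys(1) that]
  proof (elim disjE exE conjE)
    fix j k
    assume "j < length ys" "k < length ys" "i < j" "i < k" "R (ys ! i) (ys ! j) (ys ! k)"
    moreover from this have "R (code_nth (list_encode ys) i) (code_nth (list_encode ys) j)
        (code_nth (list_encode ys) k)" by (simp add: nth that)
    ultimately have "\<exists>k<length ys. i < j \<and> i < k \<and> R (code_nth (list_encode ys) i)
        (code_nth (list_encode ys) j) (code_nth (list_encode ys) k)" by auto
    then have "\<exists>j<length ys. \<exists>k<length ys. i < j \<and> i < k \<and> R (code_nth (list_encode ys) i)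
        (code_nth (list_encode ys) j) (code_nth (list_encode ys) k)"
      using \<open>j < length ys\<close> by - (rule exI[of _ j], rule conjI)
    then show ?thesis by (rule disjI2)
  qed (simp add: nth that)
  moreover have "x = code_nth (list_encode ys) 0" using ys nth[of 0] by simp
  ultimately have "derivation R (prod_encode (length ys, list_encode ys)) x"
    unfolding derivation_def pfst_encode psnd_encode using ys(2) by (intro conjI allI impI)
  then show "\<exists>w. derivation R w x" by (rule exI)
next
  assume "\<exists>w. derivation R w x"
  then obtain w where w: "derivation R w x" by blast
  then have just: "code_nth (psnd w) i = 0 \<or>
      (\<exists>j<pfst w. \<exists>k<pfst w. i < j \<and> i < k \<and>
        R (code_nth (psnd w) i) (code_nth (psnd w) j) (code_nth (psnd w) k))" if "i < pfst w" for i
    using that by (simp only: derivation_def)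
  \<comment> \<open>Premises have larger indices, so the distance to the end of the list
    decreases.\<close>
  have "derivable R (code_nth (psnd w) i)" if "i < pfst w" for i
    using that
  proof (induction "pfst w - i" arbitrary: i rule: less_induct)
    case less
    from just[OF less.prems] show ?case
    proof (elim disjE exE conjE)
      fix j k
      assume "j < pfst w" "k < pfst w" "i < j" "i < k"
        and R: "R (code_nth (psnd w) i) (code_nth (psnd w) j) (code_nth (psnd w) k)"
      then have "derivable R (code_nth (psnd w) j)" "derivable R (code_nth (psnd w) k)"
        by (auto intro!: less.hyps)
      then show ?thesis using R by (rule derivable_step)
    qed (simp add: derivable_0)
  qed
  with w show "derivable R x" by (simp only: derivation_def)
qed

text \<open>Bounded quantifiers are introduced from the inside outwards, the universal one as a
  negated existential one.\<close>

lemma decidable_derivation: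
  assumes "decidable_rel 3 (\<lambda>xs. R (xs ! 0) (xs ! 1) (xs ! 2))"
    and f: "recursive n f" and g: "recursive n g"
  shows "decidable_rel n (\<lambda>xs. derivation R (f xs) (g xs))"
proof -
  note R = decidable_comp3[OF assms(1)]
  have "decidable_rel 5 (\<lambda>xs. xs ! 2 < xs ! 1 \<and> xs ! 2 < xs ! 0 \<and>
      R (code_nth (psnd (xs ! 3)) (xs ! 2)) (code_nth (psnd (xs ! 3)) (xs ! 1))
        (code_nth (psnd (xs ! 3)) (xs ! 0)))"
    by (intro rec_intros R) simp_all
  then have "decidable_rel (Suc 4) (\<lambda>xs. xs ! 2 < xs ! 1 \<and> xs ! 2 < xs ! 0 \<and>
      R (code_nth (psnd (xs ! 3)) (xs ! 2)) (code_nth (psnd (xs ! 3)) (xs ! 1))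
        (code_nth (psnd (xs ! 3)) (xs ! 0)))" by simp
  from decidable_ex_less[OF this, of "\<lambda>xs. pfst (xs ! 2)"]
  have "decidable_rel (Suc 3) (\<lambda>xs. \<exists>k<pfst (xs ! 2). xs ! 1 < xs ! 0 \<and> xs ! 1 < k \<and>
      R (code_nth (psnd (xs ! 2)) (xs ! 1)) (code_nth (psnd (xs ! 2)) (xs ! 0))
        (code_nth (psnd (xs ! 2)) k))"
    by (simp add: recursive_pfst recursive_nth)
  from decidable_ex_less[OF this, of "\<lambda>xs. pfst (xs ! 1)"]
  have *: "decidable_rel 3 (\<lambda>xs. \<exists>j<pfst (xs ! 1). \<exists>k<pfst (xs ! 1). xs ! 0 < j \<and> xs ! 0 < k \<and>
      R (code_nth (psnd (xs ! 1)) (xs ! 0)) (code_nth (psnd (xs ! 1)) j)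
        (code_nth (psnd (xs ! 1)) k))"
    by (simp add: recursive_pfst recursive_nth)
  have "decidable_rel 3 (\<lambda>xs. \<not> (code_nth (psnd (xs ! 1)) (xs ! 0) = 0 \<or>
     (\<exists>j<pfst (xs ! 1). \<exists>k<pfst (xs ! 1). xs ! 0 < j \<and> xs ! 0 < k \<and>
      R (code_nth (psnd (xs ! 1)) (xs ! 0)) (code_nth (psnd (xs ! 1)) j)
        (code_nth (psnd (xs ! 1)) k))))"
    by (intro rec_intros *) simp_all
  then have "decidable_rel (Suc 2) (\<lambda>xs. \<not> (code_nth (psnd (xs ! 1)) (xs ! 0) = 0 \<or>
     (\<exists>j<pfst (xs ! 1). \<exists>k<pfst (xs ! 1). xs ! 0 < j \<and> xs ! 0 < k \<and>
      R (code_nth (psnd (xs ! 1)) (xs ! 0)) (code_nth (psnd (xs ! 1)) j)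
        (code_nth (psnd (xs ! 1)) k))))" by simp
  from decidable_ex_less[OF this, of "\<lambda>xs. pfst (xs ! 0)"]
  have **: "decidable_rel 2 (\<lambda>xs. \<exists>i<pfst (xs ! 0). \<not> (code_nth (psnd (xs ! 0)) i = 0 \<or>
     (\<exists>j<pfst (xs ! 0). \<exists>k<pfst (xs ! 0). i < j \<and> i < k \<and>
      R (code_nth (psnd (xs ! 0)) i) (code_nth (psnd (xs ! 0)) j)
        (code_nth (psnd (xs ! 0)) k))))"
    by (simp add: recursive_pfst recursive_nth)
  have "decidable_rel 2 (\<lambda>xs. 0 < pfst (xs ! 0) \<and> xs ! 1 = code_nth (psnd (xs ! 0)) 0 \<and>
    \<not> (\<exists>i<pfst (xs ! 0). \<not> (code_nth (psnd (xs ! 0)) i = 0 \<or>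
     (\<exists>j<pfst (xs ! 0). \<exists>k<pfst (xs ! 0). i < j \<and> i < k \<and>
      R (code_nth (psnd (xs ! 0)) i) (code_nth (psnd (xs ! 0)) j)
        (code_nth (psnd (xs ! 0)) k)))))"
    by (intro rec_intros **) simp_all
  then have "decidable_rel 2 (\<lambda>xs. derivation R (xs ! 0) (xs ! 1))"
    by (rule decidable_rel_cong) (simp only: derivation_def not_ex not_not de_Morgan_conj imp_conv_disj[symmetric] Not_eq_iff)
  then show ?thesis unfolding decidable_rel_def by (rule recursive_comp2[OF _ f g])
qed

section \<open>Approximate truth is recursively enumerable\<close>

definition rnum :: "nat \<Rightarrow> nat \<Rightarrow> nat \<Rightarrow> nat" where
  "rnum p n d = prod_encode (p, prod_encode (n, d))"

text \<open>A difference as numerator and a shifted denominator make every number a valid code: no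
  signs, no division by zero, and polynomial operations on the entries suffice.\<close>

definition rval :: "nat \<Rightarrow> real" where
  "rval q = (real (pfst q) - real (pfst (psnd q))) / (real (psnd (psnd q)) + 1)"

definition radd :: "nat \<Rightarrow> nat \<Rightarrow> nat" where
  "radd a b = rnum
    (pfst a * Suc (psnd (psnd b)) + pfst b * Suc (psnd (psnd a)))
    (pfst (psnd a) * Suc (psnd (psnd b)) + pfst (psnd b) * Suc (psnd (psnd a)))
    (Suc (psnd (psnd a)) * Suc (psnd (psnd b)) - 1)"

definition rmult :: "nat \<Rightarrow> nat \<Rightarrow> nat" where
  "rmult a b = rnum
    (pfst a * pfst b + pfst (psnd a) * pfst (psnd b))
    (pfst a * pfst (psnd b) + pfst (psnd a) * pfst b)
    (Suc (psnd (psnd a)) * Suc (psnd (psnd b)) - 1)"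

definition rneg :: "nat \<Rightarrow> nat" where
  "rneg a = rnum (pfst (psnd a)) (pfst a) (psnd (psnd a))"

definition rle :: "nat \<Rightarrow> nat \<Rightarrow> bool" where
  "rle a b \<longleftrightarrow> pfst a * Suc (psnd (psnd b)) + pfst (psnd b) * Suc (psnd (psnd a))
    \<le> pfst b * Suc (psnd (psnd a)) + pfst (psnd a) * Suc (psnd (psnd b))"

lemma rval_rnum [simp]: "rval (rnum p n d) = (real p - real n) / (real d + 1)"
  by (simp add: rval_def rnum_def)

lemma rval_radd [simp]: "rval (radd a b) = rval a + rval b"
proof -
  have "real (Suc (psnd (psnd a)) * Suc (psnd (psnd b)) - 1) + 1
      = (real (psnd (psnd a)) + 1) * (real (psnd (psnd b)) + 1)"
    by (simp add: of_nat_diff algebra_simps)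
  then show ?thesis unfolding radd_def rval_rnum
    by (simp add: rval_def divide_simps) (simp add: algebra_simps)
qed

lemma rval_rmult [simp]: "rval (rmult a b) = rval a * rval b"
proof -
  have "real (Suc (psnd (psnd a)) * Suc (psnd (psnd b)) - 1) + 1
      = (real (psnd (psnd a)) + 1) * (real (psnd (psnd b)) + 1)"
    by (simp add: of_nat_diff algebra_simps)
  then show ?thesis unfolding rmult_def rval_rnum
    by (simp add: rval_def divide_simps) (simp add: algebra_simps)
qed

lemma rval_rneg [simp]: "rval (rneg a) = - rval a"
  unfolding rneg_def rval_rnum by (simp add: rval_def divide_simps)

lemma rle_iff [simp]: "rle a b \<longleftrightarrow> rval a \<le> rval b"
proof -
  have "rval a \<le> rval b \<longleftrightarrow>
    (real (pfst a) - real (pfst (psnd a))) * (real (psnd (psnd b)) + 1)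
      \<le> (real (pfst b) - real (pfst (psnd b))) * (real (psnd (psnd a)) + 1)"
    unfolding rval_def by (simp add: divide_simps mult.commute)
  also have "\<dots> \<longleftrightarrow> real (pfst a * Suc (psnd (psnd b)) + pfst (psnd b) * Suc (psnd (psnd a)))
    \<le> real (pfst b * Suc (psnd (psnd a)) + pfst (psnd a) * Suc (psnd (psnd b)))"
    by (simp add: algebra_simps)
  finally show ?thesis unfolding rle_def of_nat_le_iff by simp
qed

lemma recursive_rnum [rec_intros]:
  "recursive n f \<Longrightarrow> recursive n g \<Longrightarrow> recursive n h \<Longrightarrow> recursive n (\<lambda>xs. rnum (f xs) (g xs) (h xs))"
  unfolding rnum_def by (intro rec_intros)

lemma recursive_radd [rec_intros]:
  "recursive n f \<Longrightarrow> recursive n g \<Longrightarrow> recursive n (\<lambda>xs. radd (f xs) (g xs))"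
  unfolding radd_def by (intro rec_intros)

lemma recursive_rmult [rec_intros]:
  "recursive n f \<Longrightarrow> recursive n g \<Longrightarrow> recursive n (\<lambda>xs. rmult (f xs) (g xs))"
  unfolding rmult_def by (intro rec_intros)

lemma recursive_rneg [rec_intros]: "recursive n f \<Longrightarrow> recursive n (\<lambda>xs. rneg (f xs))"
  unfolding rneg_def by (intro rec_intros)

lemma decidable_rle [rec_intros]:
  "recursive n f \<Longrightarrow> recursive n g \<Longrightarrow> decidable_rel n (\<lambda>xs. rle (f xs) (g xs))"
  unfolding rle_def by (intro rec_intros)

lemma rval_dense:
  assumes "a < b" obtains q where "a < rval q" "rval q < b"
proof -
  from assms obtain r where r: "r \<in> \<rat>" "a < r" "r < b" using Rats_dense_in_real by blast
  from r(1) obtain m n :: int where mn: "n > 0" "r = of_int m / of_int n"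
    by (metis Rats_cases')
  have "real (nat m) - real (nat (- m)) = of_int m" by simp
  moreover have "real (nat (n - 1)) + 1 = of_int n" using mn(1) by simp
  ultimately have "rval (rnum (nat m) (nat (- m)) (nat (n - 1))) = r"
    using mn(2) by (simp only: rval_rnum)
  with r that show ?thesis by metis
qed

section \<open>Codes of judgements and environments\<close>

definition judgement :: "nat \<Rightarrow> nat \<Rightarrow> nat \<Rightarrow> nat \<Rightarrow> nat \<Rightarrow> nat" where
  "judgement t a b c d = prod_encode (t, prod_encode (a, prod_encode (b, prod_encode (c, d))))"

definition "j_kind x = pfst x"
definition "j_env x = pfst (psnd x)"
definition "j_exp x = pfst (psnd (psnd x))"
definition "j_lo x = pfst (psnd (psnd (psnd x)))"
definition "j_hi x = psnd (psnd (psnd (psnd x)))"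

lemma judgement_simps [simp]:
  "j_kind (judgement t a b c d) = t" "j_env (judgement t a b c d) = a"
  "j_exp (judgement t a b c d) = b" "j_lo (judgement t a b c d) = c"
  "j_hi (judgement t a b c d) = d"
  by (simp_all add: judgement_def j_kind_def j_env_def j_exp_def j_lo_def j_hi_def)

lemma recursive_judgement [rec_intros]:
  assumes "recursive n f" "recursive n a" "recursive n b" "recursive n c" "recursive n d"
  shows "recursive n (\<lambda>xs. judgement (f xs) (a xs) (b xs) (c xs) (d xs))"
  unfolding judgement_def by (intro rec_intros assms)

lemma recursive_j [rec_intros]:
  assumes "recursive n f"
  shows "recursive n (\<lambda>xs. j_kind (f xs))" "recursive n (\<lambda>xs. j_env (f xs))"
    "recursive n (\<lambda>xs. j_exp (f xs))" "recursive n (\<lambda>xs. j_lo (f xs))"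
    "recursive n (\<lambda>xs. j_hi (f xs))"
  unfolding j_kind_def j_env_def j_exp_def j_lo_def j_hi_def by (intro rec_intros assms)+

primrec env_code :: "(nat \<times> nat) list \<Rightarrow> nat" where
  "env_code [] = 0"
| "env_code (b # bs) = Suc (prod_encode (fst b, prod_encode (snd b, env_code bs)))"

lemma env_code_Cons_nonzero [simp]: "env_code (b # bs) \<noteq> 0" by simp

definition "env_var e = pfst (e - 1)"
definition "env_rat e = pfst (psnd (e - 1))"
definition "env_rest e = psnd (psnd (e - 1))"

lemma env_code_simps [simp]:
  "env_var (env_code (b # bs)) = fst b" "env_rat (env_code (b # bs)) = snd b"
  "env_rest (env_code (b # bs)) = env_code bs"
  by (simp_all add: env_var_def env_rat_def env_rest_def)

declare env_code.simps(2) [simp del]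

lemma recursive_env [rec_intros]:
  assumes "recursive n f"
  shows "recursive n (\<lambda>xs. env_var (f xs))" "recursive n (\<lambda>xs. env_rat (f xs))"
    "recursive n (\<lambda>xs. env_rest (f xs))"
  unfolding env_var_def env_rat_def env_rest_def by (intro rec_intros assms)+

primrec env_val :: "(nat \<times> nat) list \<Rightarrow> nat \<Rightarrow> real" where
  "env_val [] = (\<lambda>_. 0)"
| "env_val (b # bs) = (env_val bs)(fst b := rval (snd b))"

text \<open>
  Three kinds of judgements. Kind 1: the term \<open>b\<close> has its value strictly between \<open>c\<close> and \<open>d\<close> in the
  environment \<open>a\<close>. Kind 2: \<open>c\<close> is the \<open>b\<close>-th summand of the sine series at \<open>a\<close>, and \<open>d\<close> is the sum
  of the earlier ones. Kind 3: the formula \<open>b\<close> is well formed and closed in the environment \<open>a\<close> and,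
  if \<open>d \<noteq> 0\<close>, holds approximately with the precision parameters \<open>c\<close>.
\<close>

definition term_rule :: "nat \<Rightarrow> nat \<Rightarrow> nat \<Rightarrow> bool" where
  "term_rule x y z \<longleftrightarrow> j_kind x = 1 \<and> (
    pfst (j_exp x) = 0 \<and> j_env x \<noteq> 0 \<and> env_var (j_env x) = psnd (j_exp x)
      \<and> \<not> rle (env_rat (j_env x)) (j_lo x) \<and> \<not> rle (j_hi x) (env_rat (j_env x))
  \<or> pfst (j_exp x) = 0 \<and> j_env x \<noteq> 0 \<and> env_var (j_env x) \<noteq> psnd (j_exp x)
      \<and> y = judgement 1 (env_rest (j_env x)) (j_exp x) (j_lo x) (j_hi x)
  \<or> j_exp x = prod_encode (1, 0) \<and> \<not> rle (rnum 0 0 0) (j_lo x) \<and> \<not> rle (j_hi x) (rnum 0 0 0)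
  \<or> j_exp x = prod_encode (2, 0) \<and> \<not> rle (rnum 1 0 0) (j_lo x) \<and> \<not> rle (j_hi x) (rnum 1 0 0)
  \<or> j_kind y = 1 \<and> j_env y = j_env x \<and> (
      j_kind z = 1 \<and> j_env z = j_env x \<and> (
        j_exp x = prod_encode (3, prod_encode (j_exp y, j_exp z))
          \<and> rle (j_lo x) (radd (j_lo y) (j_lo z)) \<and> rle (radd (j_hi y) (j_hi z)) (j_hi x)
      \<or> j_exp x = prod_encode (4, prod_encode (j_exp y, j_exp z))
          \<and> \<not> rle (rmult (j_lo y) (j_lo z)) (j_lo x) \<and> \<not> rle (j_hi x) (rmult (j_lo y) (j_lo z))
          \<and> \<not> rle (rmult (j_lo y) (j_hi z)) (j_lo x) \<and> \<not> rle (j_hi x) (rmult (j_lo y) (j_hi z))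
          \<and> \<not> rle (rmult (j_hi y) (j_lo z)) (j_lo x) \<and> \<not> rle (j_hi x) (rmult (j_hi y) (j_lo z))
          \<and> \<not> rle (rmult (j_hi y) (j_hi z)) (j_lo x) \<and> \<not> rle (j_hi x) (rmult (j_hi y) (j_hi z)))
    \<or> j_kind z = 2 \<and> j_env z = j_lo y \<and> j_exp x = prod_encode (5, j_exp y)
        \<and> rle (radd (j_lo x) (j_hi y)) (radd (j_hi z) (radd (j_lo y) (j_lo z)))
        \<and> rle (radd (j_lo x) (j_hi y)) (radd (j_hi z) (radd (j_lo y) (rneg (j_lo z))))
        \<and> rle (radd (j_hi z) (radd (j_hi y) (j_lo z))) (radd (j_hi x) (j_lo y))
        \<and> rle (radd (j_hi z) (radd (j_hi y) (rneg (j_lo z)))) (radd (j_hi x) (j_lo y))))"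

text \<open>At a rational argument, kept in \<open>j_env\<close>, summands and partial sums are
  exact rationals, so truncation is the only error of the series.\<close>

definition series_rule :: "nat \<Rightarrow> nat \<Rightarrow> nat \<Rightarrow> bool" where
  "series_rule x y z \<longleftrightarrow>
    x = judgement 2 (j_env x) 0 (j_env x) (rnum 0 0 0)
  \<or> j_kind y = 2 \<and> x = judgement 2 (j_env y) (Suc (j_exp y))
      (rneg (rmult (j_lo y) (rmult (j_env y) (rmult (j_env y)
        (rnum 1 0 ((2 * j_exp y + 2) * (2 * j_exp y + 3) - 1))))))
      (radd (j_hi y) (j_lo y))"

text \<open>Well-formedness is separated from truth because a true disjunction still needs its other
  disjunct to be a formula. The entry \<open>j_lo\<close> is the triple of \<open>M\<close>, the
  error \<open>d\<close>, and a flag that admits equations when it is not zero.\<close>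

definition formula_rule :: "nat \<Rightarrow> nat \<Rightarrow> nat \<Rightarrow> bool" where
  "formula_rule x y z \<longleftrightarrow> j_kind x = 3 \<and> (
    j_kind y = 1 \<and> j_kind z = 1 \<and> j_env y = j_env x \<and> j_env z = j_env x \<and> (
      j_exp x = prod_encode (0, prod_encode (j_exp y, j_exp z)) \<and> (j_hi x = 0 \<or>
        rle (radd (j_hi y) (rnum 1 0 (pfst (j_lo x)))) (radd (j_lo z) (rnum 1 0 (pfst (psnd (j_lo x))))))
    \<or> j_exp x = prod_encode (1, prod_encode (j_exp y, j_exp z)) \<and> psnd (psnd (j_lo x)) \<noteq> 0 \<and> (j_hi x = 0 \<or>
        rle (j_hi y) (radd (j_lo z) (rnum 1 0 (pfst (psnd (j_lo x)))))
        \<and> rle (j_hi z) (radd (j_lo y) (rnum 1 0 (pfst (psnd (j_lo x)))))))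
  \<or> j_kind y = 3 \<and> j_lo y = j_lo x \<and> (
      j_kind z = 3 \<and> j_env y = j_env x \<and> j_env z = j_env x \<and> j_lo z = j_lo x \<and> (
        j_exp x = prod_encode (2, prod_encode (j_exp y, j_exp z))
          \<and> (j_hi x = 0 \<or> j_hi y \<noteq> 0 \<and> j_hi z \<noteq> 0)
      \<or> j_exp x = prod_encode (3, prod_encode (j_exp y, j_exp z))
          \<and> (j_hi x = 0 \<or> j_hi y \<noteq> 0 \<or> j_hi z \<noteq> 0))
    \<or> j_env y \<noteq> 0 \<and> env_rest (j_env y) = j_env x
        \<and> j_exp x = prod_encode (4, prod_encode (env_var (j_env y), j_exp y))
        \<and> (j_hi x = 0 \<or> j_hi y \<noteq> 0 \<and> \<not> rle (rnum (pfst (j_lo x)) 0 0) (env_rat (j_env y))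
          \<and> \<not> rle (env_rat (j_env y)) (rnum 0 (pfst (j_lo x)) 0))))"

definition truth_rule :: "nat \<Rightarrow> nat \<Rightarrow> nat \<Rightarrow> bool" where
  "truth_rule x y z \<longleftrightarrow> term_rule x y z \<or> series_rule x y z \<or> formula_rule x y z"

lemma decidable_truth_rule: "decidable_rel 3 (\<lambda>xs. truth_rule (xs ! 0) (xs ! 1) (xs ! 2))"
  unfolding truth_rule_def term_rule_def series_rule_def formula_rule_def
  by (intro rec_intros) simp_all

text \<open>\<open>M\<close> gives both the bound on witnesses and the margin
  \<open>1 / (M + 1)\<close>, \<open>d\<close> the tolerated error. The margin is what survives the
  limit \<open>d \<rightarrow> \<infinity>\<close>: it turns \<open>\<le>\<close> back into
  \<open><\<close>.\<close>

primrec approx :: "nat \<Rightarrow> nat \<Rightarrow> (nat \<Rightarrow> real) \<Rightarrow> ex_formula \<Rightarrow> bool" where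
  "approx M d e (Less s t) \<longleftrightarrow> term_val e s + 1 / (real M + 1) < term_val e t + 1 / (real d + 1)"
| "approx M d e (Equal s t) \<longleftrightarrow> \<bar>term_val e s - term_val e t\<bar> < 1 / (real d + 1)"
| "approx M d e (Conj p q) \<longleftrightarrow> approx M d e p \<and> approx M d e q"
| "approx M d e (Disj p q) \<longleftrightarrow> approx M d e p \<or> approx M d e q"
| "approx M d e (Exists i p) \<longleftrightarrow> (\<exists>x. \<bar>x\<bar> < real M \<and> approx M d (e(i := x)) p)"

section \<open>The sine series\<close>

definition sine_summand :: "nat \<Rightarrow> real \<Rightarrow> real" where
  "sine_summand n x = (-1) ^ n * x ^ (2 * n + 1) / fact (2 * n + 1)"

lemma sine_summand_Suc:
  "sine_summand (Suc n) x = - (sine_summand n x * (x * (x * (1 / real ((2 * n + 2) * (2 * n + 3))))))"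
proof -
  have "fact (2 * Suc n + 1) = (real ((2 * n + 2) * (2 * n + 3)) * fact (2 * n + 1) :: real)"
    by (simp add: fact_Suc algebra_simps)
  then show ?thesis by (simp add: sine_summand_def power_add field_simps power2_eq_square)
qed

lemma sine_sum_eq:
  "(\<Sum>m<2 * n + 1. sin_coeff m * x ^ m) = (\<Sum>k<n. sine_summand k x)"
proof (induction n)
  case (Suc n)
  have "(\<Sum>m<2 * Suc n + 1. sin_coeff m * x ^ m)
      = (\<Sum>m<2 * n + 1. sin_coeff m * x ^ m) + sin_coeff (2 * n + 1) * x ^ (2 * n + 1)
        + sin_coeff (2 * n + 2) * x ^ (2 * n + 2)" by simp
  also have "sin_coeff (2 * n + 1) * x ^ (2 * n + 1) = sine_summand n x"
    by (simp add: sin_coeff_def sine_summand_def)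
  also have "sin_coeff (2 * n + 2) = 0" by (simp add: sin_coeff_def)
  finally show ?case using Suc by simp
qed (simp add: sin_coeff_def)

text \<open>Even coefficients vanish, so cutting the Maclaurin series after an even index leaves a
  remainder bounded by the next odd summand.\<close>

lemma sine_sum_error: "\<bar>sin x - (\<Sum>k<n. sine_summand k x)\<bar> \<le> \<bar>sine_summand n x\<bar>"
  using Maclaurin_sin_bound[of x "2 * n + 1"]
  by (simp only: sine_sum_eq) (simp add: sine_summand_def abs_mult power_abs divide_inverse mult.commute)

lemma sine_summand_tendsto: "(\<lambda>n. sine_summand n x) \<longlonglongrightarrow> 0"
proof -
  have "(\<lambda>n. x ^ n / fact n) \<longlonglongrightarrow> 0"
    using summable_LIMSEQ_zero[OF summable_exp[of x]] by (simp add: divide_inverse mult.commute)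
  from LIMSEQ_subseq_LIMSEQ[OF this, of "\<lambda>n. 2 * n + 1"]
  have "(\<lambda>n. x ^ (2 * n + 1) / fact (2 * n + 1)) \<longlonglongrightarrow> 0"
    by (simp only: comp_def) (simp add: strict_mono_def)
  from tendsto_rabs_zero[OF this] have "(\<lambda>n. \<bar>x ^ (2 * n + 1) / fact (2 * n + 1)\<bar>) \<longlonglongrightarrow> 0" .
  moreover have "\<bar>sine_summand n x\<bar> = \<bar>x ^ (2 * n + 1) / fact (2 * n + 1)\<bar>" for n
    by (simp add: sine_summand_def abs_mult)
  ultimately have "(\<lambda>n. \<bar>sine_summand n x\<bar>) \<longlonglongrightarrow> 0" by (simp only:)
  then show ?thesis by (rule tendsto_rabs_zero_cancel)
qed

text \<open>The semantics of the three kinds. Nothing is claimed about expression entries that are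
  not codes; \<open>well_coded\<close> closes that gap.\<close>

definition valid :: "nat \<Rightarrow> bool" where
  "valid x \<longleftrightarrow>
    (j_kind x = 1 \<longrightarrow> (\<forall>bs t. j_env x = env_code bs \<longrightarrow> j_exp x = term_code t \<longrightarrow>
      term_vars t \<subseteq> fst ` set bs \<and>
      rval (j_lo x) < term_val (env_val bs) t \<and> term_val (env_val bs) t < rval (j_hi x))) \<and>
    (j_kind x = 2 \<longrightarrow> rval (j_lo x) = sine_summand (j_exp x) (rval (j_env x)) \<and>
      rval (j_hi x) = (\<Sum>k<j_exp x. sine_summand k (rval (j_env x)))) \<and>
    (j_kind x = 3 \<longrightarrow> (\<forall>bs p. j_env x = env_code bs \<longrightarrow> j_exp x = formula_code p \<longrightarrow>
      free_vars p \<subseteq> fst ` set bs \<and> (psnd (psnd (j_lo x)) = 0 \<longrightarrow> equality_free p) \<and>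
      (j_hi x \<noteq> 0 \<longrightarrow> approx (pfst (j_lo x)) (pfst (psnd (j_lo x))) (env_val bs) p)))"

section \<open>Soundness of the rules\<close>

lemma affine_bounds:
  fixes a b c :: real
  assumes "a \<le> x" "x \<le> b"
  shows "L < c * a \<Longrightarrow> L < c * b \<Longrightarrow> L < c * x" "c * a < L \<Longrightarrow> c * b < L \<Longrightarrow> c * x < L"
proof -
  have "c * a \<le> c * x \<or> c * b \<le> c * x" "c * x \<le> c * a \<or> c * x \<le> c * b"
    using assms by (metis linear mult_left_mono mult_left_mono_neg)+
  then show "L < c * a \<Longrightarrow> L < c * b \<Longrightarrow> L < c * x" "c * a < L \<Longrightarrow> c * b < L \<Longrightarrow> c * x < L"
    by linarith+
qed

text \<open>A product is affine in each factor, so its extremes over a rectangle lie at the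
  corners.\<close>

lemma rectangle_bounds:
  fixes a b c d :: real
  assumes "a \<le> x" "x \<le> b" "c \<le> y" "y \<le> d"
  shows "L < a * c \<Longrightarrow> L < a * d \<Longrightarrow> L < b * c \<Longrightarrow> L < b * d \<Longrightarrow> L < x * y"
    "a * c < L \<Longrightarrow> a * d < L \<Longrightarrow> b * c < L \<Longrightarrow> b * d < L \<Longrightarrow> x * y < L"
  using affine_bounds(1)[OF assms(3,4), of L a] affine_bounds(1)[OF assms(3,4), of L b]
    affine_bounds(1)[OF assms(1,2), of L y] affine_bounds(2)[OF assms(3,4), of a L]
    affine_bounds(2)[OF assms(3,4), of b L] affine_bounds(2)[OF assms(1,2), of y L]
  by (simp_all add: mult.commute)

text \<open>By the sum-to-product formula, with \<open>\<bar>sin x\<bar> \<le> \<bar>x\<bar>\<close>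
  and \<open>\<bar>cos x\<bar> \<le> 1\<close>.\<close>

lemma abs_sin_diff_le: "\<bar>sin x - sin y\<bar> \<le> \<bar>x - y\<bar>" for x y :: real
proof -
  have "sin x - sin y = 2 * (sin ((x - y) / 2) * cos ((x + y) / 2))"
    by (simp add: sin_diff_sin)
  moreover have "\<bar>sin ((x - y) / 2)\<bar> * \<bar>cos ((x + y) / 2)\<bar> \<le> \<bar>(x - y) / 2\<bar> * 1"
    by (intro mult_mono abs_sin_x_le_abs_x) auto
  ultimately show ?thesis by (simp add: abs_mult)
qed

lemma validD_term:
  assumes "valid y" "j_kind y = 1" "j_env y = env_code bs" "j_exp y = term_code t"
  shows "term_vars t \<subseteq> fst ` set bs" "rval (j_lo y) < term_val (env_val bs) t"
    "term_val (env_val bs) t < rval (j_hi y)"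
  using assms unfolding valid_def by auto

lemma validD_series:
  assumes "valid y" "j_kind y = 2"
  shows "rval (j_lo y) = sine_summand (j_exp y) (rval (j_env y))"
    "rval (j_hi y) = (\<Sum>k<j_exp y. sine_summand k (rval (j_env y)))"
  using assms unfolding valid_def by auto

lemma validD_formula:
  assumes "valid y" "j_kind y = 3" "j_env y = env_code bs" "j_exp y = formula_code p"
  shows "free_vars p \<subseteq> fst ` set bs" "psnd (psnd (j_lo y)) = 0 \<Longrightarrow> equality_free p"
    "j_hi y \<noteq> 0 \<Longrightarrow> approx (pfst (j_lo y)) (pfst (psnd (j_lo y))) (env_val bs) p"
  using assms unfolding valid_def by auto

lemma env_code_nonzero: "env_code bs \<noteq> 0 \<Longrightarrow> \<exists>b bs'. bs = b # bs'"
  by (cases bs) auto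

lemma term_rule_valid:
  assumes "valid y" "valid z" "term_rule x y z"
  shows "valid x"
proof -
  have "term_vars t \<subseteq> fst ` set bs \<and>
      rval (j_lo x) < term_val (env_val bs) t \<and> term_val (env_val bs) t < rval (j_hi x)"
    if "j_env x = env_code bs" "j_exp x = term_code t" for bs t
  proof (cases t)
    case (Var i)
    with assms(3) that obtain b bs' where bs: "bs = b # bs'"
      using env_code_nonzero[of bs] by (auto simp: term_rule_def)
    show ?thesis
    proof (cases "fst b = i")
      case True
      with assms(3) that Var bs show ?thesis by (auto simp: term_rule_def)
    next
      case False
      with assms(3) that Var bs have "y = judgement 1 (env_code bs') (term_code t) (j_lo x) (j_hi x)"
        by (auto simp: term_rule_def)
      then show ?thesis using validD_term[OF assms(1), of bs' t] Var bs False by auto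
    qed
  next
    case Zero
    with assms(3) that show ?thesis by (auto simp: term_rule_def)
  next
    case One
    with assms(3) that show ?thesis by (auto simp: term_rule_def)
  next
    case (Add s u)
    with assms(3) that have R: "j_kind y = 1" "j_env y = env_code bs" "j_exp y = term_code s"
      "j_kind z = 1" "j_env z = env_code bs" "j_exp z = term_code u"
      "rval (j_lo x) \<le> rval (j_lo y) + rval (j_lo z)" "rval (j_hi y) + rval (j_hi z) \<le> rval (j_hi x)"
      by (auto simp: term_rule_def)
    from validD_term[OF assms(1) R(1-3)] validD_term[OF assms(2) R(4-6)] R(7-) Add
    show ?thesis by auto
  next
    case (Mult s u)
    with assms(3) that have R: "j_kind y = 1" "j_env y = env_code bs" "j_exp y = term_code s"
      "j_kind z = 1" "j_env z = env_code bs" "j_exp z = term_code u"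
      and C: "rval (j_lo x) < rval (j_lo y) * rval (j_lo z)" "rval (j_lo y) * rval (j_lo z) < rval (j_hi x)"
      "rval (j_lo x) < rval (j_lo y) * rval (j_hi z)" "rval (j_lo y) * rval (j_hi z) < rval (j_hi x)"
      "rval (j_lo x) < rval (j_hi y) * rval (j_lo z)" "rval (j_hi y) * rval (j_lo z) < rval (j_hi x)"
      "rval (j_lo x) < rval (j_hi y) * rval (j_hi z)" "rval (j_hi y) * rval (j_hi z) < rval (j_hi x)"
      by (auto simp: term_rule_def)
    note S = validD_term[OF assms(1) R(1-3)] and U = validD_term[OF assms(2) R(4-6)]
    show ?thesis
      using rectangle_bounds[OF S(2,3)[THEN less_imp_le] U(2,3)[THEN less_imp_le]] S(1) U(1) C Mult
      by simp
  next
    case (Sin s)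
    with assms(3) that have R: "j_kind y = 1" "j_env y = env_code bs" "j_exp y = term_code s"
      "j_kind z = 2" "j_env z = j_lo y"
      and C: "rval (j_lo x) + rval (j_hi y) \<le> rval (j_hi z) + (rval (j_lo y) + rval (j_lo z))"
        "rval (j_lo x) + rval (j_hi y) \<le> rval (j_hi z) + (rval (j_lo y) - rval (j_lo z))"
        "rval (j_hi z) + (rval (j_hi y) + rval (j_lo z)) \<le> rval (j_hi x) + rval (j_lo y)"
        "rval (j_hi z) + (rval (j_hi y) - rval (j_lo z)) \<le> rval (j_hi x) + rval (j_lo y)"
      by (auto simp: term_rule_def)
    note B = validD_term[OF assms(1) R(1-3)]
    note Z = validD_series[OF assms(2) R(4), unfolded R(5)]
    \<comment> \<open>Two errors arise: the truncation of the series at the rational left end, and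
      the distance of the argument from this end, carried over because sine is 1-Lipschitz. The four
      inequalities of the rule allow for their sum.\<close>
    have "\<bar>sin (rval (j_lo y)) - rval (j_hi z)\<bar> \<le> \<bar>rval (j_lo z)\<bar>"
      unfolding Z by (rule sine_sum_error)
    moreover have "\<bar>sin (term_val (env_val bs) s) - sin (rval (j_lo y))\<bar> < rval (j_hi y) - rval (j_lo y)"
      using abs_sin_diff_le[of "term_val (env_val bs) s" "rval (j_lo y)"] B by linarith
    ultimately show ?thesis using B C Sin by auto
  qed
  moreover have "j_kind x = 1" using assms(3) by (simp add: term_rule_def)
  ultimately show ?thesis by (simp add: valid_def)
qed

lemma series_rule_valid:
  assumes "valid y" "series_rule x y z"
  shows "valid x"
  using assms(2) unfolding series_rule_def
proof (elim disjE conjE)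
  assume "x = judgement 2 (j_env x) 0 (j_env x) (rnum 0 0 0)"
  then have "j_kind x = 2" "j_exp x = 0" "j_lo x = j_env x" "j_hi x = rnum 0 0 0"
    by (metis judgement_simps)+
  then show ?thesis by (simp add: valid_def sine_summand_def)
next
  assume y: "j_kind y = 2" and x: "x = judgement 2 (j_env y) (Suc (j_exp y))
      (rneg (rmult (j_lo y) (rmult (j_env y) (rmult (j_env y)
        (rnum 1 0 ((2 * j_exp y + 2) * (2 * j_exp y + 3) - 1))))))
      (radd (j_hi y) (j_lo y))"
  have "real ((2 * j_exp y + 2) * (2 * j_exp y + 3) - 1) + 1 = real ((2 * j_exp y + 2) * (2 * j_exp y + 3))"
    by (simp add: of_nat_diff)
  then show ?thesis using assms(1) y unfolding x valid_def
    by (simp add: sine_summand_Suc del: of_nat_mult of_nat_add)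
qed

lemma formula_rule_valid:
  assumes "valid y" "valid z" "formula_rule x y z"
  shows "valid x"
proof -
  have "free_vars p \<subseteq> fst ` set bs \<and> (psnd (psnd (j_lo x)) = 0 \<longrightarrow> equality_free p) \<and>
      (j_hi x \<noteq> 0 \<longrightarrow> approx (pfst (j_lo x)) (pfst (psnd (j_lo x))) (env_val bs) p)"
    if "j_env x = env_code bs" "j_exp x = formula_code p" for bs p
  proof (cases p)
    case (Less s t)
    with assms(3) that have R: "j_kind y = 1" "j_env y = env_code bs" "j_exp y = term_code s"
      "j_kind z = 1" "j_env z = env_code bs" "j_exp z = term_code t"
      "j_hi x = 0 \<or> rval (j_hi y) + 1 / (real (pfst (j_lo x)) + 1)
        \<le> rval (j_lo z) + 1 / (real (pfst (psnd (j_lo x))) + 1)"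
      by (auto simp: formula_rule_def)
    from validD_term[OF assms(1) R(1-3)] validD_term[OF assms(2) R(4-6)] R(7-) Less
    show ?thesis by auto
  next
    case (Equal s t)
    with assms(3) that have R: "j_kind y = 1" "j_env y = env_code bs" "j_exp y = term_code s"
      "j_kind z = 1" "j_env z = env_code bs" "j_exp z = term_code t"
      "j_hi x = 0 \<or> rval (j_hi y) \<le> rval (j_lo z) + 1 / (real (pfst (psnd (j_lo x))) + 1)
        \<and> rval (j_hi z) \<le> rval (j_lo y) + 1 / (real (pfst (psnd (j_lo x))) + 1)"
      "psnd (psnd (j_lo x)) \<noteq> 0"
      by (auto simp: formula_rule_def)
    from validD_term[OF assms(1) R(1-3)] validD_term[OF assms(2) R(4-6)] R(7-) Equal
    show ?thesis by (auto simp: abs_less_iff)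
  next
    case (Conj q r)
    with assms(3) that have R: "j_kind y = 3" "j_env y = env_code bs" "j_exp y = formula_code q"
      "j_kind z = 3" "j_env z = env_code bs" "j_exp z = formula_code r" "j_lo y = j_lo x" "j_lo z = j_lo x"
      "j_hi x = 0 \<or> j_hi y \<noteq> 0 \<and> j_hi z \<noteq> 0"
      by (auto simp: formula_rule_def)
    from validD_formula[OF assms(1) R(1-3)] validD_formula[OF assms(2) R(4-6)] R(7-) Conj
    show ?thesis by auto
  next
    case (Disj q r)
    with assms(3) that have R: "j_kind y = 3" "j_env y = env_code bs" "j_exp y = formula_code q"
      "j_kind z = 3" "j_env z = env_code bs" "j_exp z = formula_code r" "j_lo y = j_lo x" "j_lo z = j_lo x"
      "j_hi x = 0 \<or> j_hi y \<noteq> 0 \<or> j_hi z \<noteq> 0"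
      by (auto simp: formula_rule_def)
    from validD_formula[OF assms(1) R(1-3)] validD_formula[OF assms(2) R(4-6)] R(7-) Disj
    show ?thesis by auto
  next
    case (Exists i q)
    with assms(3) that have R: "j_kind y = 3" "j_env y \<noteq> 0" "env_rest (j_env y) = env_code bs"
      "j_exp y = formula_code q" "j_lo y = j_lo x" "env_var (j_env y) = i"
      "j_hi x = 0 \<or> j_hi y \<noteq> 0 \<and> rval (env_rat (j_env y)) < real (pfst (j_lo x)) \<and>
          - real (pfst (j_lo x)) < rval (env_rat (j_env y))"
      by (auto simp: formula_rule_def)
    \<comment> \<open>A nonzero number codes the list formed from its own components, hence
      \<open>j_env y\<close> extends \<open>bs\<close> by the witness.\<close>
    have "j_env y = env_code ((i, env_rat (j_env y)) # bs)"
      using R(2) by (simp add: env_code.simps(2) flip: R(3,6))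
        (simp add: env_var_def env_rat_def env_rest_def)
    from validD_formula[OF assms(1) R(1) this R(4)] R(5-) Exists
    show ?thesis by (auto intro!: exI[of _ "rval (env_rat (j_env y))"])
  qed
  moreover have "j_kind x = 3" using assms(3) by (simp add: formula_rule_def)
  ultimately show ?thesis by (simp add: valid_def)
qed

lemma derivable_valid: "derivable truth_rule x \<Longrightarrow> valid x"
proof (induction rule: derivable.induct)
  \<comment> \<open>The number 0 has kind 0, of which \<open>valid\<close> demands nothing.\<close>
  case derivable_0
  then show ?case by (simp add: valid_def j_kind_def pfst_def prod_decode_def prod_decode_aux.simps)
next
  case (derivable_step y z x)
  then show ?case
    unfolding truth_rule_def using term_rule_valid series_rule_valid formula_rule_valid by blast
qed

section \<open>Completeness of the rules\<close>

lemma derivable_truthI: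
  assumes "derivable truth_rule y" "derivable truth_rule z"
    "term_rule x y z \<or> series_rule x y z \<or> formula_rule x y z"
  shows "derivable truth_rule x"
  using derivable_step[OF assms(1,2), of x] assms(3) unfolding truth_rule_def by blast

lemma rval_bracket:
  assumes "e > 0"
  obtains l h where "x - e < rval l" "rval l < x" "x < rval h" "rval h < x + e"
  using rval_dense[of "x - e" x] rval_dense[of x "x + e"] assms by (metis diff_less_eq less_add_same_cancel1)

lemma derivable_series: "\<exists>c d. derivable truth_rule (judgement 2 q n c d)"
proof (induction n)
  case 0
  show ?case
    by (rule exI[of _ q], rule exI[of _ "rnum 0 0 0"], rule derivable_truthI[OF derivable_0 derivable_0])
      (simp add: series_rule_def)
next
  case (Suc n)
  then obtain c d where cd: "derivable truth_rule (judgement 2 q n c d)" by blast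
  show ?case
    by (rule exI, rule exI, rule derivable_truthI[OF cd derivable_0], rule disjI2, rule disjI1,
        unfold series_rule_def, rule disjI2) (simp only: judgement_simps)
qed

text \<open>The operations are continuous, so sufficiently tight intervals for the arguments yield
  the prescribed one; the bounds are therefore arbitrary in the induction.\<close>

lemma derivable_term:
  "term_vars t \<subseteq> fst ` set bs \<Longrightarrow> rval lo < term_val (env_val bs) t \<Longrightarrow> term_val (env_val bs) t < rval hi
    \<Longrightarrow> derivable truth_rule (judgement 1 (env_code bs) (term_code t) lo hi)"
proof (induction t arbitrary: lo hi)
  case (Var i)
  then show ?case
  proof (induction bs)
    case (Cons b bs)
    show ?case
    proof (cases "fst b = i")
      case True
      with Cons.prems show ?thesis
        by (intro derivable_truthI[OF derivable_0 derivable_0]) (auto simp: term_rule_def)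
    next
      case False
      with Cons.prems have "derivable truth_rule (judgement 1 (env_code bs) (term_code (Var i)) lo hi)"
        by (intro Cons.IH) auto
      note step = derivable_truthI[OF this derivable_0]
      show ?thesis by (rule step) (use False in \<open>simp add: term_rule_def\<close>)
    qed
  qed simp
next
  case Zero
  then show ?case
    by (intro derivable_truthI[OF derivable_0 derivable_0]) (auto simp: term_rule_def)
next
  case One
  then show ?case
    by (intro derivable_truthI[OF derivable_0 derivable_0]) (auto simp: term_rule_def)
next
  case (Add s u)
  let ?s = "term_val (env_val bs) s" and ?u = "term_val (env_val bs) u"
  \<comment> \<open>Half of the smaller slack, one half for each summand.\<close>
  define e where "e = min (?s + ?u - rval lo) (rval hi - (?s + ?u)) / 2"
  have e: "e > 0" "rval lo \<le> (?s - e) + (?u - e)" "(?s + e) + (?u + e) \<le> rval hi"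
    using Add.prems by (auto simp: e_def min_def field_simps)
  obtain l1 h1 where b1: "?s - e < rval l1" "rval l1 < ?s" "?s < rval h1" "rval h1 < ?s + e"
    using rval_bracket[OF e(1)] by blast
  obtain l2 h2 where b2: "?u - e < rval l2" "rval l2 < ?u" "?u < rval h2" "rval h2 < ?u + e"
    using rval_bracket[OF e(1)] by blast
  note b = b1 b2
  have "derivable truth_rule (judgement 1 (env_code bs) (term_code s) l1 h1)"
    "derivable truth_rule (judgement 1 (env_code bs) (term_code u) l2 h2)"
    using Add b by auto
  from derivable_truthI[OF this] b e show ?case by (simp add: term_rule_def)
next
  case (Mult s u)
  let ?s = "term_val (env_val bs) s" and ?u = "term_val (env_val bs) u"
  \<comment> \<open>Continuity of multiplication supplies a square around the two values on which
    products respect the bounds; the rule checks corners inside it.\<close>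
  have "((\<lambda>p. fst p * snd p) \<longlongrightarrow> ?s * ?u) (nhds (?s, ?u))"
    by (intro tendsto_intros tendsto_fst[of _ "(?s, ?u)", simplified] tendsto_snd[of _ "(?s, ?u)", simplified] filterlim_ident)
  then have "eventually (\<lambda>p. fst p * snd p \<in> {rval lo<..<rval hi}) (nhds (?s, ?u))"
    using Mult.prems by (intro topological_tendstoD) auto
  then obtain A B where AB: "eventually A (nhds ?s)" "eventually B (nhds ?u)"
    "\<And>a b. A a \<Longrightarrow> B b \<Longrightarrow> rval lo < a * b \<and> a * b < rval hi"
    unfolding nhds_prod eventually_prod_filter by auto
  then obtain e1 e2 where e: "e1 > 0" "e2 > 0" "\<And>a. dist a ?s < e1 \<Longrightarrow> A a" "\<And>b. dist b ?u < e2 \<Longrightarrow> B b"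
    unfolding eventually_nhds_metric by blast
  define d where "d = min e1 e2"
  have d: "d > 0" "\<And>a b. \<bar>a - ?s\<bar> < d \<Longrightarrow> \<bar>b - ?u\<bar> < d \<Longrightarrow> rval lo < a * b \<and> a * b < rval hi"
    using e AB(3) by (auto simp: d_def dist_real_def)
  obtain l1 h1 where b1: "?s - d < rval l1" "rval l1 < ?s" "?s < rval h1" "rval h1 < ?s + d"
    using rval_bracket[OF d(1)] by blast
  obtain l2 h2 where b2: "?u - d < rval l2" "rval l2 < ?u" "?u < rval h2" "rval h2 < ?u + d"
    using rval_bracket[OF d(1)] by blast
  note b = b1 b2
  have "derivable truth_rule (judgement 1 (env_code bs) (term_code s) l1 h1)"
    "derivable truth_rule (judgement 1 (env_code bs) (term_code u) l2 h2)"
    using Mult b by auto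
  note step = derivable_truthI[OF this]
  have near: "\<bar>rval l1 - ?s\<bar> < d" "\<bar>rval h1 - ?s\<bar> < d" "\<bar>rval l2 - ?u\<bar> < d" "\<bar>rval h2 - ?u\<bar> < d"
    using b by (auto simp: abs_less_iff)
  show ?case
    by (rule step) (use near in \<open>simp add: term_rule_def not_le d(2)\<close>)
next
  case (Sin s)
  let ?s = "term_val (env_val bs) s"
  \<comment> \<open>A quarter of the slack: truncation and width of the argument interval count
    twice, as actual errors and as allowances made by the rule.\<close>
  define e where "e = min (sin ?s - rval lo) (rval hi - sin ?s) / 4"
  have e: "e > 0" "rval lo \<le> sin ?s - 4 * e" "sin ?s + 4 * e \<le> rval hi"
    using Sin.prems by (auto simp: e_def min_def field_simps)
  define e' where "e' = e / 2"
  with e(1) have "e' > 0" by simp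
  then obtain l h where b: "?s - e' < rval l" "rval l < ?s" "?s < rval h" "rval h < ?s + e'"
    using rval_bracket by blast
  have y: "derivable truth_rule (judgement 1 (env_code bs) (term_code s) l h)"
    using Sin b by auto
  from LIMSEQ_D[OF sine_summand_tendsto[of "rval l"] e(1)]
  obtain n where n: "\<bar>sine_summand n (rval l)\<bar> < e" by auto
  obtain c d where z: "derivable truth_rule (judgement 2 l n c d)" using derivable_series by blast
  from validD_series[OF derivable_valid[OF z]]
  have cd: "rval c = sine_summand n (rval l)" "rval d = (\<Sum>k<n. sine_summand k (rval l))"
    by simp_all
  have "\<bar>sin (rval l) - rval d\<bar> \<le> \<bar>rval c\<bar>" unfolding cd by (rule sine_sum_error)
  moreover have "\<bar>sin ?s - sin (rval l)\<bar> \<le> rval h - rval l"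
    using abs_sin_diff_le[of ?s "rval l"] b by linarith
  moreover have "rval h - rval l < e" using b by (simp add: e'_def)
  moreover have "\<bar>rval c\<bar> < e" using n cd by simp
  ultimately show ?case
    using e by (intro derivable_truthI[OF y z]) (simp add: term_rule_def, linarith)
qed

lemma derivable_term_ex:
  assumes "term_vars t \<subseteq> fst ` set bs" "e > 0"
  obtains lo hi where "derivable truth_rule (judgement 1 (env_code bs) (term_code t) lo hi)"
    "term_val (env_val bs) t - e < rval lo" "rval hi < term_val (env_val bs) t + e"
proof -
  let ?t = "term_val (env_val bs) t"
  from assms(2) obtain l h where "?t - e < rval l" "rval l < ?t" "?t < rval h" "rval h < ?t + e"
    using rval_bracket by blast
  with derivable_term[OF assms(1), of l h] that show ?thesis by blast
qed

lemma derivable_terms_ex: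
  assumes "term_vars s \<union> term_vars t \<subseteq> fst ` set bs" "e > 0"
  obtains l1 h1 l2 h2 where "derivable truth_rule (judgement 1 (env_code bs) (term_code s) l1 h1)"
    "derivable truth_rule (judgement 1 (env_code bs) (term_code t) l2 h2)"
    "rval h1 < term_val (env_val bs) s + e" "term_val (env_val bs) t - e < rval l2"
    "term_val (env_val bs) s - e < rval l1" "rval h2 < term_val (env_val bs) t + e"
proof -
  from assms have v: "term_vars s \<subseteq> fst ` set bs" "term_vars t \<subseteq> fst ` set bs" by auto
  obtain l1 h1 where "derivable truth_rule (judgement 1 (env_code bs) (term_code s) l1 h1)"
    "term_val (env_val bs) s - e < rval l1" "rval h1 < term_val (env_val bs) s + e"
    using derivable_term_ex[OF v(1) assms(2)] by blast
  moreover obtain l2 h2 where "derivable truth_rule (judgement 1 (env_code bs) (term_code t) l2 h2)"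
    "term_val (env_val bs) t - e < rval l2" "rval h2 < term_val (env_val bs) t + e"
    using derivable_term_ex[OF v(2) assms(2)] by blast
  ultimately show ?thesis using that by blast
qed

abbreviation "precision M d flag \<equiv> prod_encode (M, prod_encode (d, flag))"

text \<open>Serves for the disjunct that is not claimed to be true. The interval radius 1 and the
  witness code 0 are arbitrary choices.\<close>

lemma derivable_wf:
  "free_vars p \<subseteq> fst ` set bs \<Longrightarrow> flag \<noteq> 0 \<or> equality_free p \<Longrightarrow>
    derivable truth_rule (judgement 3 (env_code bs) (formula_code p) (precision M d flag) 0)"
proof (induction p arbitrary: bs)
  case (Less s t)
  obtain l1 h1 l2 h2 where "derivable truth_rule (judgement 1 (env_code bs) (term_code s) l1 h1)"
    "derivable truth_rule (judgement 1 (env_code bs) (term_code t) l2 h2)"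
    by (rule derivable_terms_ex[of s t bs 1]) (use Less.prems in auto)
  from derivable_truthI[OF this] show ?case by (simp add: formula_rule_def)
next
  case (Equal s t)
  obtain l1 h1 l2 h2 where "derivable truth_rule (judgement 1 (env_code bs) (term_code s) l1 h1)"
    "derivable truth_rule (judgement 1 (env_code bs) (term_code t) l2 h2)"
    by (rule derivable_terms_ex[of s t bs 1]) (use Equal.prems in auto)
  from derivable_truthI[OF this] show ?case using Equal by (simp add: formula_rule_def)
next
  case (Conj p q)
  then have "derivable truth_rule (judgement 3 (env_code bs) (formula_code p) (precision M d flag) 0)"
    "derivable truth_rule (judgement 3 (env_code bs) (formula_code q) (precision M d flag) 0)" by auto
  from derivable_truthI[OF this] show ?case by (simp add: formula_rule_def)
next
  case (Disj p q)
  then have "derivable truth_rule (judgement 3 (env_code bs) (formula_code p) (precision M d flag) 0)"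
    "derivable truth_rule (judgement 3 (env_code bs) (formula_code q) (precision M d flag) 0)" by auto
  from derivable_truthI[OF this] show ?case by (simp add: formula_rule_def)
next
  case (Exists i p)
  have "derivable truth_rule (judgement 3 (env_code ((i, 0) # bs)) (formula_code p) (precision M d flag) 0)"
    using Exists.prems by (intro Exists.IH) auto
  from derivable_truthI[OF this derivable_0] show ?case by (simp add: formula_rule_def)
qed

lemma continuous_on_term_val: "continuous_on UNIV (\<lambda>x. term_val (e(i := x)) t)"
proof (induction t)
  case (Var j)
  then show ?case by (cases "i = j") (auto intro: continuous_intros)
qed (auto intro!: continuous_intros)

text \<open>All conditions in \<open>approx\<close> are strict. Hence a real witness can be replaced
  by a rational one nearby, which \<open>derivable_approx\<close> exploits.\<close>

lemma open_approx: "open {x. approx M d (e(i := x)) p}"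
proof (induction p arbitrary: e)
  case (Exists j p)
  show ?case
  proof (cases "i = j")
    case False
    then have "{x. approx M d (e(i := x)) (Exists j p)}
        = (\<Union>y\<in>{y. \<bar>y\<bar> < real M}. {x. approx M d ((e(j := y))(i := x)) p})"
      by (auto simp: fun_upd_twist)
    then show ?thesis by (simp only:) (intro open_UN ballI Exists.IH)
  qed (simp only: approx.simps fun_upd_upd, simp)
qed (auto intro!: open_Collect_less continuous_intros continuous_on_term_val
  simp: Collect_conj_eq Collect_disj_eq open_Int open_Un)

lemma derivable_approx:
  "free_vars p \<subseteq> fst ` set bs \<Longrightarrow> flag \<noteq> 0 \<or> equality_free p \<Longrightarrow> approx M d (env_val bs) p \<Longrightarrow>
    derivable truth_rule (judgement 3 (env_code bs) (formula_code p) (precision M d flag) 1)"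
proof (induction p arbitrary: bs)
  case (Less s t)
  let ?s = "term_val (env_val bs) s" and ?t = "term_val (env_val bs) t"
  let ?d = "1 / (real M + 1)" and ?e = "1 / (real d + 1)"
  \<comment> \<open>Half of the gap, shared by the errors of the two terms.\<close>
  define e where "e = (?t + ?e - (?s + ?d)) / 2"
  have "e > 0" using Less.prems by (simp add: e_def)
  obtain l1 h1 l2 h2 where d: "derivable truth_rule (judgement 1 (env_code bs) (term_code s) l1 h1)"
    "derivable truth_rule (judgement 1 (env_code bs) (term_code t) l2 h2)"
    and b: "rval h1 < ?s + e" "?t - e < rval l2"
    by (rule derivable_terms_ex[of s t bs e]) (use Less.prems \<open>e > 0\<close> in auto)
  have "2 * e = ?t + ?e - (?s + ?d)" by (simp only: e_def field_sum_of_halves mult_2)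
  with b have "rval h1 + ?d \<le> rval l2 + ?e" by linarith
  with derivable_truthI[OF d] show ?case by (simp add: formula_rule_def)
next
  case (Equal s t)
  let ?s = "term_val (env_val bs) s" and ?t = "term_val (env_val bs) t"
  let ?e = "1 / (real d + 1)"
  define e where "e = (?e - \<bar>?s - ?t\<bar>) / 2"
  have "e > 0" using Equal.prems by (simp add: e_def)
  obtain l1 h1 l2 h2 where d: "derivable truth_rule (judgement 1 (env_code bs) (term_code s) l1 h1)"
    "derivable truth_rule (judgement 1 (env_code bs) (term_code t) l2 h2)"
    and b: "rval h1 < ?s + e" "?t - e < rval l2" "?s - e < rval l1" "rval h2 < ?t + e"
    by (rule derivable_terms_ex[of s t bs e]) (use Equal.prems \<open>e > 0\<close> in auto)
  have "2 * e + ?s - ?t \<le> ?e" "2 * e + ?t - ?s \<le> ?e"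
    unfolding e_def mult_2 field_sum_of_halves by auto
  with b have "rval h1 \<le> rval l2 + ?e" "rval h2 \<le> rval l1 + ?e" by linarith+
  with derivable_truthI[OF d] Equal.prems show ?case by (simp add: formula_rule_def)
next
  case (Conj p q)
  then have "derivable truth_rule (judgement 3 (env_code bs) (formula_code p) (precision M d flag) 1)"
    "derivable truth_rule (judgement 3 (env_code bs) (formula_code q) (precision M d flag) 1)" by auto
  from derivable_truthI[OF this] show ?case by (simp add: formula_rule_def)
next
  case (Disj p q)
  then have wf: "derivable truth_rule (judgement 3 (env_code bs) (formula_code p) (precision M d flag) 0)"
    "derivable truth_rule (judgement 3 (env_code bs) (formula_code q) (precision M d flag) 0)"
    by (auto intro!: derivable_wf)
  from Disj.prems(3) consider "approx M d (env_val bs) p" | "approx M d (env_val bs) q" by auto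
  then show ?case
  proof cases
    case 1
    with Disj have "derivable truth_rule (judgement 3 (env_code bs) (formula_code p) (precision M d flag) 1)"
      by auto
    from derivable_truthI[OF this wf(2)] show ?thesis by (simp add: formula_rule_def)
  next
    case 2
    with Disj have "derivable truth_rule (judgement 3 (env_code bs) (formula_code q) (precision M d flag) 1)"
      by auto
    from derivable_truthI[OF wf(1) this] show ?thesis by (simp add: formula_rule_def)
  qed
next
  case (Exists i p)
  from Exists.prems(3) obtain x where x: "\<bar>x\<bar> < real M" "approx M d ((env_val bs)(i := x)) p" by auto
  have "open ({x. approx M d ((env_val bs)(i := x)) p} \<inter> {x. \<bar>x\<bar> < real M})"
    by (intro open_Int open_approx open_Collect_less continuous_intros)
  with x obtain e where e: "e > 0"
    "\<And>y. dist y x < e \<Longrightarrow> approx M d ((env_val bs)(i := y)) p \<and> \<bar>y\<bar> < real M"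
    unfolding open_dist by blast
  from e(1) obtain q where "x < rval q" "rval q < x + e" using rval_dense[of x "x + e"] by auto
  then have q: "approx M d ((env_val bs)(i := rval q)) p" "\<bar>rval q\<bar> < real M"
    using e(2)[of "rval q"] by (auto simp: dist_real_def)
  have "derivable truth_rule (judgement 3 (env_code ((i, q) # bs)) (formula_code p) (precision M d flag) 1)"
    using Exists.prems q by (intro Exists.IH) (auto simp: fun_upd_def)
  from derivable_truthI[OF this derivable_0] q show ?case
    by (simp add: formula_rule_def not_le abs_less_iff minus_less_iff)
qed

lemma derivable_sentence_iff:
  "derivable truth_rule (judgement 3 0 (formula_code p) (precision M d flag) 1) \<longleftrightarrow>
    sentence p \<and> (flag \<noteq> 0 \<or> equality_free p) \<and> approx M d (\<lambda>_. 0) p"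
proof
  assume "derivable truth_rule (judgement 3 0 (formula_code p) (precision M d flag) 1)"
  from validD_formula[OF derivable_valid[OF this], of "[]" p]
  show "sentence p \<and> (flag \<noteq> 0 \<or> equality_free p) \<and> approx M d (\<lambda>_. 0) p"
    by (auto simp: sentence_def)
next
  assume "sentence p \<and> (flag \<noteq> 0 \<or> equality_free p) \<and> approx M d (\<lambda>_. 0) p"
  with derivable_approx[of p "[]" flag M d]
  show "derivable truth_rule (judgement 3 0 (formula_code p) (precision M d flag) 1)"
    by (simp add: sentence_def)
qed

section \<open>From approximate truth to truth\<close>

lemma tendsto_term_val:
  "(\<And>i. (\<lambda>n. E n i) \<longlonglongrightarrow> e i) \<Longrightarrow> (\<lambda>n. term_val (E n) t) \<longlonglongrightarrow> term_val e t"
  by (induction t) (auto intro!: tendsto_intros)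

text \<open>A large \<open>M\<close> exceeds the witnesses and brings the margin below the gaps; the
  error only helps. All \<open>M \<ge> N\<close> are covered so that conjunctions can take a
  maximum.\<close>

lemma holds_imp_approx: "holds e p \<Longrightarrow> \<exists>N. \<forall>M\<ge>N. \<forall>d. approx M d e p"
proof (induction p arbitrary: e)
  case (Less s t)
  then obtain N where N: "1 / (real N + 1) < term_val e t - term_val e s"
    using nat_approx_posE[of "term_val e t - term_val e s"]
    by (auto simp: add.commute)
  have "approx M d e (Less s t)" if "M \<ge> N" for M d
  proof -
    have "1 / (real M + 1) \<le> 1 / (real N + 1)" using that by (simp add: frac_le)
    moreover have "0 < 1 / (real d + 1)" by simp
    ultimately show ?thesis using N unfolding approx.simps by linarith
  qed
  then show ?case by blast
next
  case (Conj p q)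
  then obtain N1 N2 where "\<forall>M\<ge>N1. \<forall>d. approx M d e p" "\<forall>M\<ge>N2. \<forall>d. approx M d e q"
    by (metis holds.simps(3))
  then show ?case by (intro exI[of _ "max N1 N2"]) auto
next
  case (Disj p q)
  then obtain N where "(\<forall>M\<ge>N. \<forall>d. approx M d e p) \<or> (\<forall>M\<ge>N. \<forall>d. approx M d e q)"
    by (metis holds.simps(4))
  then show ?case by (intro exI[of _ N]) auto
next
  case (Exists i p)
  then obtain x N where N: "\<forall>M\<ge>N. \<forall>d. approx M d (e(i := x)) p" by (metis holds.simps(5))
  obtain N' where N': "\<bar>x\<bar> < real N'" using reals_Archimedean2 by blast
  have "approx M d e (Exists i p)" if "M \<ge> max N N'" for M d
    using that N N' by (auto intro!: exI[of _ x])
  then show ?case by blast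
qed auto

text \<open>Bolzano-Weierstrass: the bound on the witnesses makes the approximate witnesses accumulate.\<close>

lemma approx_imp_holds:
  assumes "strict_mono r" "\<And>i. (\<lambda>n. E n i) \<longlonglongrightarrow> e i" "\<And>n. approx M (r n) (E n) p"
  shows "holds e p"
  using assms
proof (induction p arbitrary: r E e)
  case (Less s t)
  have lim: "(\<lambda>n. 1 / (real (r n) + 1)) \<longlonglongrightarrow> 0"
    using LIMSEQ_subseq_LIMSEQ[OF LIMSEQ_inverse_real_of_nat Less(1)]
    by (simp add: comp_def divide_inverse add.commute)
  \<comment> \<open>The limit destroys strictness, but the margin, which does not depend on
    \<open>n\<close>, remains.\<close>
  have "term_val e s + 1 / (real M + 1) \<le> term_val e t + 0"
  proof (rule LIMSEQ_le)
    show "(\<lambda>n. term_val (E n) s + 1 / (real M + 1)) \<longlonglongrightarrow> term_val e s + 1 / (real M + 1)"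
      "(\<lambda>n. term_val (E n) t + 1 / (real (r n) + 1)) \<longlonglongrightarrow> term_val e t + 0"
      using Less(2) lim by (intro tendsto_intros tendsto_term_val; simp)+
    show "\<exists>N. \<forall>n\<ge>N. term_val (E n) s + 1 / (real M + 1) \<le> term_val (E n) t + 1 / (real (r n) + 1)"
      using Less(3) by (auto intro: less_imp_le)
  qed
  moreover have "0 < 1 / (real M + 1)" by simp
  ultimately show ?case unfolding holds.simps by linarith
next
  case (Equal s t)
  have lim: "(\<lambda>n. 1 / (real (r n) + 1)) \<longlonglongrightarrow> 0"
    using LIMSEQ_subseq_LIMSEQ[OF LIMSEQ_inverse_real_of_nat Equal(1)]
    by (simp add: comp_def divide_inverse add.commute)
  have "\<bar>term_val e s - term_val e t\<bar> \<le> 0"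
  proof (rule LIMSEQ_le)
    show "(\<lambda>n. \<bar>term_val (E n) s - term_val (E n) t\<bar>) \<longlonglongrightarrow> \<bar>term_val e s - term_val e t\<bar>"
      using Equal(2) by (intro tendsto_intros tendsto_term_val; simp)
    show "(\<lambda>n. 1 / (real (r n) + 1)) \<longlonglongrightarrow> 0" by (rule lim)
    show "\<exists>N. \<forall>n\<ge>N. \<bar>term_val (E n) s - term_val (E n) t\<bar> \<le> 1 / (real (r n) + 1)"
      using Equal(3) by (auto intro: less_imp_le)
  qed
  then show ?case by simp
next
  case (Conj p q)
  have "holds e p" by (rule Conj.IH(1)[OF Conj.prems(1,2)]) (use Conj.prems(3) in auto)
  moreover have "holds e q" by (rule Conj.IH(2)[OF Conj.prems(1,2)]) (use Conj.prems(3) in auto)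
  ultimately show ?case by simp
next
  case (Disj p q)
  have sub: "\<exists>f :: nat \<Rightarrow> nat. strict_mono f \<and> (\<forall>n. f n \<in> S)" if "infinite S" for S :: "nat set"
    using infinite_enumerate[OF that] by blast
  \<comment> \<open>One disjunct holds infinitely often; the induction is general in
    \<open>r\<close> and \<open>E\<close> so that it applies to that subsequence.\<close>
  have "infinite {n. approx M (r n) (E n) p} \<or> infinite {n. approx M (r n) (E n) q}"
  proof (rule ccontr)
    assume "\<not> ?thesis"
    then have "finite ({n. approx M (r n) (E n) p} \<union> {n. approx M (r n) (E n) q})" by simp
    moreover have "{n. approx M (r n) (E n) p} \<union> {n. approx M (r n) (E n) q} = UNIV"
      using Disj.prems(3) by auto
    ultimately show False by simp
  qed
  then show ?case
  proof
    assume "infinite {n. approx M (r n) (E n) p}"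
    from sub[OF this] obtain f :: "nat \<Rightarrow> nat" where f: "strict_mono f" and "\<forall>n. f n \<in> {n. approx M (r n) (E n) p}"
      by (elim exE conjE)
    then have f': "approx M (r (f n)) (E (f n)) p" for n by simp
    have "holds e p"
    proof (rule Disj.IH(1)[of "r \<circ> f" "E \<circ> f"])
      show "strict_mono (r \<circ> f)" using Disj.prems(1) f by (rule strict_mono_o)
      show "(\<lambda>n. (E \<circ> f) n i) \<longlonglongrightarrow> e i" for i
        using LIMSEQ_subseq_LIMSEQ[OF Disj.prems(2) f] by (simp add: comp_def)
    qed (simp add: f')
    then show ?thesis by simp
  next
    assume "infinite {n. approx M (r n) (E n) q}"
    from sub[OF this] obtain f :: "nat \<Rightarrow> nat" where f: "strict_mono f" and "\<forall>n. f n \<in> {n. approx M (r n) (E n) q}"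
      by (elim exE conjE)
    then have f': "approx M (r (f n)) (E (f n)) q" for n by simp
    have "holds e q"
    proof (rule Disj.IH(2)[of "r \<circ> f" "E \<circ> f"])
      show "strict_mono (r \<circ> f)" using Disj.prems(1) f by (rule strict_mono_o)
      show "(\<lambda>n. (E \<circ> f) n i) \<longlonglongrightarrow> e i" for i
        using LIMSEQ_subseq_LIMSEQ[OF Disj.prems(2) f] by (simp add: comp_def)
    qed (simp add: f')
    then show ?thesis by simp
  qed
next
  case (Exists i p)
  from Exists.prems(3) have "\<forall>n. \<exists>x. \<bar>x\<bar> < real M \<and> approx M (r n) ((E n)(i := x)) p" by simp
  then obtain x where x: "\<And>n. \<bar>x n\<bar> < real M" "\<And>n. approx M (r n) ((E n)(i := x n)) p" by metis
  \<comment> \<open>The bound \<open>M\<close> makes a monotone subsequence of the witnesses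
    converge, and its limit is the witness for \<open>p\<close>.\<close>
  obtain f where f: "strict_mono f" "monoseq (\<lambda>n. x (f n))" using seq_monosub[of x] by blast
  have "Bseq (\<lambda>n. x (f n))" using x(1) by (intro BseqI'[of _ "real M"]) (simp add: less_imp_le)
  with f(2) obtain l where l: "(\<lambda>n. x (f n)) \<longlonglongrightarrow> l"
    using Bseq_monoseq_convergent convergent_def by blast
  have "holds (e(i := l)) p"
  proof (rule Exists.IH[of "r \<circ> f" "\<lambda>n. (E (f n))(i := x (f n))"])
    show "strict_mono (r \<circ> f)" using Exists.prems(1) f(1) by (rule strict_mono_o)
    show "(\<lambda>n. ((E (f n))(i := x (f n))) j) \<longlonglongrightarrow> (e(i := l)) j" for j
      using LIMSEQ_subseq_LIMSEQ[OF Exists.prems(2)[of j] f(1)] l by (simp add: comp_def)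
  qed (use x(2) in \<open>simp add: fun_upd_def\<close>)
  then show ?case by auto
qed

lemma holds_iff_approx: "holds e p \<longleftrightarrow> (\<exists>M. \<forall>d. approx M d e p)"
proof
  assume "holds e p"
  then show "\<exists>M. \<forall>d. approx M d e p" using holds_imp_approx[of e p] by blast
next
  assume "\<exists>M. \<forall>d. approx M d e p"
  then obtain M where "\<forall>d. approx M d e p" by blast
  then show "holds e p"
    by (intro approx_imp_holds[of id "\<lambda>_. e" e M p]) (auto simp: strict_mono_id)
qed

text \<open>With \<open>d = M\<close> the two fractions cancel, and only the bound on witnesses
  distinguishes \<open>approx\<close> from truth.\<close>

lemma approx_diagonal_imp_holds: "equality_free p \<Longrightarrow> approx M M e p \<Longrightarrow> holds e p"
  by (induction p arbitrary: e) auto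

lemma holds_iff_approx_diagonal: "equality_free p \<Longrightarrow> holds e p \<longleftrightarrow> (\<exists>M. approx M M e p)"
  using holds_imp_approx approx_diagonal_imp_holds by blast

text \<open>Derivability must reject numbers that code no formula, because the sets of true
  sentences consist of codes.\<close>

definition well_coded :: "nat \<Rightarrow> bool" where
  "well_coded x \<longleftrightarrow> (j_kind x = 1 \<longrightarrow> j_exp x \<in> range term_code) \<and>
    (j_kind x = 3 \<longrightarrow> j_exp x \<in> range formula_code)"

lemma term_code_rangeI:
  "prod_encode (0, i) \<in> range term_code"
  "prod_encode (1, 0) \<in> range term_code" "prod_encode (2, 0) \<in> range term_code"
  "a \<in> range term_code \<Longrightarrow> b \<in> range term_code \<Longrightarrow> prod_encode (3, prod_encode (a, b)) \<in> range term_code"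
  "a \<in> range term_code \<Longrightarrow> b \<in> range term_code \<Longrightarrow> prod_encode (4, prod_encode (a, b)) \<in> range term_code"
  "a \<in> range term_code \<Longrightarrow> prod_encode (5, a) \<in> range term_code"
  using rangeI[of term_code "Var i"] rangeI[of term_code Zero] rangeI[of term_code One]
    rangeI[of term_code "Add _ _"] rangeI[of term_code "Mult _ _"] rangeI[of term_code "Sin _"]
  by (auto simp del: rangeI)

lemma pfst_eq_0_range: "pfst c = 0 \<Longrightarrow> c \<in> range term_code"
  using term_code_rangeI(1)[of "psnd c"] encode_pfst_psnd[of c] by simp

lemma formula_code_rangeI:
  "a \<in> range term_code \<Longrightarrow> b \<in> range term_code \<Longrightarrow> prod_encode (0, prod_encode (a, b)) \<in> range formula_code"
  "a \<in> range term_code \<Longrightarrow> b \<in> range term_code \<Longrightarrow> prod_encode (1, prod_encode (a, b)) \<in> range formula_code"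
  "c \<in> range formula_code \<Longrightarrow> d \<in> range formula_code \<Longrightarrow> prod_encode (2, prod_encode (c, d)) \<in> range formula_code"
  "c \<in> range formula_code \<Longrightarrow> d \<in> range formula_code \<Longrightarrow> prod_encode (3, prod_encode (c, d)) \<in> range formula_code"
  "c \<in> range formula_code \<Longrightarrow> prod_encode (4, prod_encode (i, c)) \<in> range formula_code"
  using rangeI[of formula_code "Less _ _"] rangeI[of formula_code "Equal _ _"] rangeI[of formula_code "Conj _ _"]
    rangeI[of formula_code "Disj _ _"] rangeI[of formula_code "Exists i _"]
  by (auto simp del: rangeI)

lemma series_rule_kind: "series_rule x y z \<Longrightarrow> j_kind x = 2"
  unfolding series_rule_def by (elim disjE conjE; drule arg_cong[where f = j_kind]; simp only: judgement_simps)

lemma derivable_well_coded: "derivable truth_rule x \<Longrightarrow> well_coded x"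
proof (induction rule: derivable.induct)
  case derivable_0
  then show ?case by (simp add: well_coded_def j_kind_def pfst_def prod_decode_def prod_decode_aux.simps)
next
  case (derivable_step y z x)
  from derivable_step.hyps(3) show ?case
    unfolding truth_rule_def
  proof (elim disjE)
    assume "term_rule x y z"
    then have "j_kind x = 1" and "pfst (j_exp x) = 0 \<or> j_exp x = prod_encode (1, 0) \<or> j_exp x = prod_encode (2, 0)
      \<or> j_kind y = 1 \<and> (j_kind z = 1 \<and> (j_exp x = prod_encode (3, prod_encode (j_exp y, j_exp z))
          \<or> j_exp x = prod_encode (4, prod_encode (j_exp y, j_exp z)))
        \<or> j_exp x = prod_encode (5, j_exp y))"
      unfolding term_rule_def by argo+
    moreover from this(2) have "j_exp x \<in> range term_code"
      using derivable_step.IH unfolding well_coded_def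
      by (elim conjE disjE) (simp_all only: term_code_rangeI pfst_eq_0_range simp_thms)
    ultimately show ?thesis by (simp add: well_coded_def)
  next
    assume "series_rule x y z"
    then show ?thesis using series_rule_kind by (simp add: well_coded_def)
  next
    assume "formula_rule x y z"
    then have "j_kind x = 3" and "j_kind y = 1 \<and> j_kind z = 1 \<and>
          (j_exp x = prod_encode (0, prod_encode (j_exp y, j_exp z))
          \<or> j_exp x = prod_encode (1, prod_encode (j_exp y, j_exp z)))
      \<or> j_kind y = 3 \<and> (j_kind z = 3 \<and> (j_exp x = prod_encode (2, prod_encode (j_exp y, j_exp z))
          \<or> j_exp x = prod_encode (3, prod_encode (j_exp y, j_exp z)))
        \<or> j_exp x = prod_encode (4, prod_encode (env_var (j_env y), j_exp y)))"
      unfolding formula_rule_def by argo+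
    moreover from this(2) have "j_exp x \<in> range formula_code"
      using derivable_step.IH unfolding well_coded_def
      by (elim conjE disjE) (simp_all only: formula_code_rangeI simp_thms)
    ultimately show ?thesis by (simp add: well_coded_def)
  qed
qed

lemma derivable_formula_code:
  assumes "derivable truth_rule (judgement 3 e c k m)"
  obtains p where "c = formula_code p"
  using derivable_well_coded[OF assms] by (auto simp: well_coded_def)

text \<open>Since derivability amounts to one existential quantifier, this is the quantifier form of
  \<open>Sigma0 3\<close>.\<close>

lemma Th_sin_iff:
  "c \<in> Th_sin \<longleftrightarrow> (\<exists>M. \<forall>d. derivable truth_rule (judgement 3 0 c (precision M d 1) 1))"
proof
  assume "c \<in> Th_sin"
  then obtain p where c: "c = formula_code p" and p: "sentence p" "holds (\<lambda>_. 0) p"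
    unfolding Th_sin_def true_sentence_def by blast
  then show "\<exists>M. \<forall>d. derivable truth_rule (judgement 3 0 c (precision M d 1) 1)"
    unfolding c derivable_sentence_iff holds_iff_approx by simp
next
  assume *: "\<exists>M. \<forall>d. derivable truth_rule (judgement 3 0 c (precision M d 1) 1)"
  then obtain p where c: "c = formula_code p" using derivable_formula_code by metis
  from * have "sentence p" "holds (\<lambda>_. 0) p"
    unfolding c derivable_sentence_iff holds_iff_approx by auto
  then show "c \<in> Th_sin" using true_sentence_iff_holds c unfolding Th_sin_def by blast
qed

lemma Th_sin_less_iff:
  "c \<in> Th_sin_less \<longleftrightarrow> (\<exists>M. derivable truth_rule (judgement 3 0 c (precision M M 0) 1))"
proof
  assume "c \<in> Th_sin_less"
  then obtain p where c: "c = formula_code p" and p: "equality_free p" "sentence p" "holds (\<lambda>_. 0) p"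
    unfolding Th_sin_less_def true_sentence_def by blast
  then show "\<exists>M. derivable truth_rule (judgement 3 0 c (precision M M 0) 1)"
    unfolding c derivable_sentence_iff holds_iff_approx_diagonal[OF p(1)] by simp
next
  assume *: "\<exists>M. derivable truth_rule (judgement 3 0 c (precision M M 0) 1)"
  then obtain p where c: "c = formula_code p" using derivable_formula_code by metis
  from * have p: "equality_free p" "sentence p" "\<exists>M. approx M M (\<lambda>_. 0) p"
    unfolding c derivable_sentence_iff by auto
  then have "holds (\<lambda>_. 0) p" using holds_iff_approx_diagonal by blast
  then show "c \<in> Th_sin_less" using true_sentence_iff_holds p c unfolding Th_sin_less_def by blast
qed

section \<open>The two upper bounds\<close>

lemma recursive_computable:
  assumes "computable f" "recursive n g" shows "recursive n (\<lambda>xs. f (g xs))"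
  using assms(1) unfolding computable_def by (rule recursive_comp1) (rule assms(2))

lemma ER_sin_subset: "ER_sin \<subseteq> Sigma0 3"
proof
  fix A assume "A \<in> ER_sin"
  then obtain f where f: "computable f" "\<And>x. x \<in> A \<longleftrightarrow> f x \<in> Th_sin"
    unfolding ER_sin_def many_one_reducible_def by blast
  let ?D = "\<lambda>w d M x. derivation truth_rule w (judgement 3 0 (f x) (precision M d 1) 1)"
  have "decidable_rel (Suc (Suc 2)) (\<lambda>xs. ?D (xs ! 0) (xs ! 1) (xs ! 2) (xs ! 3))"
    by (intro decidable_derivation decidable_truth_rule rec_intros recursive_computable[OF f(1)]) simp_all
  then have "pi_rel 0 (Suc (Suc 2)) (\<lambda>xs. ?D (xs ! 0) (xs ! 1) (xs ! 2) (xs ! 3))" by simp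
  then have "sigma_rel 1 (Suc 2) (\<lambda>xs. \<exists>w. ?D w (xs ! 0) (xs ! 1) (xs ! 2))"
    unfolding One_nat_def sigma_rel.simps(2)
    by (intro exI[of _ "\<lambda>xs. ?D (xs ! 0) (xs ! 1) (xs ! 2) (xs ! 3)"]) simp
  then have "pi_rel (Suc 1) (Suc 1) (\<lambda>xs. \<forall>d. \<exists>w. ?D w d (xs ! 0) (xs ! 1))"
    unfolding pi_rel.simps(2)
    by (intro exI[of _ "\<lambda>xs. \<exists>w. ?D w (xs ! 0) (xs ! 1) (xs ! 2)"]) (simp add: numeral_2_eq_2)
  moreover have "hd xs \<in> A \<longleftrightarrow> (\<exists>M. \<forall>d. \<exists>w. ?D w d ((M # xs) ! 0) ((M # xs) ! 1))" if len: "length xs = 1" for xs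
  proof -
    obtain x where "xs = [x]" using len by (auto simp: length_Suc_conv)
    then show ?thesis by (simp only: f(2) Th_sin_iff derivable_iff_derivation) simp
  qed
  ultimately have "sigma_rel (Suc (Suc 1)) 1 (\<lambda>xs. hd xs \<in> A)"
    unfolding sigma_rel.simps(2) One_nat_def by (intro exI conjI allI impI)
  then show "A \<in> Sigma0 3" by (simp add: Sigma0_def numeral_3_eq_3)
qed

lemma ER_sin_less_subset: "ER_sin_less \<subseteq> Sigma0 1"
proof
  fix A assume "A \<in> ER_sin_less"
  then obtain f where f: "computable f" "\<And>x. x \<in> A \<longleftrightarrow> f x \<in> Th_sin_less"
    unfolding ER_sin_less_def many_one_reducible_def by blast
  \<comment> \<open>One number codes the pair of the derivation and \<open>M\<close>, which merges
    two existential quantifiers.\<close>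
  let ?D = "\<lambda>y x. derivation truth_rule (pfst y) (judgement 3 0 (f x) (precision (psnd y) (psnd y) 0) 1)"
  have "decidable_rel (Suc 1) (\<lambda>xs. ?D (xs ! 0) (xs ! 1))"
    by (intro decidable_derivation decidable_truth_rule rec_intros recursive_computable[OF f(1)]) simp_all
  moreover have "x \<in> A \<longleftrightarrow> (\<exists>y. ?D y x)" for x
  proof
    assume "x \<in> A"
    then obtain M w where "derivation truth_rule w (judgement 3 0 (f x) (precision M M 0) 1)"
      unfolding f(2) Th_sin_less_iff derivable_iff_derivation by (elim exE)
    then have "?D (prod_encode (w, M)) x" by simp
    then show "\<exists>y. ?D y x" by (rule exI)
  next
    assume "\<exists>y. ?D y x"
    then show "x \<in> A" unfolding f(2) Th_sin_less_iff derivable_iff_derivation by (elim exE) (intro exI)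
  qed
  ultimately have "sigma_rel (Suc 0) 1 (\<lambda>xs. hd xs \<in> A)"
    unfolding sigma_rel.simps
    by (intro exI[of _ "\<lambda>xs. ?D (xs ! 0) (xs ! 1)"]) (auto simp: length_Suc_conv)
  then show "A \<in> Sigma0 1" by (simp add: Sigma0_def)
qed

section \<open>Counter programs\<close>

text \<open>\<open>Dec\<close> blocks at zero and \<open>Tst\<close> everywhere else, so they act as
  guards. \<open>Star\<close> followed by a test yields loops; without one it guesses.\<close>

datatype cmd = Inc nat | Dec nat | Tst nat | Seq cmd cmd | Star cmd

type_synonym store = "nat \<Rightarrow> nat"

primrec exec :: "cmd \<Rightarrow> (store \<times> store) set" where
  "exec (Inc i) = {(s, t). t = s(i := Suc (s i))}"
| "exec (Dec i) = {(s, t). 0 < s i \<and> t = s(i := s i - 1)}"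
| "exec (Tst i) = {(s, t). s i = 0 \<and> t = s}"
| "exec (Seq c d) = exec c O exec d"
| "exec (Star c) = (exec c)\<^sup>*"

definition agree :: "nat \<Rightarrow> store \<Rightarrow> store \<Rightarrow> bool" where
  "agree m s t \<longleftrightarrow> (\<forall>r<m. s r = t r)"

text \<open>Registers from \<open>m\<close> on are scratch space: arbitrary before, unspecified
  after. A nondeterministic program may get stuck, so existence of a complete run and correctness of
  all complete runs are demanded separately.\<close>

definition implements :: "nat \<Rightarrow> cmd \<Rightarrow> (store \<Rightarrow> store) \<Rightarrow> bool" where
  "implements m c f \<longleftrightarrow> (\<forall>s s'. agree m s s' \<longrightarrow>
    (\<exists>t. (s', t) \<in> exec c) \<and> (\<forall>t. (s', t) \<in> exec c \<longrightarrow> agree m t (f s)))"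

lemma agree_refl [simp]: "agree m s s" by (simp add: agree_def)

lemma agree_sym: "agree m s t \<Longrightarrow> agree m t s" by (simp add: agree_def)

lemma agree_trans: "agree m s t \<Longrightarrow> agree m t u \<Longrightarrow> agree m s u" by (simp add: agree_def)

lemma implementsI:
  assumes "\<And>s. \<exists>t. (s, t) \<in> exec c" "\<And>s s' t. agree m s s' \<Longrightarrow> (s', t) \<in> exec c \<Longrightarrow> agree m t (f s)"
  shows "implements m c f"
  using assms unfolding implements_def by simp

lemma implements_total: "implements m c f \<Longrightarrow> \<exists>t. (s, t) \<in> exec c"
  unfolding implements_def using agree_refl by blast

lemma implements_agree: "implements m c f \<Longrightarrow> agree m s s' \<Longrightarrow> (s', t) \<in> exec c \<Longrightarrow> agree m t (f s)"
  unfolding implements_def by blast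

lemma implements_Seq:
  assumes "implements m c f" "implements m d g"
  shows "implements m (Seq c d) (\<lambda>s. g (f s))"
proof (rule implementsI)
  fix s
  obtain t u where "(s, t) \<in> exec c" "(t, u) \<in> exec d"
    using implements_total[OF assms(1)] implements_total[OF assms(2)] by meson
  then show "\<exists>u. (s, u) \<in> exec (Seq c d)" by auto
next
  fix s s' u assume "agree m s s'" "(s', u) \<in> exec (Seq c d)"
  then obtain t where "(s', t) \<in> exec c" "(t, u) \<in> exec d" by auto
  then show "agree m u (g (f s))"
    using implements_agree assms \<open>agree m s s'\<close> agree_sym by metis
qed

lemma implements_mono:
  assumes "implements M c f" "m \<le> M" "\<And>s. agree m (f s) (g s)"
    "\<And>s s'. agree m s s' \<Longrightarrow> agree m (g s) (g s')"
  shows "implements m c g"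
proof (rule implementsI)
  show "\<exists>t. (s, t) \<in> exec c" for s by (rule implements_total[OF assms(1)])
next
  fix s s' t assume *: "agree m s s'" "(s', t) \<in> exec c"
  from implements_agree[OF assms(1) agree_refl *(2)] have "agree M t (f s')" .
  then have "agree m t (f s')" using assms(2) by (simp add: agree_def)
  then show "agree m t (g s)" using assms(3,4) * agree_sym agree_trans by metis
qed

lemma implements_exact:
  assumes "exec c = {(s, t). t = F s}" "\<And>s s'. agree m s s' \<Longrightarrow> agree m (F s') (f s)"
  shows "implements m c f"
  using assms by (intro implementsI) auto

lemma implements_Inc: "i < m \<Longrightarrow> implements m (Inc i) (\<lambda>s. s(i := Suc (s i)))"
  by (rule implements_exact) (auto simp: agree_def)

text \<open>\<open>h\<close> is constant along the loop and is the identity at the exit, where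
  \<open>k\<close> is zero; the exit is reached since \<open>k\<close> falls in every pass.\<close>

lemma star_loop_exec:
  assumes body: "exec c = {(s, t). 0 < s k \<and> t = g s}"
    and dec: "\<And>s. 0 < s k \<Longrightarrow> Suc (g s k) = s k"
    and h: "\<And>s. s k = 0 \<Longrightarrow> h s = s" "\<And>s. 0 < s k \<Longrightarrow> h (g s) = h s" "\<And>s. h s k = 0"
  shows "exec (Seq (Star c) (Tst k)) = {(s, t). t = h s}"
proof -
  have 1: "(s, h s) \<in> (exec c)\<^sup>*" for s
  proof (induction "s k" arbitrary: s)
    case 0
    then show ?case using h(1) by simp
  next
    case (Suc n)
    then have "(s, g s) \<in> exec c" "n = g s k" using body dec[of s] by auto
    moreover have "(g s, h (g s)) \<in> (exec c)\<^sup>*" using Suc.hyps(1) \<open>n = g s k\<close> by simp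
    ultimately show ?case using h(2)[of s] Suc.hyps(2) by (simp add: converse_rtrancl_into_rtrancl)
  qed
  have 2: "h s = h t" if "(s, t) \<in> (exec c)\<^sup>*" for s t
    using that by (induction rule: rtrancl_induct) (auto simp: body h(2))
  show ?thesis using 1 2 h(1,3) by (fastforce simp: relcomp_unfold)
qed

definition clear :: "nat \<Rightarrow> cmd" where "clear r = Seq (Star (Dec r)) (Tst r)"

lemma exec_clear: "exec (clear r) = {(s, t). t = s(r := 0)}"
  unfolding clear_def
  by (rule star_loop_exec[where g = "\<lambda>s. s(r := s r - 1)"]) auto

definition move :: "nat \<Rightarrow> nat \<Rightarrow> cmd" where
  "move a b = Seq (Star (Seq (Dec a) (Inc b))) (Tst a)"

lemma exec_move: "a \<noteq> b \<Longrightarrow> exec (move a b) = {(s, t). t = s(a := 0, b := s b + s a)}"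
  unfolding move_def
  by (rule star_loop_exec[where g = "\<lambda>s. s(a := s a - 1, b := Suc (s b))"])
    (simp_all add: relcomp_unfold, auto simp: fun_eq_iff)

definition move2 :: "nat \<Rightarrow> nat \<Rightarrow> nat \<Rightarrow> cmd" where
  "move2 a b u = Seq (Star (Seq (Dec a) (Seq (Inc b) (Inc u)))) (Tst a)"

lemma exec_move2: "distinct [a, b, u] \<Longrightarrow>
    exec (move2 a b u) = {(s, t). t = s(a := 0, b := s b + s a, u := s u + s a)}"
  unfolding move2_def
  by (rule star_loop_exec[where g = "\<lambda>s. s(a := s a - 1, b := Suc (s b), u := Suc (s u))"])
    (simp_all add: relcomp_unfold, auto simp: fun_eq_iff)

text \<open>Reading a counter empties it, hence the detour: move to \<open>b\<close> and
  \<open>u\<close> at once, then back from \<open>u\<close>.\<close>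

definition copy :: "nat \<Rightarrow> nat \<Rightarrow> nat \<Rightarrow> cmd" where
  "copy u a b = Seq (clear b) (Seq (clear u) (Seq (move2 a b u) (move u a)))"

lemma exec_Seq_function:
  "exec c = {(s, t). t = f s} \<Longrightarrow> exec d = {(s, t). t = g s} \<Longrightarrow> exec (Seq c d) = {(s, t). t = g (f s)}"
  by (simp add: relcomp_unfold)

lemma exec_copy: "distinct [a, b, u] \<Longrightarrow> exec (copy u a b) = {(s, t). t = s(b := s a, u := 0)}"
proof -
  assume d: "distinct [a, b, u]"
  let ?F = "\<lambda>s::store. (s(b := 0))(u := 0)"
  let ?G = "\<lambda>s::store. s(a := 0, b := s b + s a, u := s u + s a)"
  let ?H = "\<lambda>s::store. s(u := 0, a := s a + s u)"
  have "exec (copy u a b) = {(s, t). t = ?H (?G (?F s))}"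
    unfolding copy_def
    by (intro exec_Seq_function[OF exec_clear] exec_Seq_function[OF exec_clear]
        exec_Seq_function[OF exec_move2[OF d]] exec_move[OF not_sym]) (use d in auto)
  moreover have "?H (?G (?F s)) = s(b := s a, u := 0)" for s
    using d by (intro ext) auto
  ultimately show ?thesis by (simp only:)
qed

lemma implements_clear: "r < m \<Longrightarrow> implements m (clear r) (\<lambda>s. s(r := 0))"
  by (rule implements_exact[OF exec_clear]) (auto simp: agree_def)

lemma implements_copy:
  assumes "a < m" "b < m" "a \<noteq> b"
  shows "implements m (copy m a b) (\<lambda>s. s(b := s a))"
  by (rule implements_exact[OF exec_copy]) (use assms in \<open>auto simp: agree_def\<close>)

lemma implements_for:
  assumes c: "implements m c f" and k: "k < m" "\<And>s. f s k = s k"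
  shows "implements m (Seq (Star (Seq (Dec k) c)) (Tst k)) (\<lambda>s. ((\<lambda>s. f (s(k := s k - 1))) ^^ s k) s)"
proof (rule implementsI)
  let ?B = "exec (Seq (Dec k) c)" and ?g = "\<lambda>s. f (s(k := s k - 1))"
  have body_step: "0 < s' k \<and> agree m t (?g s)" if "agree m s s'" "(s', t) \<in> ?B" for s s' t
  proof -
    from that(2) have t: "0 < s' k" "(s'(k := s' k - 1), t) \<in> exec c" by auto
    have "agree m (s(k := s k - 1)) (s'(k := s' k - 1))" using that(1) k(1) by (simp add: agree_def)
    from implements_agree[OF c this t(2)] t(1) show ?thesis by simp
  qed
  have ex: "\<exists>t. (s, t) \<in> ?B" if "0 < s k" for s
    using implements_total[OF c, of "s(k := s k - 1)"] that by auto
  show "\<exists>t. (s, t) \<in> exec (Seq (Star (Seq (Dec k) c)) (Tst k))" for s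
  proof -
    have "\<exists>t. (s, t) \<in> ?B\<^sup>* \<and> t k = 0"
    proof (induction "s k" arbitrary: s)
      case (Suc n)
      then obtain s' where s': "(s, s') \<in> ?B" using ex[of s] by auto
      from body_step[OF agree_refl s'] have "s' k = s k - 1" using k by (auto simp: agree_def)
      with Suc obtain t where "(s', t) \<in> ?B\<^sup>*" "t k = 0" by (metis diff_Suc_1)
      with s' show ?case by (meson converse_rtrancl_into_rtrancl)
    qed auto
    then show ?thesis by (auto simp: relcomp_unfold)
  qed
  fix s s' t assume agr: "agree m s s'" and "(s', t) \<in> exec (Seq (Star (Seq (Dec k) c)) (Tst k))"
  then have t: "(s', t) \<in> ?B\<^sup>*" "t k = 0" by (auto simp: relcomp_unfold)
  \<comment> \<open>\<open>f\<close> preserves \<open>k\<close>, so the value of \<open>k\<close>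
    counts the passes, and the final test admits exactly \<open>s k\<close> of them.\<close>
  have val: "(?g ^^ n) s k = s k - n" for n by (induction n) (auto simp: k(2))
  from t(1) have "\<exists>n\<le>s k. agree m t ((?g ^^ n) s)"
  proof (induction rule: rtrancl_induct)
    case base
    then show ?case using agr agree_sym by (intro exI[of _ 0]) auto
  next
    case (step t u)
    then obtain n where n: "n \<le> s k" "agree m t ((?g ^^ n) s)" by blast
    from body_step[OF agree_sym[OF n(2)] step.hyps(2)] have "0 < t k" "agree m u ((?g ^^ Suc n) s)" by simp_all
    moreover from this(1) n k(1) val[of n] have "Suc n \<le> s k" by (simp add: agree_def)
    ultimately show ?case by blast
  qed
  then obtain n where n: "n \<le> s k" "agree m t ((?g ^^ n) s)" by blast
  from n(2) k(1) t(2) val[of n] have "n = s k" using n(1) by (simp add: agree_def)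
  with n(2) show "agree m t ((?g ^^ s k) s)" by simp
qed

text \<open>Arbitrary positions of inputs and output allow a compiled function to be placed anywhere
  inside a larger program.\<close>

definition compilable :: "nat \<Rightarrow> (nat list \<Rightarrow> nat) \<Rightarrow> bool" where
  "compilable n f \<longleftrightarrow> (\<forall>m ins out. length ins = n \<longrightarrow> set ins \<subseteq> {..<m} \<longrightarrow> out < m \<longrightarrow> out \<notin> set ins \<longrightarrow>
    (\<exists>c. implements m c (\<lambda>s. s(out := f (map s ins)))))"

lemma compilableD:
  assumes "compilable n f" "length ins = n" "set ins \<subseteq> {..<m}" "out < m" "out \<notin> set ins"
  obtains c where "implements m c (\<lambda>s. s(out := f (map s ins)))"
  using assms unfolding compilable_def by blast

lemma agree_map: "agree m s s' \<Longrightarrow> set ins \<subseteq> {..<m} \<Longrightarrow> map s ins = map s' ins"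
  by (auto simp: agree_def)

lemma map_upd_fresh: "k \<notin> set ins \<Longrightarrow> map (s(k := x)) ins = map s ins"
  by auto

lemma agree_assign:
  "agree m s s' \<Longrightarrow> set ins \<subseteq> {..<m} \<Longrightarrow> agree m (s(out := f (map s ins))) (s'(out := f (map s' ins)))"
  using agree_map[of m s s' ins] by (auto simp: agree_def simp del: map_eq_conv)

text \<open>Results of sub-computations are stored in the registers from \<open>m\<close> on.\<close>

lemma compilable_list:
  assumes "\<forall>g\<in>set gs. compilable (length ins) g" "set ins \<subseteq> {..<m}" "m + length gs \<le> M"
  shows "\<exists>c. implements M c (\<lambda>s r. if m \<le> r \<and> r < m + length gs then (gs ! (r - m)) (map s ins) else s r)"
  using assms
proof (induction gs rule: rev_induct)
  case Nil
  \<comment> \<open>There is no empty command; clearing a scratch register has no visible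
    effect.\<close>
  have "implements (Suc M) (clear M) (\<lambda>s. s(M := 0))" by (rule implements_clear) simp
  then have "implements M (clear M) (\<lambda>s. s)"
    by (rule implements_mono) (auto simp: agree_def)
  then show ?case by (auto simp: implements_def agree_def)
next
  case (snoc g gs)
  then obtain c where c: "implements M c (\<lambda>s r. if m \<le> r \<and> r < m + length gs
      then (gs ! (r - m)) (map s ins) else s r)" (is "implements M c ?F")
    by auto
  have "compilable (length ins) g" using snoc.prems by simp
  then obtain d where d: "implements M d (\<lambda>s. s(m + length gs := g (map s ins)))" (is "implements M d ?G")
    by (rule compilableD[of _ _ ins M "m + length gs"]) (use snoc.prems in auto)
  have "map (?F s) ins = map s ins" for s using snoc.prems(2) by auto
  then have "?G (?F s) = (\<lambda>r. if m \<le> r \<and> r < m + length (gs @ [g])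
      then ((gs @ [g]) ! (r - m)) (map s ins) else s r)" for s
    by (simp only:) (auto simp: fun_eq_iff nth_append)
  with implements_Seq[OF c d] show ?case by auto
qed

lemma compilable_prim:
  assumes f: "compilable n f" and g: "compilable (Suc (Suc n)) g"
  shows "compilable (Suc n) (\<lambda>xs. rec_nat (f (tl xs)) (\<lambda>y r. g (y # r # tl xs)) (hd xs))"
  unfolding compilable_def
proof (intro allI impI)
  fix m out :: nat and ins :: "nat list"
  assume ins: "length ins = Suc n" "set ins \<subseteq> {..<m}" and out: "out < m" "out \<notin> set ins"
  then obtain y ps where yps: "ins = y # ps" "length ps = n" by (auto simp: length_Suc_conv)
  have ps: "set ps \<subseteq> {..<m}" "y < m" "y \<noteq> out" using ins out yps by auto
  \<comment> \<open>Four new registers: recursion index \<open>?k\<close>, accumulator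
    \<open>?a\<close>, remaining passes \<open>?r\<close>, and \<open>?t\<close>, because the output
    of \<open>g\<close> must not be one of its inputs.\<close>
  let ?M = "m + 4" and ?k = m and ?a = "m + 1" and ?r = "m + 2" and ?t = "m + 3"
  have c1: "implements ?M (copy ?M y ?r) (\<lambda>s. s(?r := s y))"
    by (rule implements_copy) (use ps in auto)
  have c2: "implements ?M (clear ?k) (\<lambda>s. s(?k := 0))"
    by (rule implements_clear) simp
  obtain c where c: "implements ?M c (\<lambda>s. s(?a := f (map s ps)))"
    using f by (rule compilableD[of _ _ ps ?M ?a]) (use ps yps in auto)
  obtain d where d: "implements ?M d (\<lambda>s. s(?t := g (map s (?k # ?a # ps))))"
    using g by (rule compilableD[of _ _ "?k # ?a # ps" ?M ?t]) (use ps yps in auto)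
  have c3: "implements ?M (copy ?M ?t ?a) (\<lambda>s. s(?a := s ?t))"
    by (rule implements_copy) auto
  have c4: "implements ?M (Inc ?k) (\<lambda>s. s(?k := Suc (s ?k)))"
    by (rule implements_Inc) auto
  let ?body = "\<lambda>s. (s(?t := g (map s (?k # ?a # ps)), ?a := g (map s (?k # ?a # ps)), ?k := Suc (s ?k)))"
  have "implements ?M (Seq d (Seq (copy ?M ?t ?a) (Inc ?k))) ?body"
    using implements_Seq[OF d implements_Seq[OF c3 c4]] by simp
  from implements_for[OF this, of ?r]
  have loop: "implements ?M (Seq (Star (Seq (Dec ?r) (Seq d (Seq (copy ?M ?t ?a) (Inc ?k))))) (Tst ?r))
      (\<lambda>s. ((\<lambda>s. ?body (s(?r := s ?r - 1))) ^^ s ?r) s)" (is "implements _ ?loop ?L") by simp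
  have c5: "implements ?M (copy ?M ?a out) (\<lambda>s. s(out := s ?a))"
    by (rule implements_copy) (use out in auto)
  define F :: "store \<Rightarrow> store" where "F s = s(?r := s y, ?k := 0, ?a := f (map s ps))" for s
  have F: "s(?r := s y, ?k := 0, ?a := f (map (s(?r := s y, ?k := 0)) ps)) = F s" for s
  proof -
    have "k \<notin> set ps" if "m \<le> k" for k using that ps(1) by auto
    then show ?thesis by (simp add: F_def map_upd_fresh)
  qed
  from implements_Seq[OF c1 implements_Seq[OF c2 implements_Seq[OF c implements_Seq[OF loop c5]]]]
  have all: "implements ?M (Seq (copy ?M y ?r) (Seq (clear ?k) (Seq c (Seq ?loop (copy ?M ?a out)))))
      (\<lambda>s. (?L (F s))(out := ?L (F s) ?a))" (is "implements _ ?c _") by (simp only: F)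
  let ?R = "\<lambda>xs. rec_nat (f (tl xs)) (\<lambda>y r. g (y # r # tl xs)) (hd xs)"
  have key: "agree m ((?L (F s))(out := ?L (F s) ?a)) (s(out := ?R (map s ins)))" for s
  proof -
    define B where "B = (\<lambda>s. ?body (s(?r := s ?r - 1)))"
    have "(B ^^ j) (F s) ?k = j \<and> (B ^^ j) (F s) ?a = rec_nat (f (map s ps)) (\<lambda>y r. g (y # r # map s ps)) j
      \<and> (\<forall>i<m. (B ^^ j) (F s) i = s i)" for j
    proof (induction j)
      case 0
      show ?case by (simp add: F_def)
    next
      case (Suc j)
      define X where "X = (B ^^ j) (F s)"
      have X: "X ?k = j" "X ?a = rec_nat (f (map s ps)) (\<lambda>y r. g (y # r # map s ps)) j" "\<forall>i<m. X i = s i"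
        using Suc by (simp_all add: X_def)
      have "map (X(?r := X ?r - 1)) ps = map s ps"
        using ps X(3) by (auto simp: subset_iff)
      moreover have "B X ?k = Suc (X ?k)" "B X ?a = g (X ?k # X ?a # map (X(?r := X ?r - 1)) ps)"
        "\<forall>i<m. B X i = X i"
        by (simp_all add: B_def)
      moreover have "(B ^^ Suc j) (F s) = B X" by (simp add: X_def)
      ultimately show ?case using X by (simp del: map_eq_conv)
    qed
    moreover have "?L (F s) = (B ^^ s y) (F s)" using ps by (simp add: B_def F_def)
    ultimately show ?thesis by (simp add: agree_def yps)
  qed
  have "implements m ?c (\<lambda>s. s(out := ?R (map s ins)))"
    using all by (rule implements_mono) (use key agree_assign[OF _ ins(2), of _ _ out ?R] in auto)
  then show "\<exists>c. implements m c (\<lambda>s. s(out := ?R (map s ins)))" by blast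
qed

text \<open>A pass of the loop begins with \<open>Dec\<close> on the value register and the exit
  tests it for zero, so no run can leave too early or skip the first zero.\<close>

lemma compilable_mu:
  assumes f: "compilable (Suc n) f" and reg: "\<forall>xs. length xs = n \<longrightarrow> (\<exists>y. f (y # xs) = 0)"
  shows "compilable n (\<lambda>xs. LEAST y. f (y # xs) = 0)"
  unfolding compilable_def
proof (intro allI impI)
  fix m out :: nat and ins :: "nat list"
  assume ins: "length ins = n" "set ins \<subseteq> {..<m}" and out: "out < m" "out \<notin> set ins"
  let ?M = "m + 2" and ?y = m and ?v = "m + 1"
  obtain c where c: "implements ?M c (\<lambda>s. s(?v := f (map s (?y # ins))))"
    using f by (rule compilableD[of _ _ "?y # ins" ?M ?v]) (use ins in auto)
  let ?B = "Seq (Dec ?v) (Seq (Inc ?y) c)"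
  have fresh: "k \<notin> set ins" if "m \<le> k" for k using that ins(2) by auto
  define inv where "inv s t j \<longleftrightarrow> agree m s t \<and> t ?y = j \<and> t ?v = f (j # map s ins)" for s t :: store and j
  have start: "inv s t 0" if "(s', t) \<in> exec (Seq (clear ?y) c)" "agree m s s'" for s s' t
  proof -
    from that have "(s'(?y := 0), t) \<in> exec c" by (auto simp: exec_clear)
    from implements_agree[OF c agree_refl this]
    have "agree ?M t (s'(?y := 0, ?v := f (0 # map s' ins)))"
      using fresh by (simp add: map_upd_fresh)
    moreover have "map s' ins = map s ins" using agree_map[OF that(2) ins(2)] by simp
    ultimately show ?thesis using that(2) by (simp add: agree_def inv_def)
  qed
  have body_step: "inv s u (Suc j) \<and> f (j # map s ins) \<noteq> 0" if "inv s t j" "(t, u) \<in> exec ?B" for s t u j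
  proof -
    from that have "(t(?v := t ?v - 1, ?y := Suc (t ?y)), u) \<in> exec c" "0 < t ?v"
      by auto
    note u = implements_agree[OF c agree_refl this(1)]
    have "map (t(?v := t ?v - 1, ?y := Suc (t ?y))) ins = map t ins"
      using ins(2) by (auto simp: subset_iff)
    moreover have "map t ins = map s ins" using agree_map[of m s t ins] that(1) ins(2) by (simp add: inv_def)
    ultimately show ?thesis using u that(1) \<open>0 < t ?v\<close>
      by (simp add: agree_def inv_def del: map_eq_conv)
  qed
  let ?c = "Seq (clear ?y) (Seq c (Seq (Star ?B) (Seq (Tst ?v) (copy ?M ?y out))))"
  have copy: "exec (copy ?M ?y out) = {(s, t). t = s(out := s ?y, ?M := 0)}"
    by (rule exec_copy) (use out in auto)
  have "implements m ?c (\<lambda>s. s(out := LEAST y. f (y # map s ins) = 0))"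
  proof (rule implementsI)
    fix s
    define L where "L = (LEAST y. f (y # map s ins) = 0)"
    have L: "f (L # map s ins) = 0" "\<And>j. j < L \<Longrightarrow> f (j # map s ins) \<noteq> 0"
      using LeastI_ex[of "\<lambda>y. f (y # map s ins) = 0"] reg ins(1) not_less_Least
      unfolding L_def by auto
    have "\<exists>t. (s, t) \<in> exec (Seq (clear ?y) c)"
      using implements_total[OF c] by (auto simp: exec_clear relcomp_unfold)
    then obtain t0 where t0: "(s, t0) \<in> exec (Seq (clear ?y) c)" by blast
    have "\<exists>t. (t0, t) \<in> (exec ?B)\<^sup>* \<and> inv s t j" if "j \<le> L" for j
      using that
    proof (induction j)
      case 0
      then show ?case using start[OF t0 agree_refl] by blast
    next
      case (Suc j)
      then obtain t where t: "(t0, t) \<in> (exec ?B)\<^sup>*" "inv s t j" by auto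
      have "0 < t ?v" using L(2)[of j] Suc.prems t(2) by (simp add: inv_def)
      then obtain u where u: "(t, u) \<in> exec ?B"
        using implements_total[OF c, of "t(?v := t ?v - 1, ?y := Suc (t ?y))"]
        by (auto simp: relcomp_unfold)
      with t body_step[OF t(2) u] show ?case by (meson rtrancl_into_rtrancl)
    qed
    then obtain t where t: "(t0, t) \<in> (exec ?B)\<^sup>*" "inv s t L" by blast
    have "(t, t) \<in> exec (Tst ?v)" using t(2) L(1) by (simp add: inv_def)
    moreover have "(t, t(out := t ?y, ?M := 0)) \<in> exec (copy ?M ?y out)" unfolding copy by blast
    ultimately show "\<exists>t. (s, t) \<in> exec ?c"
      using t0 t(1) unfolding exec.simps(4,5) by blast
  next
    fix s s' t assume "agree m s s'" "(s', t) \<in> exec ?c"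
    then obtain t0 t1 t2 where t0: "(s', t0) \<in> exec (Seq (clear ?y) c)" and t1: "(t0, t1) \<in> (exec ?B)\<^sup>*"
      and "(t1, t2) \<in> exec (Tst ?v)" "(t2, t) \<in> exec (copy ?M ?y out)"
      unfolding exec.simps(4,5) by blast
    then have t: "t1 ?v = 0" "t = t1(out := t1 ?y, ?M := 0)" unfolding copy by simp_all
    from t1 have "\<exists>j. inv s t1 j \<and> (\<forall>i<j. f (i # map s ins) \<noteq> 0)"
    proof (induction rule: rtrancl_induct)
      case base
      show ?case using start[OF t0 \<open>agree m s s'\<close>] by (intro exI[of _ 0]) simp
    next
      case (step t u)
      then obtain j where "inv s t j" "\<forall>i<j. f (i # map s ins) \<noteq> 0" by blast
      with body_step[OF this(1) step.hyps(2)] show ?case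
        by (intro exI[of _ "Suc j"]) (auto simp: less_Suc_eq)
    qed
    then obtain j where j: "inv s t1 j" "\<forall>i<j. f (i # map s ins) \<noteq> 0" by blast
    then have "(LEAST y. f (y # map s ins) = 0) = j"
      using t(1) by (intro Least_equality) (auto simp: inv_def not_less[symmetric])
    then show "agree m t (s(out := LEAST y. f (y # map s ins) = 0))"
      using j(1) t(2) by (simp add: agree_def inv_def)
  qed
  then show "\<exists>c. implements m c (\<lambda>s. s(out := LEAST y. f (y # map s ins) = 0))" by blast
qed

lemma recursive_compilable: "recursive n f \<Longrightarrow> compilable n f"
proof (induction rule: recursive.induct)
  case (rec_zero n)
  then show ?case unfolding compilable_def using implements_clear by blast
next
  case rec_succ
  show ?case unfolding compilable_def
  proof (intro allI impI)
    fix m out :: nat and ins :: "nat list"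
    assume ins: "length ins = 1" "set ins \<subseteq> {..<m}" and out: "out < m" "out \<notin> set ins"
    then obtain i where i: "ins = [i]" by (auto simp: length_Suc_conv)
    have "implements m (Seq (copy m i out) (Inc out)) (\<lambda>s. s(out := Suc (hd (map s ins))))"
      using implements_Seq[OF implements_copy[of i m out] implements_Inc[of out m]] i ins out by simp
    then show "\<exists>c. implements m c (\<lambda>s. s(out := Suc (hd (map s ins))))" by blast
  qed
next
  case (rec_proj i n)
  show ?case unfolding compilable_def
  proof (intro allI impI)
    fix m out :: nat and ins :: "nat list"
    assume ins: "length ins = n" "set ins \<subseteq> {..<m}" and out: "out < m" "out \<notin> set ins"
    have "ins ! i \<in> set ins" using rec_proj ins by simp
    then have "ins ! i < m" "ins ! i \<noteq> out" using ins(2) out(2) by auto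
    then have "implements m (copy m (ins ! i) out) (\<lambda>s. s(out := map s ins ! i))"
      using implements_copy[of "ins ! i" m out] rec_proj ins out by simp
    then show "\<exists>c. implements m c (\<lambda>s. s(out := map s ins ! i))" by blast
  qed
next
  case (rec_comp gs f n)
  show ?case unfolding compilable_def
  proof (intro allI impI)
    fix m out :: nat and ins :: "nat list"
    assume ins: "length ins = n" "set ins \<subseteq> {..<m}" and out: "out < m" "out \<notin> set ins"
    let ?M = "m + length gs"
    have "\<exists>c. implements ?M c (\<lambda>s r. if m \<le> r \<and> r < m + length gs then (gs ! (r - m)) (map s ins) else s r)"
      using rec_comp ins by (intro compilable_list) auto
    then obtain c where c: "implements ?M c
      (\<lambda>s r. if m \<le> r \<and> r < m + length gs then (gs ! (r - m)) (map s ins) else s r)" (is "implements _ _ ?G")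
      by blast
    obtain d where d: "implements ?M d (\<lambda>s. s(out := f (map s [m..<?M])))"
      using rec_comp.IH(1) by (rule compilableD[of _ _ "[m..<?M]" ?M out]) (use out in auto)
    have "map (?G s) [m..<?M] = map (\<lambda>g. g (map s ins)) gs" for s
      by (rule nth_equalityI) auto
    then have "implements ?M (Seq c d) (\<lambda>s. (?G s)(out := f (map (\<lambda>g. g (map s ins)) gs)))"
      using implements_Seq[OF c d] by simp
    then have "implements m (Seq c d) (\<lambda>s. s(out := f (map (\<lambda>g. g (map s ins)) gs)))"
      by (rule implements_mono)
        (use agree_assign[OF _ ins(2), of _ _ out "\<lambda>xs. f (map (\<lambda>g. g xs) gs)"] in \<open>auto simp: agree_def\<close>)
    then show "\<exists>c. implements m c (\<lambda>s. s(out := f (map (\<lambda>g. g (map s ins)) gs)))" by blast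
  qed
next
  case (rec_prim n f g)
  then show ?case by (intro compilable_prim)
next
  case (rec_mu n f)
  then show ?case by (intro compilable_mu)
next
  case (rec_ext n f g)
  then show ?case unfolding compilable_def by (metis (no_types, lifting) length_map implements_def)
qed

text \<open>A control point is the list of the commands that remain to be executed.\<close>

datatype op = Nop | IncOp nat | DecOp nat | TstOp nat

primrec op_rel :: "op \<Rightarrow> (store \<times> store) set" where
  "op_rel Nop = Id"
| "op_rel (IncOp i) = {(s, t). t = s(i := Suc (s i))}"
| "op_rel (DecOp i) = {(s, t). 0 < s i \<and> t = s(i := s i - 1)}"
| "op_rel (TstOp i) = {(s, t). s i = 0 \<and> t = s}"

type_synonym 'q edge = "'q \<times> op \<times> 'q"

definition step :: "'q edge set \<Rightarrow> (('q \<times> store) \<times> ('q \<times> store)) set" where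
  "step E = {((p, s), (q, t)). \<exists>a. (p, a, q) \<in> E \<and> (s, t) \<in> op_rel a}"

primrec edges :: "cmd \<Rightarrow> cmd list \<Rightarrow> cmd list edge set" where
  "edges (Inc i) k = {(Inc i # k, IncOp i, k)}"
| "edges (Dec i) k = {(Dec i # k, DecOp i, k)}"
| "edges (Tst i) k = {(Tst i # k, TstOp i, k)}"
| "edges (Seq c d) k = insert (Seq c d # k, Nop, c # d # k) (edges c (d # k) \<union> edges d k)"
| "edges (Star c) k = {(Star c # k, Nop, k), (Star c # k, Nop, c # Star c # k)} \<union> edges c (Star c # k)"

lemma finite_edges: "finite (edges c k)"
  by (induction c arbitrary: k) auto

lemma step_mono: "E \<subseteq> F \<Longrightarrow> step E \<subseteq> step F"
  unfolding step_def by auto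

lemma exec_imp_steps: "(s, t) \<in> exec c \<Longrightarrow> ((c # k, s), (k, t)) \<in> (step (edges c k))\<^sup>*"
proof (induction c arbitrary: k s t)
  case (Seq c d)
  then obtain u where u: "(s, u) \<in> exec c" "(u, t) \<in> exec d" by auto
  let ?E = "edges (Seq c d) k"
  have "((Seq c d # k, s), (c # d # k, s)) \<in> step ?E" by (auto simp: step_def intro: exI[of _ Nop])
  also have "((c # d # k, s), (d # k, u)) \<in> (step ?E)\<^sup>*"
    using Seq.IH(1)[OF u(1)] by (rule rtrancl_mono[THEN subsetD, rotated]) (intro step_mono, auto)
  also have "((d # k, u), (k, t)) \<in> (step ?E)\<^sup>*"
    using Seq.IH(2)[OF u(2)] by (rule rtrancl_mono[THEN subsetD, rotated]) (intro step_mono, auto)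
  finally show ?case .
next
  case (Star c)
  let ?E = "edges (Star c) k"
  from Star.prems have "(s, t) \<in> (exec c)\<^sup>*" by simp
  then have "((Star c # k, s), (Star c # k, t)) \<in> (step ?E)\<^sup>*"
  proof (induction rule: rtrancl_induct)
    case (step t u)
    note step.IH
    also have "((Star c # k, t), (c # Star c # k, t)) \<in> step ?E"
      by (auto simp: step_def intro: exI[of _ Nop])
    also have "((c # Star c # k, t), (Star c # k, u)) \<in> (step ?E)\<^sup>*"
      using Star.IH[OF step.hyps(2)] by (rule rtrancl_mono[THEN subsetD, rotated]) (intro step_mono, auto)
    finally show ?case .
  qed simp
  also have "((Star c # k, t), (k, t)) \<in> step ?E" by (auto simp: step_def intro: exI[of _ Nop])
  finally show ?case .
qed (auto simp: step_def)

primrec exec_list :: "cmd list \<Rightarrow> (store \<times> store) set" where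
  "exec_list [] = Id"
| "exec_list (c # k) = exec c O exec_list k"

text \<open>A control point means the composition of its remaining commands, and every edge respects
  this meaning; induction along a run then gives \<open>steps_imp_exec\<close>.\<close>

lemma edges_sound: "(p, a, q) \<in> edges c k \<Longrightarrow> op_rel a O exec_list q \<subseteq> exec_list p"
proof (induction c arbitrary: k)
  case (Seq c d)
  then show ?case by (auto simp: O_assoc)
next
  case (Star c)
  from Star.prems consider "p = Star c # k" "a = Nop" "q = k" | "p = Star c # k" "a = Nop" "q = c # Star c # k"
    | "(p, a, q) \<in> edges c (Star c # k)" by auto
  then show ?case
  proof cases
    case 2
    have "exec c O (exec c)\<^sup>* \<subseteq> (exec c)\<^sup>*" by (auto intro: converse_rtrancl_into_rtrancl)
    then show ?thesis using 2 by (auto simp flip: O_assoc)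
  qed (use Star.IH in auto)
qed auto

lemma steps_imp_exec:
  "((p, s), ([], t)) \<in> (step (edges c k))\<^sup>* \<Longrightarrow> (s, t) \<in> exec_list p"
proof (induction "(p, s)" arbitrary: p s rule: converse_rtrancl_induct)
  case (step y)
  obtain q u where y: "y = (q, u)" by (cases y)
  from step y obtain a where "(p, a, q) \<in> edges c k" "(s, u) \<in> op_rel a" "(u, t) \<in> exec_list q"
    by (auto simp: step_def)
  with edges_sound show ?case by blast
qed simp

lemma exec_iff_steps: "(s, t) \<in> exec c \<longleftrightarrow> (([c], s), ([], t)) \<in> (step (edges c []))\<^sup>*"
  using exec_imp_steps[of s t c "[]"] steps_imp_exec[of "[c]" s t c "[]"] by auto

lemma Sigma0_1_counter_program:
  assumes "A \<in> Sigma0 1"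
  obtains c where "\<And>x. x \<in> A \<longleftrightarrow> (\<exists>t. ((\<lambda>_. 0)(0 := x), t) \<in> exec c)"
proof -
  from assms obtain S where S: "decidable_rel 2 S" "\<And>x. x \<in> A \<longleftrightarrow> (\<exists>y. S [y, x])"
    unfolding Sigma0_def One_nat_def
    by (auto simp: numeral_2_eq_2) (metis length_Cons list.sel(1) list.size(3))
  let ?f = "\<lambda>xs. if S xs then 1 else 0 :: nat"
  from S(1) have "compilable 2 ?f" unfolding decidable_rel_def by (rule recursive_compilable)
  then obtain c where c: "implements 3 c (\<lambda>s. s(2 := ?f (map s [1, 0])))"
    by (rule compilableD[of _ _ "[1, 0]" 3 2]) auto
  let ?s = "\<lambda>x. (\<lambda>_. 0)(0 := x) :: store"
  \<comment> \<open>Guess \<open>y\<close> in register 1, compute the characteristic function into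
    register 2, and accept by a decrement, which succeeds only for the value 1.\<close>
  let ?c = "Seq (Star (Inc 1)) (Seq c (Dec 2))"
  have "(\<exists>t. (?s x, t) \<in> exec ?c) \<longleftrightarrow> x \<in> A" for x
  proof
    assume "\<exists>t. (?s x, t) \<in> exec ?c"
    then obtain u v where u: "(?s x, u) \<in> (exec (Inc 1))\<^sup>*" "(u, v) \<in> exec c" "0 < v 2" by auto
    from u(1) have "u 0 = x" by (induction rule: rtrancl_induct) auto
    moreover have "v 2 = ?f (map u [1, 0])"
      using implements_agree[OF c agree_refl u(2)] by (simp add: agree_def)
    ultimately have "S [u 1, x]" using u(3) by (auto split: if_splits)
    then show "x \<in> A" using S(2) by blast
  next
    assume "x \<in> A"
    then obtain y where y: "S [y, x]" using S(2) by blast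
    let ?u = "(?s x)(1 := y)"
    have "(?s x, (?s x)(1 := j)) \<in> (exec (Inc 1))\<^sup>*" for j
    proof (induction j)
      case 0
      have "(?s x)(1 := 0) = ?s x" by auto
      then show ?case by (simp only: rtrancl.rtrancl_refl)
    next
      case (Suc j)
      have "((?s x)(1 := j), (?s x)(1 := Suc j)) \<in> exec (Inc 1)" by (simp add: fun_upd_twist)
      with Suc show ?case by (rule rtrancl_into_rtrancl)
    qed
    moreover obtain v where v: "(?u, v) \<in> exec c" using implements_total[OF c] by blast
    moreover have "v 2 = 1"
      using implements_agree[OF c agree_refl v] y by (simp add: agree_def)
    then have "(v, v(2 := v 2 - 1)) \<in> exec (Dec 2)" by simp
    ultimately have "(?s x, v(2 := v 2 - 1)) \<in> exec ?c"
      unfolding exec.simps(4,5) by (intro relcompI)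
    then show "\<exists>t. (?s x, t) \<in> exec ?c" by (intro exI)
  qed
  then show ?thesis by (intro that[of ?c]) simp
qed

section \<open>Arithmetization of runs\<close>

definition masked :: "nat \<Rightarrow> nat \<Rightarrow> bool" where
  "masked a b \<longleftrightarrow> (\<forall>i. bit a i \<longrightarrow> bit b i)"

lemma masked_div2: "masked a b \<longleftrightarrow> (odd a \<longrightarrow> odd b) \<and> masked (a div 2) (b div 2)"
proof -
  have "(\<forall>i. bit a i \<longrightarrow> bit b i) \<longleftrightarrow> (bit a 0 \<longrightarrow> bit b 0) \<and> (\<forall>i. bit a (Suc i) \<longrightarrow> bit b (Suc i))"
    (is "?l \<longleftrightarrow> ?r")
  proof
    assume r: ?r
    have "bit a i \<longrightarrow> bit b i" for i using r by (cases i) auto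
    then show ?l by blast
  qed auto
  then show ?thesis by (simp add: masked_def bit_0 bit_Suc)
qed

text \<open>Modulo 2, \<open>(1 + X)^(2 * n)\<close> equals \<open>(1 + X^2)^n\<close>; the
  comparison of coefficients is carried out with Pascal's rule.\<close>

lemma choose_double:
  "(odd (2 * n choose (2 * k)) \<longleftrightarrow> odd (n choose k)) \<and> even (2 * n choose Suc (2 * k))"
proof (induction n arbitrary: k)
  case 0
  show ?case by (cases k) auto
next
  case (Suc n)
  have 1: "odd (Suc (2 * n) choose Suc (2 * k)) \<longleftrightarrow> odd (n choose k)" for k
    using Suc[of k] by simp
  have 2: "odd (Suc (2 * n) choose (2 * k)) \<longleftrightarrow> odd (n choose k)" for k
  proof (cases k)
    case (Suc j)
    then have "Suc (2 * n) choose (2 * k) = (2 * n choose Suc (2 * j)) + (2 * n choose (2 * k))" by simp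
    then show ?thesis using Suc.IH[of j] Suc.IH[of k] by simp
  qed simp
  show ?case
  proof
    show "odd (2 * Suc n choose (2 * k)) \<longleftrightarrow> odd (Suc n choose k)"
    proof (cases k)
      case (Suc j)
      then have "2 * Suc n choose (2 * k) = (Suc (2 * n) choose Suc (2 * j)) + (Suc (2 * n) choose (2 * k))"
        by simp
      moreover have "Suc n choose k = (n choose j) + (n choose k)" using Suc by simp
      ultimately show ?thesis using 1[of j] 2[of k] by (metis even_add)
    qed simp
    have "2 * Suc n choose Suc (2 * k) = (Suc (2 * n) choose (2 * k)) + (Suc (2 * n) choose Suc (2 * k))"
      by simp
    then show "even (2 * Suc n choose Suc (2 * k))" using 1[of k] 2[of k] by (metis even_add)
  qed
qed

lemma odd_choose_div2:
  "odd (b choose a) \<longleftrightarrow> (odd a \<longrightarrow> odd b) \<and> odd ((b div 2) choose (a div 2))"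
proof -
  let ?n = "b div 2" and ?k = "a div 2"
  have eq: "b = (if odd b then Suc (2 * ?n) else 2 * ?n)" "a = (if odd a then Suc (2 * ?k) else 2 * ?k)"
    by auto
  have 1: "odd (Suc (2 * ?n) choose Suc (2 * k)) \<longleftrightarrow> odd (?n choose k)" for k
    using choose_double[of ?n k] by simp
  have 2: "odd (Suc (2 * ?n) choose (2 * k)) \<longleftrightarrow> odd (?n choose k)" for k
  proof (cases k)
    case (Suc j)
    then have "Suc (2 * ?n) choose (2 * k) = (2 * ?n choose Suc (2 * j)) + (2 * ?n choose (2 * k))" by simp
    then show ?thesis using choose_double[of ?n j] choose_double[of ?n k] by simp
  qed simp
  show ?thesis
    using 1[of ?k] 2[of ?k] choose_double[of ?n ?k] eq by (metis (full_types))
qed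

text \<open>Lucas's theorem for the prime 2, applied one binary digit at a time.\<close>

lemma odd_choose_iff_masked: "odd (b choose a) \<longleftrightarrow> masked a b"
proof (induction b arbitrary: a rule: less_induct)
  case (less b)
  show ?case
  proof (cases "b = 0")
    case True
    have "masked a 0 \<longleftrightarrow> a = 0" by (auto simp: masked_def bit_eq_iff)
    then show ?thesis using True by (cases a) auto
  next
    case False
    then show ?thesis using less[of "b div 2"] odd_choose_div2[of b a] masked_div2[of a b] by simp
  qed
qed

lemma masked_le: "masked a b \<Longrightarrow> a \<le> b"
  using odd_choose_iff_masked[of b a] by (metis even_zero binomial_eq_0 not_le)

lemma masked_0 [simp]: "masked a 0 \<longleftrightarrow> a = 0"
  using masked_le[of a 0] by (auto simp: masked_def)

lemma masked_0_left [simp]: "masked 0 b" by (simp add: masked_def)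

lemma masked_1: "masked a 1 \<longleftrightarrow> a \<le> 1"
  using masked_le[of a 1] masked_0_left[of 1] by (auto simp: le_Suc_eq) (simp add: masked_def)

lemma bit_low: "a < 2 ^ k \<Longrightarrow> bit a i \<Longrightarrow> i < k" for a :: nat
  by (metis bit_take_bit_iff take_bit_nat_eq_self)

text \<open>A mask of ones expresses a bound; digit by digit, this keeps register contents below
  \<open>H\<close>.\<close>

lemma masked_ones: "masked a (2 ^ k - 1) \<longleftrightarrow> a < 2 ^ k"
proof
  assume "masked a (2 ^ k - 1)"
  from masked_le[OF this] show "a < 2 ^ k" by (simp add: Suc_leI order_le_less_trans)
next
  assume "a < 2 ^ k"
  then show "masked a (2 ^ k - 1)"
    unfolding masked_def mask_eq_exp_minus_1[symmetric] by (auto simp: bit_mask_iff dest: bit_low)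
qed

lemma bit_shift_add:
  fixes a x :: nat
  assumes "a < 2 ^ k"
  shows "bit (a + 2 ^ k * x) i \<longleftrightarrow> (if i < k then bit a i else bit x (i - k))"
proof (cases "i < k")
  case True
  then have "2 ^ k * x = 2 ^ i * (2 * (2 ^ (k - Suc i) * x))"
    by (simp flip: power_add power_Suc mult.assoc)
  then have "(a + 2 ^ k * x) div 2 ^ i = a div 2 ^ i + 2 * (2 ^ (k - Suc i) * x)"
    by (simp only: div_mult_self2 power_not_zero zero_neq_numeral not_False_eq_True add.commute)
  with True show ?thesis by (simp add: bit_iff_odd)
next
  case False
  then have "(a + 2 ^ k * x) div 2 ^ i = ((a + 2 ^ k * x) div 2 ^ k) div 2 ^ (i - k)"
  proof -
    have "(2::nat) ^ i = 2 ^ k * 2 ^ (i - k)" using False by (simp flip: power_add)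
    then show ?thesis by (simp only: div_mult2_eq)
  qed
  also have "(a + 2 ^ k * x) div 2 ^ k = x" using assms by simp
  finally show ?thesis using False by (simp add: bit_iff_odd)
qed

lemma masked_shift_add:
  assumes "a < 2 ^ k" "b < 2 ^ k"
  shows "masked (a + 2 ^ k * x) (b + 2 ^ k * y) \<longleftrightarrow> masked a b \<and> masked x y"
proof
  assume *: "masked (a + 2 ^ k * x) (b + 2 ^ k * y)"
  have "bit b i" if "bit a i" for i
    using *[unfolded masked_def, rule_format, of i] that bit_low[OF assms(1) that]
    by (simp add: bit_shift_add assms)
  moreover have "bit y i" if "bit x i" for i
    using *[unfolded masked_def, rule_format, of "i + k"] that by (simp add: bit_shift_add assms)
  ultimately show "masked a b \<and> masked x y" by (simp add: masked_def)
qed (auto simp: masked_def bit_shift_add assms)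

section \<open>Numbers as sequences of digits\<close>

definition vec :: "nat \<Rightarrow> (nat \<Rightarrow> nat) \<Rightarrow> nat \<Rightarrow> nat" where
  "vec Q d T = (\<Sum>t<T. d t * Q ^ t)"

lemma vec_0 [simp]: "vec Q d 0 = 0" by (simp add: vec_def)

lemma vec_Suc: "vec Q d (Suc T) = d 0 + Q * vec Q (\<lambda>t. d (Suc t)) T"
  unfolding vec_def by (subst sum.lessThan_Suc_shift) (simp add: sum_distrib_left mult_ac)

lemma vec_cong: "(\<And>t. t < T \<Longrightarrow> d t = d' t) \<Longrightarrow> vec Q d T = vec Q d' T"
  by (simp add: vec_def)

lemma vec_add: "vec Q d T + vec Q d' T = vec Q (\<lambda>t. d t + d' t) T"
  by (simp add: vec_def sum.distrib distrib_right)

lemma vec_scale: "c * vec Q d T = vec Q (\<lambda>t. c * d t) T"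
  by (simp add: vec_def sum_distrib_left mult.assoc)

lemma vec_sum: "(\<Sum>j\<in>S. vec Q (d j) T) = vec Q (\<lambda>t. \<Sum>j\<in>S. d j t) T"
  unfolding vec_def by (subst sum.swap) (simp add: sum_distrib_right)

lemma vec_shift: "c + Q * vec Q d T = vec Q (case_nat c d) (Suc T)"
  by (simp add: vec_Suc)

lemma vec_top: "vec Q d T + c * Q ^ T = vec Q (\<lambda>t. if t < T then d t else c) (Suc T)"
  by (simp add: vec_def)

text \<open>The top digit may exceed the base, as there is nothing above it for a carry. Final
  register contents stand there without a bound.\<close>

lemma vec_unique:
  assumes "vec Q a (Suc T) = vec Q b (Suc T)" "\<And>t. t < T \<Longrightarrow> a t < Q \<and> b t < Q" "t \<le> T"
  shows "a t = b t"
  using assms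
proof (induction T arbitrary: a b t)
  case 0
  then show ?case by (simp add: vec_Suc)
next
  case (Suc T)
  have "(a 0 + Q * vec Q (\<lambda>t. a (Suc t)) (Suc T)) mod Q = (b 0 + Q * vec Q (\<lambda>t. b (Suc t)) (Suc T)) mod Q"
    using Suc.prems(1) by (simp only: vec_Suc[of Q _ "Suc T"])
  then have 0: "a 0 = b 0" using Suc.prems(2)[of 0] by simp
  moreover have "Q > 0" using Suc.prems(2)[of 0] by auto
  ultimately have "vec Q (\<lambda>t. a (Suc t)) (Suc T) = vec Q (\<lambda>t. b (Suc t)) (Suc T)"
    using Suc.prems(1) by (simp only: vec_Suc[of Q _ "Suc T"]) simp
  with Suc.IH[of "\<lambda>t. a (Suc t)" "\<lambda>t. b (Suc t)" "t - 1"] Suc.prems(2,3) 0 show ?case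
    by (cases t) auto
qed

lemma vec_unique':
  assumes "vec Q a T = vec Q b T" "\<And>t. t < T \<Longrightarrow> a t < Q \<and> b t < Q" "t < T"
  shows "a t = b t"
proof -
  from assms(3) obtain T' where "T = Suc T'" by (cases T) auto
  with vec_unique[of Q a T' b t] assms show ?thesis by auto
qed

text \<open>This finds digits in an arbitrary number: below a mask whose digits are less than the
  base, it inherits the block structure of the mask.\<close>

lemma masked_vec:
  assumes "\<And>t. t < T \<Longrightarrow> d' t < 2 ^ k"
  shows "masked X (vec (2 ^ k) d' T) \<longleftrightarrow> (\<exists>d. X = vec (2 ^ k) d T \<and> (\<forall>t<T. masked (d t) (d' t)))"
  using assms
proof (induction T arbitrary: X d')
  case 0
  then show ?case by simp
next
  case (Suc T)
  let ?Q = "2 ^ k :: nat"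
  have IH: "masked Y (vec ?Q (\<lambda>t. d' (Suc t)) T) \<longleftrightarrow>
      (\<exists>d. Y = vec ?Q d T \<and> (\<forall>t<T. masked (d t) (d' (Suc t))))" for Y
    using Suc.prems by (intro Suc.IH) auto
  show ?case
  proof
    assume "masked X (vec ?Q d' (Suc T))"
    then have "masked (X mod ?Q + ?Q * (X div ?Q)) (d' 0 + ?Q * vec ?Q (\<lambda>t. d' (Suc t)) T)"
      by (simp add: vec_Suc)
    then have m: "masked (X mod ?Q) (d' 0)" "masked (X div ?Q) (vec ?Q (\<lambda>t. d' (Suc t)) T)"
      using Suc.prems[of 0] by (auto simp only: masked_shift_add mod_less_divisor zero_less_power zero_less_numeral zero_less_Suc)
    from m(2) obtain d where d: "X div ?Q = vec ?Q d T" "\<forall>t<T. masked (d t) (d' (Suc t))"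
      using IH by blast
    have "X = X mod ?Q + ?Q * (X div ?Q)" by simp
    then have "X = vec ?Q (case_nat (X mod ?Q) d) (Suc T)" unfolding d(1) vec_shift .
    moreover have "\<forall>t<Suc T. masked (case_nat (X mod ?Q) d t) (d' t)"
      using m(1) d(2) by (auto simp: less_Suc_eq_0_disj)
    ultimately show "\<exists>d. X = vec ?Q d (Suc T) \<and> (\<forall>t<Suc T. masked (d t) (d' t))" by blast
  next
    assume "\<exists>d. X = vec ?Q d (Suc T) \<and> (\<forall>t<Suc T. masked (d t) (d' t))"
    then obtain d where d: "X = vec ?Q d (Suc T)" "\<forall>t<Suc T. masked (d t) (d' t)" by blast
    have "d 0 < ?Q" using d(2) Suc.prems[of 0] masked_le[of "d 0" "d' 0"] by auto
    moreover have "masked (vec ?Q (\<lambda>t. d (Suc t)) T) (vec ?Q (\<lambda>t. d' (Suc t)) T)"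
      unfolding IH using d(2) by auto
    ultimately show "masked X (vec ?Q d' (Suc T))"
      unfolding d(1) vec_Suc using d(2) Suc.prems[of 0] by (subst masked_shift_add) auto
  qed
qed

text \<open>The geometric sum, free of division and subtraction; it defines the number whose digits
  are all 1.\<close>

lemma vec_ones_iff:
  assumes "Q > 1"
  shows "Q * J + 1 = Q ^ T + J \<longleftrightarrow> J = vec Q (\<lambda>_. 1) T"
proof -
  have ones: "Q * vec Q (\<lambda>_. 1) T + 1 = Q ^ T + vec Q (\<lambda>_. 1) T"
    by (induction T) (auto simp: vec_def algebra_simps)
  show ?thesis
  proof
    assume *: "Q * J + 1 = Q ^ T + J"
    have "(int Q - 1) * int J = int (Q * J) - int J" by (simp add: algebra_simps)
    also have "\<dots> = int Q ^ T - 1" using arg_cong[OF *, of int] by simp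
    also have "\<dots> = int (Q * vec Q (\<lambda>_. 1) T) - int (vec Q (\<lambda>_. 1) T)"
      using arg_cong[OF ones, of int] by simp
    also have "\<dots> = (int Q - 1) * int (vec Q (\<lambda>_. 1) T)" by (simp add: algebra_simps)
    finally show "J = vec Q (\<lambda>_. 1) T" using assms by simp
  qed (use ones in simp)
qed

section \<open>Runs and their equations\<close>

abbreviation "edge_src e \<equiv> fst e"
abbreviation "edge_op e \<equiv> fst (snd e)"
abbreviation "edge_tgt e \<equiv> snd (snd e)"

text \<open>The last condition compares the start of edge \<open>t\<close> with the end of edge
  \<open>t - 1\<close>; at \<open>t = 0\<close> and \<open>t = T\<close> the missing sides are
  \<open>p\<close> and \<open>q\<close>, which also covers the empty run.\<close>

definition trace :: "'q edge list \<Rightarrow> 'q \<Rightarrow> 'q \<Rightarrow> store \<Rightarrow> nat \<Rightarrow> (nat \<Rightarrow> nat) \<Rightarrow> (nat \<Rightarrow> store) \<Rightarrow> bool" where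
  "trace es p q s0 T e s \<longleftrightarrow> s 0 = s0 \<and>
    (\<forall>t<T. e t < length es \<and> (s t, s (Suc t)) \<in> op_rel (edge_op (es ! e t))) \<and>
    (\<forall>t\<le>T. (if t < T then edge_src (es ! e t) else q) = (case t of 0 \<Rightarrow> p | Suc t' \<Rightarrow> edge_tgt (es ! e t')))"

lemma steps_iff_trace:
  "(\<exists>t. ((p, s0), (q, t)) \<in> (step (set es))\<^sup>*) \<longleftrightarrow> (\<exists>T e s. trace es p q s0 T e s)"
proof
  assume "\<exists>t. ((p, s0), (q, t)) \<in> (step (set es))\<^sup>*"
  then obtain T f t where f: "f 0 = (p, s0)" "f T = (q, t)" "\<forall>i<T. (f i, f (Suc i)) \<in> step (set es)"
    unfolding rtrancl_power relpow_fun_conv by blast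
  have "\<exists>j. i < T \<longrightarrow> j < length es \<and> es ! j = (fst (f i), edge_op (es ! j), fst (f (Suc i))) \<and>
      (snd (f i), snd (f (Suc i))) \<in> op_rel (edge_op (es ! j))" for i
  proof (cases "i < T")
    case True
    with f(3) have "(f i, f (Suc i)) \<in> step (set es)" by blast
    then obtain a where "(fst (f i), a, fst (f (Suc i))) \<in> set es" "(snd (f i), snd (f (Suc i))) \<in> op_rel a"
      by (auto simp: step_def split_beta)
    then show ?thesis by (metis fst_conv in_set_conv_nth snd_conv)
  qed simp
  then obtain e where e: "\<And>i. i < T \<Longrightarrow> e i < length es \<and> es ! e i = (fst (f i), edge_op (es ! e i), fst (f (Suc i))) \<and>
      (snd (f i), snd (f (Suc i))) \<in> op_rel (edge_op (es ! e i))"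
    by metis
  have src: "edge_src (es ! e i) = fst (f i)" and tgt: "edge_tgt (es ! e i) = fst (f (Suc i))" if "i < T" for i
    using e[OF that] by (metis fst_conv snd_conv)+
  have "trace es p q s0 T e (\<lambda>i. snd (f i))"
    unfolding trace_def
  proof (intro conjI allI impI)
    show "(if t < T then edge_src (es ! e t) else q) = (case t of 0 \<Rightarrow> p | Suc t' \<Rightarrow> edge_tgt (es ! e t'))"
      if "t \<le> T" for t
      using that src[of t] tgt[of "t - 1"] f(1,2) by (cases t) auto
  qed (use f(1) e in auto)
  then show "\<exists>T e s. trace es p q s0 T e s" by blast
next
  assume "\<exists>T e s. trace es p q s0 T e s"
  then obtain T e s where tr: "s 0 = s0"
    "\<And>t. t < T \<Longrightarrow> e t < length es \<and> (s t, s (Suc t)) \<in> op_rel (edge_op (es ! e t))"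
    "\<And>t. t \<le> T \<Longrightarrow> (if t < T then edge_src (es ! e t) else q) = (case t of 0 \<Rightarrow> p | Suc t' \<Rightarrow> edge_tgt (es ! e t'))"
    unfolding trace_def by blast
  define f where "f t = (if t < T then edge_src (es ! e t) else q, s t)" for t
  have "(f i, f (Suc i)) \<in> step (set es)" if "i < T" for i
  proof -
    have "f (Suc i) = (edge_tgt (es ! e i), s (Suc i))" using tr(3)[of "Suc i"] that by (simp add: f_def)
    moreover have "(edge_src (es ! e i), edge_op (es ! e i), edge_tgt (es ! e i)) \<in> set es"
      using tr(2)[OF that] by simp
    ultimately show ?thesis using tr(2)[OF that] that by (auto simp: step_def f_def intro!: exI)
  qed
  moreover have "f 0 = (p, s0)" using tr(1) tr(3)[of 0] by (simp add: f_def)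
  moreover have "f T = (q, s T)" by (simp add: f_def)
  ultimately have "((p, s0), (q, s T)) \<in> (step (set es))\<^sup>*"
    unfolding rtrancl_power relpow_fun_conv by metis
  then show "\<exists>t. ((p, s0), (q, t)) \<in> (step (set es))\<^sup>*" by blast
qed

definition incs :: "'q edge list \<Rightarrow> nat \<Rightarrow> nat \<Rightarrow> nat" where
  "incs es r j = (if edge_op (es ! j) = IncOp r then 1 else 0)"

definition decs :: "'q edge list \<Rightarrow> nat \<Rightarrow> nat \<Rightarrow> nat" where
  "decs es r j = (if edge_op (es ! j) = DecOp r then 1 else 0)"

text \<open>
  The run of length \<open>T\<close> is encoded by numbers in base \<open>2 * H\<close> whose \<open>t\<close>-th digit describes the
  situation at time \<open>t\<close>: \<open>E j\<close> tells whether edge \<open>j\<close> is taken and \<open>R r\<close> is the content of register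
  \<open>r\<close>. The equations shift by one digit, that is, by one unit of time.
\<close>

definition arith :: "'q edge list \<Rightarrow> ('q \<Rightarrow> nat) \<Rightarrow> nat \<Rightarrow> nat \<Rightarrow> 'q \<Rightarrow> 'q \<Rightarrow> nat \<Rightarrow> nat \<Rightarrow> nat \<Rightarrow> nat \<Rightarrow> nat \<Rightarrow>
    nat \<Rightarrow> nat \<Rightarrow> (nat \<Rightarrow> nat) \<Rightarrow> (nat \<Rightarrow> nat) \<Rightarrow> (nat \<Rightarrow> nat) \<Rightarrow> (nat \<Rightarrow> nat) \<Rightarrow> bool" where
  "arith es \<sigma> C m p q x \<kappa> T H G P J E R Z F \<longleftrightarrow>
    H = 2 ^ \<kappa> \<and> G + 1 = H \<and> C < H \<and> x < H \<and> P = (2 * H) ^ T \<and> 2 * H * J + 1 = P + J \<and>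
    (\<forall>j<length es. masked (E j) J) \<and> (\<Sum>j<length es. E j) = J \<and>
    (\<forall>r<m. masked (R r) (G * J)) \<and>
    (\<forall>r<m. 2 * H * (R r + (\<Sum>j<length es. incs es r j * E j)) + (if r = 0 then x else 0)
      = R r + 2 * H * (\<Sum>j<length es. decs es r j * E j) + F r * P) \<and>
    (\<forall>j<length es. Z j + E j = J) \<and>
    (\<forall>j<length es. \<forall>r<m. edge_op (es ! j) = TstOp r \<longrightarrow> masked (R r) (G * Z j)) \<and>
    2 * H * (\<Sum>j<length es. \<sigma> (edge_tgt (es ! j)) * E j) + \<sigma> p
      = (\<Sum>j<length es. \<sigma> (edge_src (es ! j)) * E j) + \<sigma> q * P"

lemma op_rel_balance:
  assumes "(s, t) \<in> op_rel (edge_op (es ! j))"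
  shows "s r + incs es r j = t r + decs es r j"
  using assms by (cases "edge_op (es ! j)") (auto simp: incs_def decs_def)

text \<open>Exactly one indicator is 1 at each time, so the sum picks the coefficient of the edge
  taken.\<close>

lemma vec_select:
  fixes e :: "nat \<Rightarrow> nat"
  assumes "\<And>t. t < T \<Longrightarrow> e t < N"
  shows "(\<Sum>j<N. c j * vec Q (\<lambda>t. if e t = j then 1 else 0) T) = vec Q (\<lambda>t. c (e t)) T"
proof -
  have "(\<Sum>j<N. c j * (if e t = j then 1 else 0)) = c (e t)" if "t < T" for t
  proof -
    have "(\<Sum>j<N. c j * (if e t = j then 1 else 0)) = (\<Sum>j<N. if j = e t then c j else 0)"
      by (intro sum.cong) auto
    also have "\<dots> = c (e t)" by (subst sum.delta) (use assms[OF that] in auto)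
    finally show ?thesis .
  qed
  then show ?thesis unfolding vec_scale vec_sum by (intro vec_cong)
qed

lemma trace_imp_arith:
  assumes tr: "trace es p q ((\<lambda>_. 0)(0 := x)) T e s"
  shows "\<exists>\<kappa> H G P J E R Z F. arith es \<sigma> C m p q x \<kappa> T H G P J E R Z F"
proof -
  let ?N = "length es"
  \<comment> \<open>Any exponent that dominates \<open>C\<close>, \<open>x\<close> and all register
    contents will do, since \<open>\<kappa> < 2 ^ \<kappa>\<close>.\<close>
  define \<kappa> where "\<kappa> = C + x + (\<Sum>t\<le>T. \<Sum>r<m. s t r)"
  define H where "H = (2::nat) ^ \<kappa>"
  \<comment> \<open>Twice the bound, so that a register content plus one increment causes no
    carry.\<close>
  let ?Q = "2 * H"
  have "1 \<le> H" by (simp add: H_def)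
  then have "1 < ?Q" "H < ?Q" by linarith+
  moreover have "?Q = 2 ^ Suc \<kappa>" by (simp add: H_def)
  ultimately have Q: "?Q = 2 ^ Suc \<kappa>" "1 < ?Q" "H < ?Q" by -
  have "\<kappa> < H" by (simp add: H_def less_exp)
  then have bound: "C < H" "x < H" by (auto simp: \<kappa>_def)
  have sbound: "s t r < H" if "t \<le> T" "r < m" for t r
  proof -
    have "s t r \<le> (\<Sum>r<m. s t r)" using that(2) by (intro member_le_sum) auto
    also have "\<dots> \<le> (\<Sum>t\<le>T. \<Sum>r<m. s t r)" using that(1) by (intro member_le_sum) auto
    finally show ?thesis using \<open>\<kappa> < H\<close> by (simp add: \<kappa>_def)
  qed
  from tr have s0: "s 0 = (\<lambda>_. 0)(0 := x)" and e: "\<And>t. t < T \<Longrightarrow> e t < ?N"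
    and ops: "\<And>t. t < T \<Longrightarrow> (s t, s (Suc t)) \<in> op_rel (edge_op (es ! e t))"
    and st: "\<And>t. t \<le> T \<Longrightarrow> (if t < T then edge_src (es ! e t) else q) = (case t of 0 \<Rightarrow> p | Suc t' \<Rightarrow> edge_tgt (es ! e t'))"
    unfolding trace_def by auto
  define J where "J = vec ?Q (\<lambda>_. 1) T"
  define E where "E j = vec ?Q (\<lambda>t. if e t = j then 1 else 0) T" for j
  \<comment> \<open>The complement of \<open>E j\<close>: multiplied by \<open>G\<close>, it is a
    mask that leaves no room for a tested register at the times when edge \<open>j\<close> is
    taken.\<close>
  define Z where "Z j = vec ?Q (\<lambda>t. if e t = j then 0 else 1) T" for j
  define R where "R r = vec ?Q (\<lambda>t. s t r) T" for r
  have sel: "(\<Sum>j<?N. c j * E j) = vec ?Q (\<lambda>t. c (e t)) T" for c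
    unfolding E_def by (rule vec_select) (rule e)
  have G: "(H - 1) * J = vec ?Q (\<lambda>_. H - 1) T" "(H - 1) * Z j = vec ?Q (\<lambda>t. (H - 1) * (if e t = j then 0 else 1)) T" for j
    unfolding J_def Z_def vec_scale by simp_all
  have "arith es \<sigma> C m p q x \<kappa> T H (H - 1) (?Q ^ T) J E R Z (\<lambda>r. s T r)"
    unfolding arith_def
  proof (intro conjI allI impI)
    show "H = 2 ^ \<kappa>" "H - 1 + 1 = H" "C < H" "x < H" "?Q ^ T = ?Q ^ T" using bound by (auto simp: H_def)
    show "2 * H * J + 1 = ?Q ^ T + J" using vec_ones_iff[OF Q(2)] J_def by blast
    show "masked (E j) J" for j
    proof -
      have "(1::nat) < 2 ^ Suc \<kappa>" using Q(1,2) by metis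
      then show ?thesis unfolding J_def E_def Q(1)
        by (subst masked_vec) (assumption, intro exI conjI allI impI, rule refl, simp add: masked_def)
    qed
    show "(\<Sum>j<?N. E j) = J" using sel[of "\<lambda>_. 1"] by (simp add: J_def)
    show "masked (R r) ((H - 1) * J)" if "r < m" for r
      unfolding G Q(1) using Q sbound that
      by (subst masked_vec) (auto simp: R_def H_def masked_ones[unfolded One_nat_def] intro!: exI)
    show "?Q * (R r + (\<Sum>j<?N. incs es r j * E j)) + (if r = 0 then x else 0)
      = R r + ?Q * (\<Sum>j<?N. decs es r j * E j) + s T r * ?Q ^ T" if "r < m" for r
    proof -
      \<comment> \<open>At each time this is \<open>op_rel_balance\<close>. Multiplication by the
        base then shifts by one unit of time, and the initial content enters as lowest
        digit.\<close>
      have "R r + (\<Sum>j<?N. incs es r j * E j) = vec ?Q (\<lambda>t. s (Suc t) r + decs es r (e t)) T"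
        unfolding sel R_def vec_add by (rule vec_cong) (rule op_rel_balance, rule ops)
      also have "\<dots> = vec ?Q (\<lambda>t. s (Suc t) r) T + (\<Sum>j<?N. decs es r j * E j)"
        by (simp only: sel vec_add)
      finally have "?Q * (R r + (\<Sum>j<?N. incs es r j * E j)) + (if r = 0 then x else 0)
        = (s 0 r + ?Q * vec ?Q (\<lambda>t. s (Suc t) r) T) + ?Q * (\<Sum>j<?N. decs es r j * E j)"
        by (simp add: s0 distrib_left)
      also have "s 0 r + ?Q * vec ?Q (\<lambda>t. s (Suc t) r) T = vec ?Q (\<lambda>t. s t r) (Suc T)"
        by (simp only: vec_Suc)
      also have "\<dots> = R r + s T r * ?Q ^ T" by (simp only: vec_def R_def sum.lessThan_Suc)
      finally show ?thesis by simp
    qed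
    show "Z j + E j = J" for j
      unfolding Z_def E_def J_def vec_add by (rule vec_cong) simp
    show "masked (R r) ((H - 1) * Z j)" if "j < ?N" "r < m" "edge_op (es ! j) = TstOp r" for j r
    proof -
      have "masked (s t r) ((H - 1) * (if e t = j then 0 else 1))" if "t < T" for t
      proof (cases "e t = j")
        case True
        then show ?thesis using ops[OF \<open>t < T\<close>] \<open>edge_op (es ! j) = TstOp r\<close> by simp
      next
        case False
        then show ?thesis using sbound[of t r] \<open>t < T\<close> \<open>r < m\<close> by (simp add: H_def masked_ones[unfolded One_nat_def])
      qed
      then have "\<exists>d. R r = vec ?Q d T \<and> (\<forall>t<T. masked (d t) ((H - 1) * (if e t = j then 0 else 1)))"
        unfolding R_def by blast
      moreover have "(H - 1) * (if e t = j then 0 else 1) < ?Q" for t using \<open>1 \<le> H\<close> by auto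
      ultimately show ?thesis unfolding G Q(1) by (subst masked_vec)
    qed
    have "?Q * (\<Sum>j<?N. \<sigma> (edge_tgt (es ! j)) * E j) + \<sigma> p
        = vec ?Q (case_nat (\<sigma> p) (\<lambda>t. \<sigma> (edge_tgt (es ! e t)))) (Suc T)"
      unfolding sel by (subst add.commute) (rule vec_shift)
    also have "\<dots> = vec ?Q (\<lambda>t. if t < T then \<sigma> (edge_src (es ! e t)) else \<sigma> q) (Suc T)"
    proof (rule vec_cong)
      fix t assume "t < Suc T"
      then show "(case t of 0 \<Rightarrow> \<sigma> p | Suc t \<Rightarrow> \<sigma> (edge_tgt (es ! e t))) =
         (if t < T then \<sigma> (edge_src (es ! e t)) else \<sigma> q)"
        using arg_cong[OF st[of t], of \<sigma>] by (cases t) (auto split: if_splits)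
    qed
    also have "\<dots> = (\<Sum>j<?N. \<sigma> (edge_src (es ! j)) * E j) + \<sigma> q * ?Q ^ T"
      unfolding sel vec_top ..
    finally show "?Q * (\<Sum>j<?N. \<sigma> (edge_tgt (es ! j)) * E j) + \<sigma> p
        = (\<Sum>j<?N. \<sigma> (edge_src (es ! j)) * E j) + \<sigma> q * ?Q ^ T" .
  qed
  then show ?thesis by blast
qed

lemma arith_imp_trace:
  assumes ar: "arith es \<sigma> C m p q x \<kappa> T H G P J E R Z F"
    and C: "length es \<le> C" "\<sigma> p \<le> C" "\<And>e. e \<in> set es \<Longrightarrow> \<sigma> (edge_src e) \<le> C \<and> \<sigma> (edge_tgt e) \<le> C"
    and inj: "inj_on \<sigma> ({p, q} \<union> edge_src ` set es \<union> edge_tgt ` set es)"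
    and regs: "0 < m" "\<And>e r. e \<in> set es \<Longrightarrow> edge_op e \<in> {IncOp r, DecOp r, TstOp r} \<Longrightarrow> r < m"
  shows "\<exists>e s. trace es p q ((\<lambda>_. 0)(0 := x)) T e s"
proof -
  let ?N = "length es" and ?Q = "2 * H"
  from ar have H: "H = 2 ^ \<kappa>" "G + 1 = H" "C < H" "x < H" and P: "P = ?Q ^ T" and J: "?Q * J + 1 = P + J"
    and E: "\<And>j. j < ?N \<Longrightarrow> masked (E j) J" "(\<Sum>j<?N. E j) = J"
    and R: "\<And>r. r < m \<Longrightarrow> masked (R r) (G * J)"
    and reg: "\<And>r. r < m \<Longrightarrow> ?Q * (R r + (\<Sum>j<?N. incs es r j * E j)) + (if r = 0 then x else 0)
      = R r + ?Q * (\<Sum>j<?N. decs es r j * E j) + F r * P"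
    and Z: "\<And>j. j < ?N \<Longrightarrow> Z j + E j = J"
      "\<And>j r. j < ?N \<Longrightarrow> r < m \<Longrightarrow> edge_op (es ! j) = TstOp r \<Longrightarrow> masked (R r) (G * Z j)"
    and state: "?Q * (\<Sum>j<?N. \<sigma> (edge_tgt (es ! j)) * E j) + \<sigma> p
      = (\<Sum>j<?N. \<sigma> (edge_src (es ! j)) * E j) + \<sigma> q * P"
    unfolding arith_def by blast+
  have "1 < ?Q" "H < ?Q" "G < ?Q" using H(2,3) by linarith+
  moreover have "?Q = 2 ^ Suc \<kappa>" by (simp add: H(1))
  ultimately have Q: "?Q = 2 ^ Suc \<kappa>" "1 < ?Q" "H < ?Q" "G < ?Q" by -
  have J: "J = vec ?Q (\<lambda>_. 1) T" using vec_ones_iff[OF Q(2)] J P by blast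
  \<comment> \<open>Masked by \<open>J\<close>, the number \<open>E j\<close> has only digits 0 and
    1.\<close>
  have "\<forall>j. \<exists>d. j < ?N \<longrightarrow> E j = vec ?Q d T \<and> (\<forall>t<T. d t \<le> 1)"
    using E(1) Q(2) unfolding J Q(1) by (subst (asm) masked_vec) (auto simp: masked_1[unfolded One_nat_def])
  then obtain \<epsilon> where \<epsilon>: "\<And>j. j < ?N \<Longrightarrow> E j = vec ?Q (\<epsilon> j) T" "\<And>j t. j < ?N \<Longrightarrow> t < T \<Longrightarrow> \<epsilon> j t \<le> 1"
    by metis
  have "vec ?Q (\<lambda>t. \<Sum>j<?N. \<epsilon> j t) T = vec ?Q (\<lambda>_. 1) T"
    using E(2) \<epsilon>(1) unfolding J vec_sum[symmetric] by simp
  \<comment> \<open>At most \<open>length es \<le> C < H\<close> ones are added per digit, so no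
    carry blurs the condition that one edge is taken at each time.\<close>
  moreover have "(\<Sum>j<?N. \<epsilon> j t) < ?Q" if "t < T" for t
  proof -
    have "(\<Sum>j<?N. \<epsilon> j t) \<le> (\<Sum>j<?N. 1)" using \<epsilon>(2) that by (intro sum_mono) auto
    then show ?thesis using C(1) H(3) by simp
  qed
  ultimately have one: "(\<Sum>j<?N. \<epsilon> j t) = 1" if "t < T" for t
    using vec_unique'[of ?Q "\<lambda>t. \<Sum>j<?N. \<epsilon> j t" T "\<lambda>_. 1" t] that Q(2) by auto
  have "\<exists>i. t < T \<longrightarrow> i < ?N \<and> (\<forall>j<?N. \<epsilon> j t = (if i = j then 1 else 0))" for t
  proof (cases "t < T")
    case True
    from one[OF True] obtain i where i: "i < ?N" "\<epsilon> i t = 1" "\<And>j. j < ?N \<Longrightarrow> j \<noteq> i \<Longrightarrow> \<epsilon> j t = 0"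
      by (subst (asm) sum_eq_1_iff) auto
    then show ?thesis by (intro exI[of _ i]) auto
  qed simp
  then obtain e where e: "\<And>t. t < T \<Longrightarrow> e t < ?N"
    "\<And>t j. t < T \<Longrightarrow> j < ?N \<Longrightarrow> \<epsilon> j t = (if e t = j then 1 else 0)"
    by metis
  have E': "E j = vec ?Q (\<lambda>t. if e t = j then 1 else 0) T" if "j < ?N" for j
    unfolding \<epsilon>(1)[OF that] by (rule vec_cong) (rule e(2)[OF _ that])
  have sel: "(\<Sum>j<?N. c j * E j) = vec ?Q (\<lambda>t. c (e t)) T" for c
    using vec_select[of T e ?N c ?Q, OF e(1)] E' by simp
  have "\<forall>r. \<exists>d. r < m \<longrightarrow> R r = vec ?Q d T \<and> (\<forall>t<T. masked (d t) G)"
    using R Q(4) unfolding J Q(1) vec_scale by (subst (asm) masked_vec) auto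
  then obtain \<rho> where \<rho>: "\<And>r. r < m \<Longrightarrow> R r = vec ?Q (\<rho> r) T" "\<And>r t. r < m \<Longrightarrow> t < T \<Longrightarrow> masked (\<rho> r t) G"
    by metis
  have \<rho>H: "\<rho> r t < H" if "r < m" "t < T" for r t
    using masked_le[OF \<rho>(2)[OF that]] H(2) by simp
  \<comment> \<open>The content at time \<open>T\<close> is not a digit of \<open>R r\<close> but
    the coefficient \<open>F r\<close> of \<open>P\<close>; registers from \<open>m\<close> on stay
    0.\<close>
  define s where "s t r = (if r < m then if t < T then \<rho> r t else F r else 0)" for t r
  have reg_eq: "s 0 r = (if r = 0 then x else 0) \<and> (\<forall>t<T. s t r + incs es r (e t) = s (Suc t) r + decs es r (e t))"
    if r: "r < m" for r
  proof -
    \<comment> \<open>\<open>?a\<close> and \<open>?b\<close> are the digits of the two sides of the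
      register equation; all but the last stay below the base.\<close>
    let ?a = "case_nat (if r = 0 then x else 0) (\<lambda>t. \<rho> r t + incs es r (e t))"
    let ?b = "\<lambda>t. s t r + case_nat 0 (\<lambda>t. decs es r (e t)) t"
    have "vec ?Q ?a (Suc T) = (if r = 0 then x else 0) + ?Q * (R r + (\<Sum>j<?N. incs es r j * E j))"
      unfolding vec_shift[symmetric] sel \<rho>(1)[OF r] vec_add ..
    also have "\<dots> = (R r + F r * P) + (0 + ?Q * (\<Sum>j<?N. decs es r j * E j))"
      using reg[OF r] by simp
    also have "R r + F r * P = vec ?Q (\<lambda>t. s t r) (Suc T)"
      unfolding \<rho>(1)[OF r] P vec_top by (rule vec_cong) (simp add: s_def r)
    also have "0 + ?Q * (\<Sum>j<?N. decs es r j * E j) = vec ?Q (case_nat 0 (\<lambda>t. decs es r (e t))) (Suc T)"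
      unfolding sel vec_shift ..
    finally have eq: "vec ?Q ?a (Suc T) = vec ?Q ?b (Suc T)" unfolding vec_add .
    have small: "?a t < ?Q \<and> ?b t < ?Q" if "t < T" for t
    proof
      have "incs es r i \<le> 1" "decs es r i \<le> 1" for i by (auto simp: incs_def decs_def)
      note le = this
      show "?a t < ?Q"
      proof (cases t)
        case (Suc t')
        with \<rho>H[OF r, of t'] le(1)[of "e t'"] that show ?thesis by simp
      qed (use H(4) Q(3) in auto)
      have "?b t \<le> s t r + 1" using le(2) by (cases t) auto
      moreover have "s t r < H" using \<rho>H[OF r that] that r by (simp add: s_def)
      ultimately show "?b t < ?Q" by linarith
    qed
    have "?a t = ?b t" if "t \<le> T" for t by (rule vec_unique[OF eq small that])
    from this[of 0] this[of "Suc _"] show ?thesis using r by (auto simp: s_def)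
  qed
  let ?src = "\<lambda>t. if t < T then edge_src (es ! e t) else q" and ?tgt = "\<lambda>t. case t of 0 \<Rightarrow> p | Suc t' \<Rightarrow> edge_tgt (es ! e t')"
  have "vec ?Q (case_nat (\<sigma> p) (\<lambda>t. \<sigma> (edge_tgt (es ! e t)))) (Suc T)
      = vec ?Q (\<lambda>t. if t < T then \<sigma> (edge_src (es ! e t)) else \<sigma> q) (Suc T)"
    using state unfolding sel P vec_top by (simp add: vec_shift[symmetric] add.commute)
  moreover have "case_nat (\<sigma> p) (\<lambda>t. \<sigma> (edge_tgt (es ! e t))) t < ?Q \<and>
      (if t < T then \<sigma> (edge_src (es ! e t)) else \<sigma> q) < ?Q" if "t < T" for t
  proof -
    have "\<sigma> (edge_src (es ! e t)) \<le> C" using C(3) e(1)[OF that] by simp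
    moreover have "case_nat (\<sigma> p) (\<lambda>t. \<sigma> (edge_tgt (es ! e t))) t \<le> C"
      using C(2,3) e(1)[of "t - 1"] that by (cases t) auto
    ultimately show ?thesis using H(3) Q(3) that by simp
  qed
  ultimately have \<sigma>eq: "case_nat (\<sigma> p) (\<lambda>t. \<sigma> (edge_tgt (es ! e t))) t = (if t < T then \<sigma> (edge_src (es ! e t)) else \<sigma> q)"
    if "t \<le> T" for t
    using that by (rule vec_unique)
  \<comment> \<open>Equal digits are equal state codes, and \<open>\<sigma>\<close> is injective on
    the states that occur.\<close>
  have states: "?src t = ?tgt t" if "t \<le> T" for t
  proof (rule inj_onD[OF inj])
    show "\<sigma> (?src t) = \<sigma> (?tgt t)" using \<sigma>eq[OF that] by (cases t) (auto split: if_splits)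
    show "?src t \<in> {p, q} \<union> edge_src ` set es \<union> edge_tgt ` set es" using e(1)[of t] by auto
    show "?tgt t \<in> {p, q} \<union> edge_src ` set es \<union> edge_tgt ` set es"
      using e(1)[of "t - 1"] that by (cases t) auto
  qed
  have ops: "(s t, s (Suc t)) \<in> op_rel (edge_op (es ! e t))" if t: "t < T" for t
  proof -
    have mem: "es ! e t \<in> set es" using e(1)[OF t] by simp
    have bal: "s t r + incs es r (e t) = s (Suc t) r + decs es r (e t)" if "r < m" for r
      using reg_eq[OF that] t by blast
    have out: "s t r = 0" if "\<not> r < m" for t r using that by (simp add: s_def)
    show ?thesis
    proof (cases "edge_op (es ! e t)")
      case Nop
      have "s t r = s (Suc t) r" for r
        using bal[of r] out[of r] Nop by (cases "r < m") (auto simp: incs_def decs_def)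
      then show ?thesis using Nop by auto
    next
      case (IncOp i)
      have i: "i < m" using regs(2)[OF mem] IncOp by blast
      have "s (Suc t) r = ((s t)(i := Suc (s t i))) r" for r
        using bal[of r] out[of r] IncOp i by (cases "r < m") (auto simp: incs_def decs_def)
      then show ?thesis using IncOp by auto
    next
      case (DecOp i)
      have i: "i < m" using regs(2)[OF mem] DecOp by blast
      have "s (Suc t) r = ((s t)(i := s t i - 1)) r" for r
        using bal[of r] out[of r] DecOp i by (cases "r < m") (auto simp: incs_def decs_def)
      moreover have "0 < s t i" using bal[OF i] DecOp by (simp add: incs_def decs_def)
      ultimately show ?thesis using DecOp by auto
    next
      case (TstOp i)
      have i: "i < m" using regs(2)[OF mem] TstOp by blast
      have "s (Suc t) r = s t r" for r
        using bal[of r] out[of r] TstOp i by (cases "r < m") (auto simp: incs_def decs_def)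
      \<comment> \<open>The mask \<open>G * Z\<close> of the tested edge has digit 0 at time
        \<open>t\<close>, which forces the register digit to 0.\<close>
      moreover have "s t i = 0"
      proof -
        let ?j = "e t"
        have j: "?j < ?N" using e(1)[OF t] .
        have "Z ?j + E ?j = vec ?Q (\<lambda>u. if e u = ?j then 0 else 1) T + E ?j"
          unfolding E'[OF j] Z(1)[OF j, unfolded E'[OF j]] J vec_add by (rule vec_cong) simp
        then have "Z ?j = vec ?Q (\<lambda>u. if e u = ?j then 0 else 1) T" by simp
        with Z(2)[OF j i TstOp] have "masked (R i) (vec ?Q (\<lambda>u. G * (if e u = ?j then 0 else 1)) T)"
          by (simp add: vec_scale)
        then obtain d where d: "R i = vec ?Q d T" "\<forall>u<T. masked (d u) (G * (if e u = ?j then 0 else 1))"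
          using Q(4) unfolding Q(1) by (subst (asm) masked_vec) auto
        have "d u < ?Q" if "u < T" for u
          using masked_le[OF d(2)[rule_format, OF that]] Q(4) by (auto split: if_splits)
        then have "\<rho> i t = d t"
          using vec_unique'[of ?Q "\<rho> i" T d t] \<rho>(1)[OF i] d(1) less_trans[OF \<rho>H[OF i] Q(3)] t by metis
        then show ?thesis using d(2) t i by (auto simp: s_def)
      qed
      ultimately show ?thesis using TstOp by auto
    qed
  qed
  have "s 0 = (\<lambda>_. 0)(0 := x)"
  proof
    fix r show "s 0 r = ((\<lambda>_. 0)(0 := x)) r"
      using reg_eq[of r] regs(1) by (cases "r < m") (auto simp: s_def)
  qed
  then have "trace es p q ((\<lambda>_. 0)(0 := x)) T e s"
    unfolding trace_def using e(1) ops states by blast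
  then show ?thesis by blast
qed

section \<open>Exponentiation from rotations\<close>

fun pell :: "int \<Rightarrow> nat \<Rightarrow> int \<times> int" where
  "pell a 0 = (1, 0)"
| "pell a (Suc n) = (a * fst (pell a n) + (a\<^sup>2 - 1) * snd (pell a n), fst (pell a n) + a * snd (pell a n))"

text \<open>The pair represents \<open>(a + sqrt (a^2 - 1)) ^ n\<close>, an element of norm
  1.\<close>

lemma pell_solution: "(fst (pell a n))\<^sup>2 = (a\<^sup>2 - 1) * (snd (pell a n))\<^sup>2 + 1"
proof (induction n)
  case (Suc n)
  let ?x = "fst (pell a n)" and ?y = "snd (pell a n)"
  have "(a * ?x + (a\<^sup>2 - 1) * ?y)\<^sup>2 - (a\<^sup>2 - 1) * (?x + a * ?y)\<^sup>2 = ?x\<^sup>2 - (a\<^sup>2 - 1) * ?y\<^sup>2"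
    by algebra
  then show ?case using Suc by simp
qed simp

lemma pell_nonneg: "a \<ge> 1 \<Longrightarrow> 1 \<le> fst (pell a n) \<and> 0 \<le> snd (pell a n)"
proof (induction n)
  case (Suc n)
  then have x: "1 \<le> fst (pell a n)" and y: "0 \<le> snd (pell a n)" by auto
  have "1 * 1 \<le> a * fst (pell a n)" using Suc.prems x by (intro mult_mono) auto
  moreover have "0 \<le> (a\<^sup>2 - 1) * snd (pell a n)" using Suc.prems y by simp
  moreover have "0 \<le> a * snd (pell a n)" using Suc.prems y by simp
  ultimately show ?case using x by simp
qed simp

text \<open>Descent: multiplication by the inverse \<open>a - sqrt (a^2 - 1)\<close> leads from a
  solution with \<open>y > 0\<close> to one with smaller \<open>y\<close>.\<close>

lemma pell_complete:
  assumes "a \<ge> 2" "0 \<le> x" "0 \<le> y" "x\<^sup>2 = (a\<^sup>2 - 1) * y\<^sup>2 + 1"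
  shows "\<exists>n. pell a n = (x, y)"
  using assms(2-)
proof (induction "nat y" arbitrary: x y rule: less_induct)
  case less
  show ?case
  proof (cases "y = 0")
    case True
    with less.prems have "x\<^sup>2 = 1" by simp
    with less.prems(1) have "x = 1" by (simp add: power2_eq_1_iff)
    with True show ?thesis by (intro exI[of _ 0]) simp
  next
    case False
    with less.prems have y: "0 < y" by simp
    let ?x = "a * x - (a\<^sup>2 - 1) * y" and ?y = "a * y - x"
    have eq: "?x\<^sup>2 = (a\<^sup>2 - 1) * ?y\<^sup>2 + 1" using less.prems(3) by algebra
    \<comment> \<open>The bounds \<open>(a - 1) * y < x\<close> and \<open>x \<le> a * y\<close> say
      that the new second component is nonnegative and below \<open>y\<close>.\<close>
    have "x\<^sup>2 \<le> (a * y)\<^sup>2"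
    proof -
      have "1 \<le> y\<^sup>2" using y by (simp add: int_one_le_iff_zero_less)
      then show ?thesis using less.prems(3) by (simp add: power_mult_distrib algebra_simps)
    qed
    then have "x \<le> a * y" by (rule power2_le_imp_le) (use assms(1) y in simp)
    moreover have "((a - 1) * y)\<^sup>2 < x\<^sup>2"
    proof -
      have "(a - 1)\<^sup>2 \<le> a\<^sup>2 - 1" using assms(1) by (simp add: power2_eq_square algebra_simps)
      then have "(a - 1)\<^sup>2 * y\<^sup>2 \<le> (a\<^sup>2 - 1) * y\<^sup>2" by (rule mult_right_mono) simp
      then show ?thesis using less.prems(3) by (simp add: power_mult_distrib)
    qed
    then have "(a - 1) * y < x" by (rule power2_less_imp_less) (use less.prems in simp)
    moreover have "0 \<le> ?x"
    proof -
      have "((a\<^sup>2 - 1) * y)\<^sup>2 \<le> (a * x)\<^sup>2"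
      proof -
        have "(a * x)\<^sup>2 - ((a\<^sup>2 - 1) * y)\<^sup>2 = (a\<^sup>2 - 1) * y\<^sup>2 + a\<^sup>2" using less.prems(3) by algebra
        moreover have "0 \<le> (a\<^sup>2 - 1) * y\<^sup>2" using assms(1) by simp
        ultimately show ?thesis by (smt (verit) zero_le_power2)
      qed
      then have "(a\<^sup>2 - 1) * y \<le> a * x" by (rule power2_le_imp_le) (use assms(1) less.prems in simp)
      then show ?thesis by simp
    qed
    ultimately have "nat ?y < nat y" "0 \<le> ?y" using y by (auto simp: algebra_simps)
    from less.hyps[OF this(1) \<open>0 \<le> ?x\<close> this(2) eq] obtain n where n: "pell a n = (?x, ?y)" by blast
    have "pell a (Suc n) = (x, y)" using n by (simp add: algebra_simps power2_eq_square)
    then show ?thesis by blast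
  qed
qed

text \<open>Modulo \<open>a - 1\<close>, \<open>a\<close> is 1 and \<open>a^2 - 1\<close> is 0, so
  the recursion keeps the first component at 1 and adds 1 to the second.\<close>

lemma pell_cong: "(a - 1) dvd (fst (pell a n) - 1) \<and> (a - 1) dvd (snd (pell a n) - int n)"
proof (induction n)
  case (Suc n)
  let ?x = "fst (pell a n)" and ?y = "snd (pell a n)"
  have 1: "a * ?x + (a\<^sup>2 - 1) * ?y - 1 = (a - 1) * (?x + (a + 1) * ?y) + (?x - 1)"
    by (simp add: algebra_simps power2_eq_square)
  have 2: "?x + a * ?y - int (Suc n) = (?x - 1) + (?y - int n) + (a - 1) * ?y"
    by (simp add: algebra_simps)
  show ?case unfolding pell.simps(2) fst_conv snd_conv 1 2
    using Suc by (intro conjI dvd_add dvd_triv_left) auto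
qed simp

lemma pell_growth: "a \<ge> 1 \<Longrightarrow> a ^ n \<le> snd (pell a (Suc n))"
proof (induction n)
  case (Suc n)
  then have "a * a ^ n \<le> a * snd (pell a (Suc n))" by (intro mult_left_mono) auto
  also have "\<dots> \<le> snd (pell a (Suc (Suc n)))"
    using pell_nonneg[OF Suc.prems, of "Suc n"] unfolding pell.simps(2)[of a "Suc n"] snd_conv by linarith
  finally show ?case by simp
qed simp

lemma pell_mono:
  assumes "a \<ge> 1" "m \<le> n"
  shows "snd (pell a m) \<le> snd (pell a n)"
  using assms(2)
proof (induction rule: dec_induct)
  case (step n)
  have "1 * snd (pell a n) \<le> a * snd (pell a n)"
    using pell_nonneg[OF assms(1), of n] assms(1) by (intro mult_right_mono) auto
  then show ?case using step.IH pell_nonneg[OF assms(1), of n] unfolding pell.simps(2)[of a n] snd_conv by linarith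
qed simp

text \<open>
  The index of a solution \<open>y\<close> of Pell's equation is congruent to \<open>y\<close>, so that \<open>y\<close> cannot be small.
\<close>

lemma pell_certificate:
  fixes b n x y k :: nat
  assumes "Suc n < b" "x * x + y * y = (b + 1) * (b + 1) * (y * y) + 1" "y = n + 1 + k * b"
  shows "(b + 1) ^ n \<le> y"
proof -
  let ?a = "int b + 1"
  have "(int x)\<^sup>2 = (?a\<^sup>2 - 1) * (int y)\<^sup>2 + 1"
    using arg_cong[OF assms(2), of int] by (simp add: power2_eq_square algebra_simps)
  moreover have "?a \<ge> 2" using assms(1) by simp
  ultimately obtain j where j: "pell ?a j = (int x, int y)" using pell_complete[of ?a "int x" "int y"] by auto
  have "int b dvd int y - int j" using pell_cong[of ?a j] j by simp
  moreover have "int y - int j = (int n + 1 - int j) + int k * int b" using assms(3) by simp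
  ultimately have "int b dvd int n + 1 - int j" by (metis dvd_add_left_iff dvd_triv_right)
  \<comment> \<open>A smaller index would produce a positive multiple of \<open>b\<close> below
    \<open>b\<close>.\<close>
  have "Suc n \<le> j"
  proof (rule ccontr)
    assume "\<not> Suc n \<le> j"
    then have "0 < int n + 1 - int j" "int n + 1 - int j < int b" using assms(1) by auto
    with \<open>int b dvd int n + 1 - int j\<close> show False by (meson zdvd_not_zless)
  qed
  then have "?a ^ n \<le> int y" using pell_growth[of ?a n] pell_mono[of ?a "Suc n" j] j by simp
  then have "int ((b + 1) ^ n) \<le> int y" by (simp add: add.commute)
  then show ?thesis by linarith
qed

text \<open>The solution with index \<open>n + 1\<close>; its congruence modulo \<open>b\<close>
  yields \<open>k\<close>.\<close>

lemma pell_certificate_ex: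
  fixes b n :: nat
  assumes "Suc n < b"
  shows "\<exists>x y k. x * x + y * y = (b + 1) * (b + 1) * (y * y) + 1 \<and> y = n + 1 + k * b"
proof -
  let ?a = "int b + 1"
  obtain X Y where XY: "pell ?a (Suc n) = (X, Y)" by fastforce
  have nn: "1 \<le> X" "0 \<le> Y" using pell_nonneg[of ?a "Suc n"] XY by auto
  have eq: "X\<^sup>2 = (?a\<^sup>2 - 1) * Y\<^sup>2 + 1" using pell_solution[of ?a "Suc n"] XY by simp
  obtain K where K: "Y - int (Suc n) = int b * K" using pell_cong[of ?a "Suc n"] XY by (auto simp: dvd_def)
  have "0 \<le> K"
  proof (rule ccontr)
    assume "\<not> 0 \<le> K"
    then have "int b * K \<le> int b * (- 1)" by (intro mult_left_mono) auto
    then show False using K nn(2) assms by simp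
  qed
  have "int (nat X * nat X + nat Y * nat Y) = int ((b + 1) * (b + 1) * (nat Y * nat Y) + 1)"
    using eq nn by (simp add: power2_eq_square algebra_simps)
  moreover have "int (nat Y) = int (n + 1 + nat K * b)" using K nn \<open>0 \<le> K\<close> by (simp add: algebra_simps)
  ultimately show ?thesis using of_nat_eq_iff by blast
qed

section \<open>Powers of the square of u + i\<close>

fun gauss_pow :: "int \<Rightarrow> nat \<Rightarrow> int \<times> int" where
  "gauss_pow u 0 = (1, 0)"
| "gauss_pow u (Suc n) = ((u\<^sup>2 - 1) * fst (gauss_pow u n) - 2 * u * snd (gauss_pow u n),
     2 * u * fst (gauss_pow u n) + (u\<^sup>2 - 1) * snd (gauss_pow u n))"

lemma gauss_pow_complex:
  "Complex (of_int u) 1 ^ (2 * n) = Complex (of_int (fst (gauss_pow u n))) (of_int (snd (gauss_pow u n)))"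
proof (induction n)
  case (Suc n)
  have "Complex (of_int u) 1 ^ (2 * Suc n) = Complex (of_int u) 1 ^ (2 * n) * (Complex (of_int u) 1 * Complex (of_int u) 1)"
    by simp
  then show ?case unfolding Suc by (simp add: complex_eq_iff algebra_simps power2_eq_square)
qed (simp add: complex_eq_iff)

text \<open>Modulo \<open>u\<^sup>2 + 1\<close> the number \<open>(u + i)\<^sup>2\<close> is \<open>2 * i\<close> times \<open>u + i\<close>.\<close>

lemma gauss_pow_coprime:
  assumes "even u"
  shows "coprime (fst (gauss_pow u n)) (u\<^sup>2 + 1)"
proof -
  \<comment> \<open>For the power \<open>x + i * y\<close>, the divisibility says that it is
    \<open>- i * x * (u + i)\<close> modulo \<open>u^2 + 1\<close>. This holds from the first power
    on, hence the shifted index.\<close>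
  have *: "(u\<^sup>2 + 1) dvd (snd (gauss_pow u (Suc n)) + u * fst (gauss_pow u (Suc n))) \<and>
    coprime (fst (gauss_pow u (Suc n))) (u\<^sup>2 + 1)" for n
  proof (induction n)
    case 0
    have "2 * u + u * (u\<^sup>2 - 1) = (u\<^sup>2 + 1) * u" by (simp add: algebra_simps power2_eq_square)
    moreover have "coprime (u\<^sup>2 - 1) (u\<^sup>2 + 1)"
    proof -
      have "coprime 2 (u\<^sup>2 + 1)" using assms by simp
      moreover have "gcd (u\<^sup>2 - 1) (u\<^sup>2 + 1) dvd 2"
        using dvd_diff[of "gcd (u\<^sup>2 - 1) (u\<^sup>2 + 1)" "u\<^sup>2 + 1" "u\<^sup>2 - 1"] by simp
      ultimately show ?thesis
        by (meson coprime_absorb_left coprime_common_divisor coprime_iff_gcd_eq_1 gcd_dvd2 gcd_dvd1 dvd_trans is_unit_gcd)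
    qed
    ultimately show ?case by simp
  next
    case (Suc n)
    obtain x y where xy: "gauss_pow u (Suc n) = (x, y)" by fastforce
    from Suc have IH: "(u\<^sup>2 + 1) dvd (y + u * x)" "coprime x (u\<^sup>2 + 1)" by (simp_all only: xy fst_conv snd_conv)
    from IH(1) obtain k where "y + u * x = (u\<^sup>2 + 1) * k" by (auto simp: dvd_def)
    then have k: "y = (u\<^sup>2 + 1) * k - u * x" by simp
    have "(2 * u * x + (u\<^sup>2 - 1) * y) + u * ((u\<^sup>2 - 1) * x - 2 * u * y) = (u\<^sup>2 + 1) * (u * x - y)"
      by (simp add: algebra_simps power2_eq_square)
    \<comment> \<open>The next real part is \<open>- 4 * x\<close> modulo \<open>u^2 + 1\<close>,
      and \<open>u^2 + 1\<close> is odd because \<open>u\<close> is even.\<close>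
    moreover have x': "(u\<^sup>2 - 1) * x - 2 * u * y = (u\<^sup>2 + 1) * (3 * x - 2 * u * k) + - (2 * 2 * x)"
      unfolding k by (simp add: algebra_simps power2_eq_square)
    moreover have "coprime ((u\<^sup>2 + 1) * (3 * x - 2 * u * k) + - (2 * 2 * x)) (u\<^sup>2 + 1)"
    proof -
      have "coprime 2 (u\<^sup>2 + 1)" using assms by simp
      then have "coprime (2 * 2 * x) (u\<^sup>2 + 1)" using IH(2) by (simp only: coprime_mult_left_iff)
      then have "coprime (- (2 * 2 * x)) (u\<^sup>2 + 1)" by (simp only: coprime_minus_left_iff)
      moreover have "gcd ((u\<^sup>2 + 1) * z + w) (u\<^sup>2 + 1) = gcd w (u\<^sup>2 + 1)" for z w
        by (metis add.commute gcd.commute gcd_add_mult mult.commute)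
      ultimately show ?thesis by (simp only: coprime_iff_gcd_eq_1)
    qed
    ultimately show ?case
      unfolding gauss_pow.simps(2)[of u "Suc n"] xy fst_conv snd_conv by (simp only: dvd_triv_left simp_thms)
  qed
  show ?thesis using *[of "n - 1"] by (cases n) auto
qed

text \<open>For the rotation \<open>e^(i \<theta>) = (u + i)^2 / (u^2 + 1)\<close> this is
  \<open>m * e^(i n \<theta>) = A + i * B\<close> with the denominator cleared.\<close>

definition gauss_eq :: "nat \<Rightarrow> nat \<Rightarrow> nat \<Rightarrow> int \<Rightarrow> int \<Rightarrow> bool" where
  "gauss_eq u n m A B \<longleftrightarrow>
    of_nat m * Complex (real u) 1 ^ (2 * n) = Complex (of_int A) (of_int B) * of_nat ((u * u + 1) ^ n)"

lemma gauss_eq_iff: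
  "gauss_eq u n m A B \<longleftrightarrow> int m * fst (gauss_pow (int u) n) = A * int ((u * u + 1) ^ n) \<and>
    int m * snd (gauss_pow (int u) n) = B * int ((u * u + 1) ^ n)"
proof -
  have "gauss_eq u n m A B \<longleftrightarrow>
    real m * of_int (fst (gauss_pow (int u) n)) = of_int A * real ((u * u + 1) ^ n) \<and>
    real m * of_int (snd (gauss_pow (int u) n)) = of_int B * real ((u * u + 1) ^ n)"
    unfolding gauss_eq_def using gauss_pow_complex[of "int u" n]
    by (simp add: complex_eq_iff del: of_nat_power of_nat_add of_nat_mult)
  also have "\<dots> \<longleftrightarrow> real_of_int (int m * fst (gauss_pow (int u) n)) = real_of_int (A * int ((u * u + 1) ^ n)) \<and>
    real_of_int (int m * snd (gauss_pow (int u) n)) = real_of_int (B * int ((u * u + 1) ^ n))"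
    by simp
  finally show ?thesis unfolding of_int_eq_iff .
qed

text \<open>The real part of the rotated point equals \<open>A / m\<close> and also a fraction with
  denominator \<open>(u * u + 1) ^ n\<close>; both are in lowest terms.\<close>

lemma gauss_eq_imp_power:
  assumes "even u" "gauss_eq u n m A B" "coprime (int m) A"
  shows "m = (u * u + 1) ^ n"
proof -
  let ?p = "int ((u * u + 1) ^ n)" and ?x = "fst (gauss_pow (int u) n)"
  from assms(2) have eq: "int m * ?x = A * ?p" by (simp add: gauss_eq_iff)
  have "int m dvd ?p" using assms(3) eq by (metis coprime_dvd_mult_right_iff dvd_triv_left)
  moreover have "coprime ?x ?p"
    using gauss_pow_coprime[of "int u" n] assms(1) by (simp add: power2_eq_square add.commute)
  then have "?p dvd int m" using eq by (metis coprime_commute coprime_dvd_mult_left_iff dvd_triv_right)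
  ultimately have "int m = ?p" by (simp add: zdvd_antisym_nonneg)
  then show ?thesis by linarith
qed

lemma power_imp_gauss_eq:
  assumes "even u" "m = (u * u + 1) ^ n"
  obtains A B where "gauss_eq u n m A B" "coprime (int m) A"
proof
  show "gauss_eq u n m (fst (gauss_pow (int u) n)) (snd (gauss_pow (int u) n))"
    unfolding gauss_eq_iff assms(2) by simp
  show "coprime (int m) (fst (gauss_pow (int u) n))"
    using gauss_pow_coprime[of "int u" n] assms
    by (simp add: power2_eq_square add.commute coprime_commute)
qed

text \<open>A Bezout identity for \<open>m\<close> and \<open>A^2\<close>, spelled out for
  \<open>A = a1 - a2\<close> without subtraction; squaring makes the sign of \<open>A\<close>
  harmless.\<close>

lemma coprime_certificate:
  fixes m a1 a2 :: nat
  assumes "A = int a1 - int a2" "(a1 * a1 + a2 * a2) * d = 2 * a1 * a2 * d + m * c + 1"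
  shows "coprime (int m) A"
proof -
  have "A * (A * int d) = int m * int c + 1"
    using arg_cong[OF assms(2), of int] unfolding assms(1) by (simp add: algebra_simps)
  then show ?thesis by (intro coprimeI) (metis dvd_add_right_iff dvd_mult2 zdvd1_eq dvd_mult)
qed

lemma coprime_certificate_ex:
  assumes "coprime (int m) A" "A \<noteq> 0"
  shows "\<exists>c d. (nat A * nat A + nat (- A) * nat (- A)) * d = 2 * nat A * nat (- A) * d + m * c + 1"
proof -
  let ?A = "nat \<bar>A\<bar>"
  have "coprime m ?A" using assms(1) by (simp add: coprime_int_iff[symmetric] coprime_commute)
  then have "gcd (?A * ?A) m = 1" by (simp add: coprime_commute)
  moreover obtain d c where "(?A * ?A) * d = m * c + gcd (?A * ?A) m"
    using bezout_nat[of "?A * ?A" m] assms(2) by auto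
  moreover have "nat A * nat A + nat (- A) * nat (- A) = ?A * ?A" "nat A * nat (- A) = 0"
    by (auto simp: abs_if)
  moreover have "2 * nat A * nat (- A) * d = 0" by auto
  ultimately have "(nat A * nat A + nat (- A) * nat (- A)) * d = 2 * nat A * nat (- A) * d + m * c + 1"
    by presburger
  then show ?thesis by blast
qed

section \<open>Definability by constraints\<close>

text \<open>
  In its strong reading the constraint \<open>CRot\<close> states an exponential equation; in its weak reading the
  equation is guaranteed only if the last variable bounds the power that occurs in it. The
  translation to the language of the reals yields something between the two readings.
\<close>

datatype 'v con =
    COne 'v
  | CAdd 'v 'v 'v
  | CMul 'v 'v 'v
  | CRot 'v 'v 'v 'v 'v 'v 'v 'v

primrec sat :: "bool \<Rightarrow> ('v \<Rightarrow> nat) \<Rightarrow> 'v con \<Rightarrow> bool" where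
  "sat strong v (COne i) \<longleftrightarrow> v i = 1"
| "sat strong v (CAdd i j k) \<longleftrightarrow> v i + v j = v k"
| "sat strong v (CMul i j k) \<longleftrightarrow> v i * v j = v k"
| "sat strong v (CRot u n m a a' b b' y) \<longleftrightarrow> (strong \<or> (v u * v u + 1) ^ v n \<le> v y \<longrightarrow>
     gauss_eq (v u) (v n) (v m) (int (v a) - int (v a')) (int (v b) - int (v b')))"

lemma sat_map_con: "sat strong v (map_con f c) \<longleftrightarrow> sat strong (\<lambda>i. v (f i)) c"
  by (cases c) simp_all

definition sats :: "bool \<Rightarrow> 'v con list \<Rightarrow> ('v \<Rightarrow> nat) \<Rightarrow> bool" where
  "sats strong cs v \<longleftrightarrow> (\<forall>c\<in>set cs. sat strong v c)"

lemma sats_append: "sats strong (cs @ ds) v \<longleftrightarrow> sats strong cs v \<and> sats strong ds v"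
  by (auto simp: sats_def)

lemma sats_map: "sats strong (map (map_con f) cs) v \<longleftrightarrow> sats strong cs (\<lambda>i. v (f i))"
  by (simp add: sats_def sat_map_con)

text \<open>Left variables are the given ones, right variables are quantified existentially. If
  \<open>P\<close> and \<open>Q\<close> coincide, every reading of the constraints between weak and
  strong defines \<open>P\<close>.\<close>

definition realizes :: "(nat + nat) con list \<Rightarrow> (store \<Rightarrow> bool) \<Rightarrow> (store \<Rightarrow> bool) \<Rightarrow> bool" where
  "realizes cs P Q \<longleftrightarrow> (\<forall>v. P v \<longrightarrow> (\<exists>w. sats True cs (case_sum v w))) \<and>
    (\<forall>v w. sats False cs (case_sum v w) \<longrightarrow> Q v)"

lemma realizesI:
  assumes "\<And>v. P v \<Longrightarrow> \<exists>w. sats True cs (case_sum v w)"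
    "\<And>v w. sats False cs (case_sum v w) \<Longrightarrow> Q v"
  shows "realizes cs P Q"
  unfolding realizes_def using assms by simp

lemma realizesD1: "realizes cs P Q \<Longrightarrow> P v \<Longrightarrow> \<exists>w. sats True cs (case_sum v w)"
  by (simp add: realizes_def)

lemma realizesD2: "realizes cs P Q \<Longrightarrow> sats False cs (case_sum v w) \<Longrightarrow> Q v"
  unfolding realizes_def by blast

definition dfn2 :: "(store \<Rightarrow> bool) \<Rightarrow> (store \<Rightarrow> bool) \<Rightarrow> bool" where
  "dfn2 P Q \<longleftrightarrow> (\<exists>cs. realizes cs P Q)"

abbreviation dfn :: "(store \<Rightarrow> bool) \<Rightarrow> bool" where "dfn P \<equiv> dfn2 P P"

section \<open>Closure properties of definability\<close>

lemma dfn2_mono: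
  assumes "dfn2 P Q" "\<And>v. P' v \<Longrightarrow> P v" "\<And>v. Q v \<Longrightarrow> Q' v"
  shows "dfn2 P' Q'"
proof -
  obtain cs where cs: "realizes cs P Q" using assms(1) unfolding dfn2_def by (elim exE)
  have "realizes cs P' Q'"
    by (rule realizesI) (blast intro: realizesD1[OF cs] assms(2), blast intro: realizesD2[OF cs] assms(3))
  then show ?thesis unfolding dfn2_def by (intro exI)
qed

lemma dfn2_conj:
  assumes "dfn2 P Q" "dfn2 P' Q'"
  shows "dfn2 (\<lambda>v. P v \<and> P' v) (\<lambda>v. Q v \<and> Q' v)"
proof -
  obtain cs ds where cs: "realizes cs P Q" and ds: "realizes ds P' Q'"
    using assms unfolding dfn2_def by (elim exE)
  \<comment> \<open>Even and odd indices keep the auxiliary variables of the two systems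
    apart.\<close>
  let ?f = "case_sum Inl (\<lambda>i. Inr (2 * i))" and ?g = "case_sum Inl (\<lambda>i. Inr (2 * i + 1))"
  have f: "(\<lambda>i. case_sum v w (?f i)) = case_sum v (\<lambda>i. w (2 * i))" for v w :: store
    by (auto simp: fun_eq_iff split: sum.split)
  have g: "(\<lambda>i. case_sum v w (?g i)) = case_sum v (\<lambda>i. w (2 * i + 1))" for v w :: store
    by (auto simp: fun_eq_iff split: sum.split)
  have "realizes (map (map_con ?f) cs @ map (map_con ?g) ds) (\<lambda>v. P v \<and> P' v) (\<lambda>v. Q v \<and> Q' v)"
  proof (rule realizesI)
    fix v assume PP: "P v \<and> P' v"
    obtain w1 where w1: "sats True cs (case_sum v w1)" using realizesD1[OF cs] PP by (elim conjE) blast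
    obtain w2 where w2: "sats True ds (case_sum v w2)" using realizesD1[OF ds] PP by (elim conjE) blast
    define w where "w i = (if even i then w1 (i div 2) else w2 (i div 2))" for i
    have "(\<lambda>i. w (2 * i)) = w1" "(\<lambda>i. w (2 * i + 1)) = w2" by (auto simp: w_def)
    then have "sats True (map (map_con ?f) cs @ map (map_con ?g) ds) (case_sum v w)"
      using w1 w2 unfolding sats_append sats_map f g by simp
    then show "\<exists>w. sats True (map (map_con ?f) cs @ map (map_con ?g) ds) (case_sum v w)" by (intro exI)
  next
    fix v w assume "sats False (map (map_con ?f) cs @ map (map_con ?g) ds) (case_sum v w)"
    then show "Q v \<and> Q' v"
      unfolding sats_append sats_map f g by (blast intro: realizesD2[OF cs] realizesD2[OF ds])
  qed
  then show ?thesis unfolding dfn2_def by (intro exI)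
qed

lemma dfn2_rename:
  assumes "dfn2 P Q"
  shows "dfn2 (\<lambda>v. P (\<lambda>i. v (f i))) (\<lambda>v. Q (\<lambda>i. v (f i)))"
proof -
  obtain cs where cs: "realizes cs P Q" using assms unfolding dfn2_def by (elim exE)
  let ?f = "case_sum (\<lambda>i. Inl (f i)) Inr"
  have f: "(\<lambda>i. case_sum v w (?f i)) = case_sum (\<lambda>i. v (f i)) w" for v w :: store
    by (auto simp: fun_eq_iff split: sum.split)
  have "realizes (map (map_con ?f) cs) (\<lambda>v. P (\<lambda>i. v (f i))) (\<lambda>v. Q (\<lambda>i. v (f i)))"
    by (rule realizesI) (simp_all add: sats_map f realizesD1[OF cs] realizesD2[OF cs])
  then show ?thesis unfolding dfn2_def by (intro exI)
qed

text \<open>A whole store is quantified at once, as needed for the families of numbers in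
  \<open>arith\<close>; it is interleaved with the given variables by parity.\<close>

lemma dfn2_exf:
  assumes "dfn2 (\<lambda>v. P (\<lambda>i. v (2 * i)) (\<lambda>i. v (2 * i + 1))) (\<lambda>v. Q (\<lambda>i. v (2 * i)) (\<lambda>i. v (2 * i + 1)))"
  shows "dfn2 (\<lambda>v. \<exists>w. P w v) (\<lambda>v. \<exists>w. Q w v)"
proof -
  obtain cs where cs: "realizes cs (\<lambda>v. P (\<lambda>i. v (2 * i)) (\<lambda>i. v (2 * i + 1)))
      (\<lambda>v. Q (\<lambda>i. v (2 * i)) (\<lambda>i. v (2 * i + 1)))"
    using assms unfolding dfn2_def by (elim exE)
  let ?f = "case_sum (\<lambda>i. if even i then Inr i else Inl (i div 2)) (\<lambda>i. Inr (2 * i + 1))"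
  have f: "(\<lambda>i. case_sum v w (?f i)) = case_sum (\<lambda>i. if even i then w i else v (i div 2)) (\<lambda>i. w (2 * i + 1))"
    for v w :: store
    by (auto simp: fun_eq_iff split: sum.split)
  have "realizes (map (map_con ?f) cs) (\<lambda>v. \<exists>w. P w v) (\<lambda>v. \<exists>w. Q w v)"
  proof (rule realizesI)
    fix v assume "\<exists>w. P w v"
    then obtain w where w: "P w v" by (elim exE)
    define u where "u i = (if even i then w (i div 2) else v (i div 2))" for i
    have "(\<lambda>i. u (2 * i)) = w" "(\<lambda>i. u (2 * i + 1)) = v" by (auto simp: u_def)
    with w have "P (\<lambda>i. u (2 * i)) (\<lambda>i. u (2 * i + 1))" by (simp only:)
    from realizesD1[OF cs, OF this] obtain w' where w': "sats True cs (case_sum u w')" by (elim exE)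
    define z where "z i = (if even i then w (i div 2) else w' (i div 2))" for i
    have "(\<lambda>i. if even i then z i else v (i div 2)) = u" "(\<lambda>i. z (2 * i + 1)) = w'"
      by (auto simp: z_def u_def)
    then have "sats True (map (map_con ?f) cs) (case_sum v z)"
      unfolding sats_map f using w' by (simp only:)
    then show "\<exists>w. sats True (map (map_con ?f) cs) (case_sum v w)" by (intro exI)
  next
    fix v w assume "sats False (map (map_con ?f) cs) (case_sum v w)"
    then have "Q (\<lambda>i. w (2 * i)) v"
      unfolding sats_map f using realizesD2[OF cs] by fastforce
    then show "\<exists>w. Q w v" by (intro exI)
  qed
  then show ?thesis unfolding dfn2_def by (intro exI)
qed

lemma dfn2_ex:
  assumes "dfn2 (\<lambda>v. P (v 0) (\<lambda>i. v (Suc i))) (\<lambda>v. Q (v 0) (\<lambda>i. v (Suc i)))"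
  shows "dfn2 (\<lambda>v. \<exists>y. P y v) (\<lambda>v. \<exists>y. Q y v)"
proof -
  have "dfn2 (\<lambda>v. P (v 0) (\<lambda>i. v (2 * i + 1))) (\<lambda>v. Q (v 0) (\<lambda>i. v (2 * i + 1)))"
    using dfn2_rename[OF assms, of "case_nat 0 (\<lambda>i. 2 * i + 1)"] by simp
  then have d: "dfn2 (\<lambda>v. \<exists>w::store. P (w 0) v) (\<lambda>v. \<exists>w::store. Q (w 0) v)"
    using dfn2_exf[of "\<lambda>w v. P (w 0) v" "\<lambda>w v. Q (w 0) v"] by simp
  show ?thesis
  proof (rule dfn2_mono[OF d])
    fix v assume "\<exists>y. P y v"
    then obtain y where "P ((\<lambda>_::nat. y) 0) v" by auto
    then show "\<exists>w::store. P (w 0) v" by (rule exI[of "\<lambda>w::store. P (w 0) v" "\<lambda>_. y"])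
  qed auto
qed

definition dfun :: "(store \<Rightarrow> nat) \<Rightarrow> bool" where
  "dfun t \<longleftrightarrow> dfn (\<lambda>v. v 0 = t (\<lambda>i. v (Suc i)))"

named_theorems dfn_intros

lemma dfn_conj [dfn_intros]: "dfn P \<Longrightarrow> dfn Q \<Longrightarrow> dfn (\<lambda>v. P v \<and> Q v)"
  by (rule dfn2_conj)

lemma dfn_ex [dfn_intros]: "dfn (\<lambda>v. P (v 0) (\<lambda>i. v (Suc i))) \<Longrightarrow> dfn (\<lambda>v. \<exists>y. P y v)"
  by (rule dfn2_ex)

lemma dfn_exf: "dfn (\<lambda>v. P (\<lambda>i. v (2 * i)) (\<lambda>i. v (2 * i + 1))) \<Longrightarrow> dfn (\<lambda>v. \<exists>w. P w v)"
  by (rule dfn2_exf)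

lemma dfn_rename: "dfn P \<Longrightarrow> dfn (\<lambda>v. P (\<lambda>i. v (f i)))"
  by (rule dfn2_rename)

lemma dfn_iff: "dfn P \<Longrightarrow> (\<And>v. P v \<longleftrightarrow> Q v) \<Longrightarrow> dfn Q"
  by (erule dfn2_mono) auto

lemma dfn_app2:
  assumes "dfn (\<lambda>v. R (v 0) (v 1))" "dfun s" "dfun t"
  shows "dfn (\<lambda>v. R (s v) (t v))"
proof -
  have "dfn (\<lambda>v. \<exists>y z. z = t v \<and> y = s v \<and> R y z)"
  proof (intro dfn_ex dfn_conj)
    show "dfn (\<lambda>v. v 0 = t (\<lambda>i. v (Suc (Suc i))))"
      using dfn_rename[OF assms(3)[unfolded dfun_def], of "case_nat 0 (\<lambda>i. Suc (Suc i))"] by simp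
    show "dfn (\<lambda>v. v (Suc 0) = s (\<lambda>i. v (Suc (Suc i))))"
      using dfn_rename[OF assms(2)[unfolded dfun_def], of "case_nat 1 (\<lambda>i. Suc (Suc i))"] by simp
    show "dfn (\<lambda>v. R (v (Suc 0)) (v 0))"
      using dfn_rename[OF assms(1), of "\<lambda>i. 1 - i"] by simp
  qed
  then show ?thesis by simp
qed

lemma dfun_comp2:
  assumes "dfn (\<lambda>v. v 0 = F (v 1) (v 2))" "dfun s" "dfun t"
  shows "dfun (\<lambda>v. F (s v) (t v))"
  unfolding dfun_def
proof -
  have "dfn (\<lambda>v. \<exists>y z. z = t (\<lambda>i. v (Suc i)) \<and> y = s (\<lambda>i. v (Suc i)) \<and> v 0 = F y z)"
  proof (intro dfn_ex dfn_conj)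
    show "dfn (\<lambda>v. v 0 = t (\<lambda>i. v (Suc (Suc (Suc i)))))"
      using dfn_rename[OF assms(3)[unfolded dfun_def], of "case_nat 0 (\<lambda>i. Suc (Suc (Suc i)))"] by simp
    show "dfn (\<lambda>v. v (Suc 0) = s (\<lambda>i. v (Suc (Suc (Suc i)))))"
      using dfn_rename[OF assms(2)[unfolded dfun_def], of "case_nat 1 (\<lambda>i. Suc (Suc (Suc i)))"] by simp
    show "dfn (\<lambda>v. v (Suc (Suc 0)) = F (v (Suc 0)) (v 0))"
      using dfn_rename[OF assms(1), of "\<lambda>i. 2 - i"] by (simp add: numeral_2_eq_2)
  qed
  then show "dfn (\<lambda>v. v 0 = F (s (\<lambda>i. v (Suc i))) (t (\<lambda>i. v (Suc i))))" by simp
qed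

lemma dfn_con: "dfn2 (\<lambda>v. sat True v c) (\<lambda>v. sat False v c)"
  unfolding dfn2_def
proof
  have "(\<lambda>i. case_sum v w (Inl i)) = v" for v w :: store by simp
  then show "realizes [map_con Inl c] (\<lambda>v. sat True v c) (\<lambda>v. sat False v c)"
    by (intro realizesI) (simp_all add: sats_def sat_map_con)
qed

lemma dfn_var_eq: "dfn (\<lambda>v. v i = v j)"
proof -
  have "dfn (\<lambda>v. \<exists>y. y = 1 \<and> y * v i = v j)"
    using dfn_con[of "COne 0"] dfn_con[of "CMul 0 (Suc i) (Suc j)"]
    by (intro dfn_ex dfn_conj) simp_all
  then show ?thesis by simp
qed

lemma dfun_var [dfn_intros]: "dfun (\<lambda>v. v i)"
  unfolding dfun_def by (rule dfn_var_eq)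

lemma dfun_add [dfn_intros]: "dfun s \<Longrightarrow> dfun t \<Longrightarrow> dfun (\<lambda>v. s v + t v)"
  by (rule dfun_comp2) (use dfn_con[of "CAdd 1 2 0"] in \<open>simp add: eq_commute\<close>)

lemma dfun_mult [dfn_intros]: "dfun s \<Longrightarrow> dfun t \<Longrightarrow> dfun (\<lambda>v. s v * t v)"
  by (rule dfun_comp2) (use dfn_con[of "CMul 1 2 0"] in \<open>simp add: eq_commute\<close>)

lemma dfun_const [dfn_intros]: "dfun (\<lambda>v. c)"
proof (induction c)
  case 0
  show ?case using dfn_con[of "CAdd 0 0 0"] by (simp add: dfun_def)
next
  case (Suc c)
  have "dfun (\<lambda>v. 1)" using dfn_con[of "COne 0"] by (simp add: dfun_def)
  from dfun_add[OF this Suc] show ?case by simp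
qed

lemma dfn_eq [dfn_intros]: "dfun s \<Longrightarrow> dfun t \<Longrightarrow> dfn (\<lambda>v. s v = t v)"
  by (rule dfn_app2) (rule dfn_var_eq)

lemma dfn_less [dfn_intros]: "dfun s \<Longrightarrow> dfun t \<Longrightarrow> dfn (\<lambda>v. s v < t v)"
proof (rule dfn_app2)
  have "dfn (\<lambda>v. \<exists>d. v 0 + d + 1 = v 1)" by (intro dfn_intros)
  then show "dfn (\<lambda>v. v 0 < v 1)"
    by (rule dfn_iff) (metis add.assoc less_iff_Suc_add Suc_eq_plus1 add_Suc_right)
qed

lemma dfn_const [dfn_intros]: "dfn (\<lambda>v. b)"
proof (cases b)
  case True
  have "dfn (\<lambda>v. (0::nat) = 0)" by (intro dfn_eq dfun_const)
  with True show ?thesis by simp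
next
  case False
  have "dfn (\<lambda>v. (0::nat) = 1)" by (intro dfn_eq dfun_const)
  with False show ?thesis by simp
qed

lemma dfn_imp_const [dfn_intros]: "dfn P \<Longrightarrow> dfn (\<lambda>v. b \<longrightarrow> P v)"
  using dfn_const[of True] by (cases b) simp_all

lemma dfun_if_const [dfn_intros]: "dfun s \<Longrightarrow> dfun t \<Longrightarrow> dfun (\<lambda>v. if b then s v else t v)"
  by (cases b) simp_all

lemma dfn_all_less [dfn_intros]: "(\<And>j::nat. dfn (P j)) \<Longrightarrow> dfn (\<lambda>v. \<forall>j<N. P j v)"
proof (induction N)
  case 0
  show ?case using dfn_const[of True] by simp
next
  case (Suc N)
  have "dfn (\<lambda>v. P N v \<and> (\<forall>j<N. P j v))" by (intro dfn_conj Suc)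
  then show ?case by (rule dfn_iff) (auto simp: less_Suc_eq)
qed

lemma dfun_sum [dfn_intros]: "(\<And>j::nat. dfun (t j)) \<Longrightarrow> dfun (\<lambda>v. \<Sum>j<N. t j v)"
proof (induction N)
  case 0
  show ?case using dfun_const[of 0] by simp
next
  case (Suc N)
  have "dfun (\<lambda>v. (\<Sum>j<N. t j v) + t N v)" by (intro dfun_add Suc)
  then show ?case by simp
qed

text \<open>The base is \<open>u * u + 1\<close> with \<open>u = 2 * v 1 + 2\<close>, so
  \<open>u\<close> is even, as \<open>gauss_eq_imp_power\<close> requires, and positive. The Pell
  part forces \<open>w 3\<close> above the power, which makes the weak reading of
  \<open>CRot\<close> usable.\<close>

lemma dfn_even_power: "dfn (\<lambda>v. v 0 = ((2 * v 1 + 2) * (2 * v 1 + 2) + 1) ^ v 2)"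
proof -
  \<comment> \<open>\<open>w 0\<close> is \<open>u\<close>; \<open>w 1\<close> to \<open>w 4\<close>
    form the Pell certificate; \<open>w 5\<close> to \<open>w 8\<close> certify that
    \<open>v 0\<close> is coprime to \<open>A = w 5 - w 6\<close>; \<open>w 9 - w 10\<close> will be
    \<open>B\<close>.\<close>
  define S where "S w v \<longleftrightarrow> w 0 = 2 * v 1 + 2 \<and> w 1 = w 0 * w 0 + v 2 + 2 \<and>
      w 2 * w 2 + w 3 * w 3 = (w 1 + 1) * (w 1 + 1) * (w 3 * w 3) + 1 \<and> w 3 = v 2 + 1 + w 4 * w 1 \<and>
      (w 5 * w 5 + w 6 * w 6) * w 7 = 2 * w 5 * w 6 * w 7 + v 0 * w 8 + 1" for w v :: store
  define I where "I strong w v \<longleftrightarrow> S w v \<and>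
      (strong \<or> (w 0 * w 0 + 1) ^ v 2 \<le> w 3 \<longrightarrow>
        gauss_eq (w 0) (v 2) (v 0) (int (w 5) - int (w 6)) (int (w 9) - int (w 10)))"
    for strong and w v :: store
  \<comment> \<open>Even indices refer to \<open>w\<close> and odd ones to \<open>v\<close>, the
    layout of \<open>dfn2_exf\<close>.\<close>
  have rot: "dfn2 (\<lambda>v. sat True v (CRot (2 * 0) (2 * 2 + 1) (2 * 0 + 1) (2 * 5) (2 * 6) (2 * 9) (2 * 10) (2 * 3)))
    (\<lambda>v. sat False v (CRot (2 * 0) (2 * 2 + 1) (2 * 0 + 1) (2 * 5) (2 * 6) (2 * 9) (2 * 10) (2 * 3)))"
    by (rule dfn_con)
  have S: "dfn (\<lambda>v. S (\<lambda>i. v (2 * i)) (\<lambda>i. v (2 * i + 1)))"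
    unfolding S_def by (intro dfn_intros)
  from dfn2_conj[OF S rot] have "dfn2 (\<lambda>v. I True (\<lambda>i. v (2 * i)) (\<lambda>i. v (2 * i + 1)))
      (\<lambda>v. I False (\<lambda>i. v (2 * i)) (\<lambda>i. v (2 * i + 1)))"
    by (simp only: I_def sat.simps)
  from dfn2_exf[of "I True" "I False", OF this]
  have "dfn2 (\<lambda>v. \<exists>w. I True w v) (\<lambda>v. \<exists>w. I False w v)" .
  then show ?thesis
  proof (rule dfn2_mono)
    fix v :: store
    let ?u = "2 * v 1 + 2"
    assume m: "v 0 = (?u * ?u + 1) ^ v 2"
    let ?b = "?u * ?u + v 2 + 2"
    have "Suc (v 2) < ?b" by simp
    from pell_certificate_ex[OF this] obtain x y k where pell: "x * x + y * y = (?b + 1) * (?b + 1) * (y * y) + 1" "y = v 2 + 1 + k * ?b"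
      by (elim exE conjE)
    obtain A B where AB: "gauss_eq ?u (v 2) (v 0) A B" "coprime (int (v 0)) A"
      by (rule power_imp_gauss_eq[OF _ m]) auto
    \<comment> \<open>For \<open>A = 0\<close> coprimality gives \<open>v 0 = 1\<close>, so the
      exponent is 0 because the base exceeds 1; but then \<open>A\<close> would be 1.\<close>
    have "A \<noteq> 0"
    proof
      assume "A = 0"
      then have "v 0 = 1" using AB(2) by simp
      then have "v 2 = 0" using m by auto
      then show False using AB(1) \<open>A = 0\<close> \<open>v 0 = 1\<close> by (simp add: gauss_eq_iff)
    qed
    from coprime_certificate_ex[OF AB(2) this] obtain c d where
      cd: "(nat A * nat A + nat (- A) * nat (- A)) * d = 2 * nat A * nat (- A) * d + v 0 * c + 1" by (elim exE)
    have signs: "int (nat A) - int (nat (- A)) = A" "int (nat B) - int (nat (- B)) = B" by auto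
    define w where "w = nth [?u, ?b, x, y, k, nat A, nat (- A), d, c, nat B, nat (- B)]"
    have w: "w 0 = ?u" "w 1 = ?b" "w 2 = x" "w 3 = y" "w 4 = k" "w 5 = nat A" "w 6 = nat (- A)" "w 7 = d"
      "w 8 = c" "w 9 = nat B" "w 10 = nat (- B)"
      by (simp_all add: w_def numeral_nat)
    have "I True w v" unfolding I_def S_def w signs using pell cd AB(1) by (intro conjI refl impI)
    then show "\<exists>w. I True w v" by (intro exI)
  next
    fix v assume "\<exists>w. I False w v"
    then obtain w where I: "I False w v" by (elim exE)
    note W = I[unfolded I_def S_def, THEN conjunct1]
    note w = W[THEN conjunct1] W[THEN conjunct2, THEN conjunct1]
      W[THEN conjunct2, THEN conjunct2, THEN conjunct1]
      W[THEN conjunct2, THEN conjunct2, THEN conjunct2, THEN conjunct1]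
      W[THEN conjunct2, THEN conjunct2, THEN conjunct2, THEN conjunct2]
    have g: "gauss_eq (w 0) (v 2) (v 0) (int (w 5) - int (w 6)) (int (w 9) - int (w 10))"
      if "(w 0 * w 0 + 1) ^ v 2 \<le> w 3"
      using I[unfolded I_def, THEN conjunct2] that by (simp only: simp_thms)
    have "Suc (v 2) < w 1" unfolding w(2) by simp
    from pell_certificate[OF this w(3,4)] have "(w 1 + 1) ^ v 2 \<le> w 3" .
    \<comment> \<open>\<open>w 1\<close> was chosen above \<open>u * u\<close>, so the Pell bound
      covers the power that \<open>CRot\<close> speaks of.\<close>
    moreover have "(w 0 * w 0 + 1) ^ v 2 \<le> (w 1 + 1) ^ v 2" unfolding w(2) by (intro power_mono) auto
    ultimately have "gauss_eq (w 0) (v 2) (v 0) (int (w 5) - int (w 6)) (int (w 9) - int (w 10))"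
      by (intro g) (rule order_trans)
    moreover have "even (w 0)" unfolding w(1) by simp
    ultimately have "v 0 = (w 0 * w 0 + 1) ^ v 2" using coprime_certificate[OF refl w(5)] by (intro gauss_eq_imp_power)
    then show "v 0 = ((2 * v 1 + 2) * (2 * v 1 + 2) + 1) ^ v 2" unfolding w(1) .
  qed
qed

lemma dfun_even_power:
  "dfun s \<Longrightarrow> dfun t \<Longrightarrow> dfun (\<lambda>v. ((2 * s v + 2) * (2 * s v + 2) + 1) ^ t v)"
  by (rule dfun_comp2[OF dfn_even_power])

text \<open>An arbitrary power is the residue of a power of \<open>u\<^sup>2 + 1\<close> modulo \<open>u\<^sup>2 + 1 - x\<close>.\<close>

lemma power_iff_residue:
  fixes x n m :: nat
  defines "P \<equiv> 5 ^ ((n + 1) * (x + 1))"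
  defines "M \<equiv> (2 * P + 2) * (2 * P + 2) + 1"
  shows "m = x ^ n \<longleftrightarrow> (\<exists>q. M ^ n + q * x = q * M + m \<and> m + x < M)"
proof -
  \<comment> \<open>\<open>P\<close> has to dominate \<open>x\<close> and \<open>x ^ n\<close>; its
    base 5 is \<open>2 * 2 + 1\<close>, the smallest of the bases whose powers are already
    definable.\<close>
  have "x < 2 ^ x" by (rule less_exp)
  also have "(2::nat) ^ x \<le> 5 ^ x" by (rule power_mono) auto
  also have "(5::nat) ^ x \<le> 5 ^ (x + 1)" by (rule power_increasing) auto
  finally have x5: "x < 5 ^ (x + 1)" .
  have "(5::nat) ^ (x + 1) \<le> P" unfolding P_def by (intro power_increasing) auto
  with x5 have x: "x < P" by (rule less_le_trans)
  have "x ^ n \<le> (5 ^ (x + 1)) ^ n" using x5 by (intro power_mono) auto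
  also have "\<dots> = 5 ^ (n * (x + 1))" by (simp only: power_mult[symmetric] mult.commute)
  also have "\<dots> \<le> P" unfolding P_def by (intro power_increasing) auto
  finally have xn: "x ^ n \<le> P" .
  have "P + P < M" by (simp add: M_def)
  then have small: "x ^ n + x < M" using x xn by linarith
  define K where "K = int M - int x"
  have "int (x ^ n) + int x < int M" using small by linarith
  then have K: "int (x ^ n) < K" "0 < K" unfolding K_def by linarith+
  \<comment> \<open>\<open>M\<close> is congruent to \<open>x\<close> modulo \<open>M - x\<close>,
    so \<open>M ^ n\<close> has the residue \<open>x ^ n\<close>, which is smaller than the
    modulus.\<close>
  have "K dvd int M ^ n - int x ^ n" unfolding K_def by (rule power_diff_sumr2[THEN dvdI])
  then obtain q where q: "int M ^ n - int x ^ n = K * q" by (auto simp: dvd_def)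
  show ?thesis
  proof
    assume m: "m = x ^ n"
    have "x ^ n \<le> M ^ n" using x \<open>P + P < M\<close> by (intro power_mono) auto
    then have "int (x ^ n) \<le> int (M ^ n)" by linarith
    then have "0 \<le> K * q" using q by simp
    then have "0 \<le> q" using K by (simp add: zero_le_mult_iff)
    have "int (M ^ n + nat q * x) = int (nat q * M + m)"
      using q \<open>0 \<le> q\<close> by (simp add: m K_def algebra_simps)
    then have "M ^ n + nat q * x = nat q * M + m" by linarith
    then show "\<exists>q. M ^ n + q * x = q * M + m \<and> m + x < M" using small m by blast
  next
    assume "\<exists>q. M ^ n + q * x = q * M + m \<and> m + x < M"
    then obtain q' where q': "M ^ n + q' * x = q' * M + m" "m + x < M" by blast
    have "int M ^ n - int m = K * int q'"
      using arg_cong[OF q'(1), of int] by (simp add: K_def algebra_simps)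
    then have "int x ^ n - int m = K * (int q' - q)" using q by (simp add: algebra_simps)
    then have "K dvd int (x ^ n) - int m" by (simp add: dvd_def)
    then have "int (x ^ n) mod K = int m mod K" by (simp add: mod_eq_dvd_iff)
    moreover have "int m < K" using q'(2) by (simp add: K_def)
    ultimately have "int (x ^ n) = int m" using K by simp
    then show "m = x ^ n" by linarith
  qed
qed

lemma dfun_power [dfn_intros]:
  assumes "dfun s" "dfun t"
  shows "dfun (\<lambda>v. s v ^ t v)"
proof (rule dfun_comp2[OF _ assms])
  have "dfn (\<lambda>v. \<exists>P q. P = ((2 * 0 + 2) * (2 * 0 + 2) + 1) ^ ((v 2 + 1) * (v 1 + 1)) \<and>
    ((2 * P + 2) * (2 * P + 2) + 1) ^ v 2 + q * v 1 = q * ((2 * P + 2) * (2 * P + 2) + 1) + v 0 \<and>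
    v 0 + v 1 < (2 * P + 2) * (2 * P + 2) + 1)"
    by (intro dfn_ex dfn_conj dfn_eq dfn_less dfun_even_power dfun_add dfun_mult dfun_var dfun_const)
  then show "dfn (\<lambda>v. v 0 = v 1 ^ v 2)"
  proof (rule dfn_iff)
    fix v :: store
    have five: "(2 * 0 + 2) * (2 * 0 + 2) + 1 = (5::nat)" by simp
    show "(\<exists>P q. P = ((2 * 0 + 2) * (2 * 0 + 2) + 1) ^ ((v 2 + 1) * (v 1 + 1)) \<and>
      ((2 * P + 2) * (2 * P + 2) + 1) ^ v 2 + q * v 1 = q * ((2 * P + 2) * (2 * P + 2) + 1) + v 0 \<and>
      v 0 + v 1 < (2 * P + 2) * (2 * P + 2) + 1) \<longleftrightarrow> v 0 = v 1 ^ v 2"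
      unfolding five power_iff_residue[of "v 0" "v 1" "v 2"] by blast
  qed
qed

section \<open>Definability of bitwise comparison\<close>

lemma vec_less: "(\<And>t. t < T \<Longrightarrow> d t < Q) \<Longrightarrow> vec Q d T < Q ^ T"
proof (induction T)
  case (Suc T)
  have "vec Q d (Suc T) = vec Q d T + d T * Q ^ T" by (simp add: vec_def)
  also have "\<dots> < Q ^ T + d T * Q ^ T" using Suc by simp
  also have "\<dots> = Suc (d T) * Q ^ T" by simp
  also have "\<dots> \<le> Q * Q ^ T" using Suc.prems[of T] by (intro mult_right_mono) auto
  finally show ?case by simp
qed simp

lemma vec_digit:
  assumes "\<And>t. d t < Q"
  shows "(vec Q d (a + S) div Q ^ a) mod Q = (if S = 0 then 0 else d a)"
proof -
  have "vec Q d (a + S) = vec Q d a + Q ^ a * vec Q (\<lambda>t. d (a + t)) S"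
    unfolding vec_def sum_distrib_left
    by (induction S) (simp_all add: power_add mult_ac)
  moreover have "Q > 0" using assms[of 0] by simp
  moreover have "vec Q d a < Q ^ a" using assms by (intro vec_less)
  ultimately have "vec Q d (a + S) div Q ^ a = vec Q (\<lambda>t. d (a + t)) S" by simp
  then show ?thesis using assms by (cases S) (simp_all add: vec_Suc)
qed

lemma digit_iff:
  fixes N c W a :: nat
  assumes "0 < W"
  shows "c = (N div W ^ a) mod W \<longleftrightarrow> (\<exists>q r. N = q * W ^ (a + 1) + c * W ^ a + r \<and> c < W \<and> r < W ^ a)"
proof
  assume c: "c = (N div W ^ a) mod W"
  have "N = (N div W ^ a) * W ^ a + N mod W ^ a" by (rule div_mult_mod_eq[symmetric])
  moreover have "N div W ^ a = (N div W ^ a) div W * W + c" unfolding c by (rule div_mult_mod_eq[symmetric])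
  ultimately have "N = ((N div W ^ a) div W * W + c) * W ^ a + N mod W ^ a" by metis
  then have "N = (N div W ^ a) div W * W ^ (a + 1) + c * W ^ a + N mod W ^ a" by (simp add: algebra_simps)
  moreover have "c < W" "N mod W ^ a < W ^ a" using c assms by simp_all
  ultimately show "\<exists>q r. N = q * W ^ (a + 1) + c * W ^ a + r \<and> c < W \<and> r < W ^ a" by blast
next
  assume "\<exists>q r. N = q * W ^ (a + 1) + c * W ^ a + r \<and> c < W \<and> r < W ^ a"
  then obtain q r where "N = r + W ^ a * (q * W + c)" "c < W" "r < W ^ a"
    by (auto simp: algebra_simps)
  then show "c = (N div W ^ a) mod W" using assms by simp
qed

text \<open>By the binomial theorem the coefficients are the digits of \<open>(1 + W) ^ b\<close> in
  base \<open>W\<close>, since \<open>W = 2 ^ (b + 1)\<close> exceeds each of them.\<close>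

lemma masked_iff_digit:
  fixes a b :: nat
  defines "W \<equiv> (2::nat) ^ (b + 1)"
  shows "masked a b \<longleftrightarrow> odd (((1 + W) ^ b div W ^ a) mod W)"
proof -
  have digit: "b choose k < W" for k
  proof -
    have "b choose k \<le> 2 ^ b" by (rule binomial_le_pow2)
    also have "\<dots> < W" by (simp add: W_def)
    finally show ?thesis .
  qed
  have "(1 + W) ^ b = (\<Sum>k\<le>b. (b choose k) * W ^ k)" using binomial[of W 1 b] by simp
  \<comment> \<open>Padding with zero digits covers the case \<open>a > b\<close>.\<close>
  also have "\<dots> = (\<Sum>k<a + (b + 1). (b choose k) * W ^ k)"
    by (rule sum.mono_neutral_left) auto
  finally have "(1 + W) ^ b = vec W (\<lambda>k. b choose k) (a + (b + 1))" by (simp add: vec_def)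
  then have "((1 + W) ^ b div W ^ a) mod W = b choose a" using vec_digit[of "\<lambda>k. b choose k" W a "b + 1"] digit by simp
  then show ?thesis by (simp add: odd_choose_iff_masked)
qed

lemma odd_iff: "odd n \<longleftrightarrow> (\<exists>h. 2 * h + 1 = n)" for n :: nat
  by (auto elim: oddE)

lemma dfn_masked [dfn_intros]:
  assumes "dfun s" "dfun t"
  shows "dfn (\<lambda>v. masked (s v) (t v))"
proof (rule dfn_app2[OF _ assms])
  have "dfn (\<lambda>v. \<exists>W h q r. W = (2::nat) ^ (v 1 + 1) \<and>
    (1 + W) ^ v 1 = q * W ^ (v 0 + 1) + (2 * h + 1) * W ^ v 0 + r \<and> 2 * h + 1 < W \<and> r < W ^ v 0)"
    by (intro dfn_intros)
  then show "dfn (\<lambda>v. masked (v 0) (v 1))"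
  proof (rule dfn_iff)
    fix v :: store
    let ?W = "2 ^ (v 1 + 1) :: nat"
    have "masked (v 0) (v 1) \<longleftrightarrow> (\<exists>h. 2 * h + 1 = ((1 + ?W) ^ v 1 div ?W ^ v 0) mod ?W)"
      unfolding masked_iff_digit odd_iff ..
    also have "\<dots> \<longleftrightarrow> (\<exists>h q r. (1 + ?W) ^ v 1 = q * ?W ^ (v 0 + 1) + (2 * h + 1) * ?W ^ v 0 + r
        \<and> 2 * h + 1 < ?W \<and> r < ?W ^ v 0)"
      by (subst digit_iff) simp_all
    finally show "(\<exists>W h q r. W = (2::nat) ^ (v 1 + 1) \<and>
      (1 + W) ^ v 1 = q * W ^ (v 0 + 1) + (2 * h + 1) * W ^ v 0 + r \<and> 2 * h + 1 < W \<and> r < W ^ v 0)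
      \<longleftrightarrow> masked (v 0) (v 1)" by blast
  qed
qed

lemma dfn_arith:
  "dfn (\<lambda>v. \<exists>\<kappa> T H G P J E R Z F. arith es \<sigma> C m p q (v 0) \<kappa> T H G P J E R Z F)"
  unfolding arith_def
  by (intro dfn_intros dfn_exf)

lemma Sigma0_1_dfn:
  assumes "A \<in> Sigma0 1"
  shows "dfn (\<lambda>v. v 0 \<in> A)"
proof -
  obtain c where c: "\<And>x. x \<in> A \<longleftrightarrow> (\<exists>t. ((\<lambda>_. 0)(0 := x), t) \<in> exec c)"
    using Sigma0_1_counter_program[OF assms] by blast
  obtain es where es: "set es = edges c []" using finite_edges finite_list by blast
  let ?Q = "{[c], []} \<union> edge_src ` set es \<union> edge_tgt ` set es"
  have "finite ?Q" by simp
  then obtain \<sigma> :: "cmd list \<Rightarrow> nat" where \<sigma>: "inj_on \<sigma> ?Q"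
    using finite_imp_inj_to_nat_seg by metis
  \<comment> \<open>Bounds the number of edges and all state codes, as
    \<open>arith_imp_trace\<close> requires.\<close>
  define C where "C = length es + (\<Sum>q\<in>?Q. \<sigma> q)"
  have C: "\<sigma> q \<le> C" if "q \<in> ?Q" for q
    using member_le_sum[OF that, of \<sigma>] \<open>finite ?Q\<close> by (simp add: C_def)
  define regs where "regs e = (case edge_op e of Nop \<Rightarrow> 0 | IncOp r \<Rightarrow> r | DecOp r \<Rightarrow> r | TstOp r \<Rightarrow> r)"
    for e :: "cmd list edge"
  define m where "m = Suc (\<Sum>e\<in>set es. regs e)"
  have m: "r < m" if "e \<in> set es" "edge_op e \<in> {IncOp r, DecOp r, TstOp r}" for e r
  proof -
    have "regs e \<le> (\<Sum>e\<in>set es. regs e)" using that(1) by (intro member_le_sum) auto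
    then show ?thesis using that(2) by (auto simp: regs_def m_def)
  qed
  have "x \<in> A \<longleftrightarrow> (\<exists>\<kappa> T H G P J E R Z F. arith es \<sigma> C m [c] [] x \<kappa> T H G P J E R Z F)" (is "_ \<longleftrightarrow> ?ar") for x
  proof -
    have "x \<in> A \<longleftrightarrow> (\<exists>T e s. trace es [c] [] ((\<lambda>_. 0)(0 := x)) T e s)"
      unfolding c exec_iff_steps es[symmetric] steps_iff_trace ..
    also have "\<dots> \<longleftrightarrow> ?ar"
    proof
      assume "\<exists>T e s. trace es [c] [] ((\<lambda>_. 0)(0 := x)) T e s"
      then obtain T e s where "trace es [c] [] ((\<lambda>_. 0)(0 := x)) T e s" by (elim exE)
      from trace_imp_arith[OF this, of \<sigma> C m] show ?ar by blast
    next
      assume ?ar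
      then obtain \<kappa> T H G P J E R Z F where "arith es \<sigma> C m [c] [] x \<kappa> T H G P J E R Z F" by (elim exE)
      then have "\<exists>e s. trace es [c] [] ((\<lambda>_. 0)(0 := x)) T e s"
      proof (rule arith_imp_trace)
        show "length es \<le> C" by (simp add: C_def)
        show "\<sigma> (edge_src e) \<le> C \<and> \<sigma> (edge_tgt e) \<le> C" if "e \<in> set es" for e using C that by blast
        show "0 < m" by (simp add: m_def)
      qed (use C \<sigma> m in blast)+
      then show "\<exists>T e s. trace es [c] [] ((\<lambda>_. 0)(0 := x)) T e s" by blast
    qed
    finally show ?thesis .
  qed
  with dfn_arith[of es \<sigma> C m "[c]" "[]"] show ?thesis by (simp only:)
qed

section \<open>Rounding approximate solutions\<close>

text \<open>\<open>sin y\<close> differs from \<open>y\<close> by at most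
  \<open>\<bar>y\<bar> ^ 3 / 6\<close>, which is at most two thirds of \<open>\<bar>y\<bar>\<close>
  when \<open>\<bar>y\<bar> \<le> 2\<close>.\<close>

lemma abs_le_3_abs_sin:
  fixes y :: real
  assumes "\<bar>y\<bar> \<le> 2"
  shows "\<bar>y\<bar> \<le> 3 * \<bar>sin y\<bar>"
proof -
  have "(\<Sum>m<3. sin_coeff m * y ^ m) = y" by (simp add: numeral_3_eq_3 sin_coeff_def)
  moreover have "inverse (fact 3) = (1 / 6 :: real)" by (simp add: fact_numeral)
  ultimately have "\<bar>sin y - y\<bar> \<le> \<bar>y\<bar> ^ 3 / 6" using Maclaurin_sin_bound[of y 3]
    by (metis mult.commute mult_1 times_divide_eq_left)
  moreover have "\<bar>y\<bar> ^ 3 \<le> 4 * \<bar>y\<bar>"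
  proof -
    have "\<bar>y\<bar> * \<bar>y\<bar> \<le> 2 * 2" using assms by (intro mult_mono) auto
    then have "\<bar>y\<bar> * \<bar>y\<bar> * \<bar>y\<bar> \<le> 4 * \<bar>y\<bar>" by (intro mult_right_mono) auto
    then show ?thesis by (simp add: power3_eq_cube)
  qed
  ultimately show ?thesis by linarith
qed

text \<open>Both \<open>2 * h\<close> and pi lie between 2 and 4, so \<open>abs_le_3_abs_sin\<close>
  applies to their difference.\<close>

lemma pi_approximation:
  assumes "1 < h" "h < 2" "\<bar>sin (2 * h)\<bar> \<le> \<delta>"
  shows "\<bar>2 * h - pi\<bar> \<le> 3 * \<delta>"
proof -
  have "\<bar>2 * h - pi\<bar> \<le> 2" using assms(1,2) pi_ge_two pi_less_4 by linarith
  then have "\<bar>2 * h - pi\<bar> \<le> 3 * \<bar>sin (2 * h - pi)\<bar>" by (rule abs_le_3_abs_sin)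
  then show ?thesis using assms(3) by simp
qed

text \<open>Up to errors, \<open>sin (pi * v)\<close> measures the distance \<open>t\<close> of
  \<open>v\<close> from the nearest integer. The lower bound \<open>- 1 / 2\<close> keeps that
  integer from being negative.\<close>

lemma nat_approximation:
  assumes "\<bar>v\<bar> \<le> B" "1 \<le> B" "- 1 / 2 < v" "\<bar>\<pi> - pi\<bar> \<le> 3 * \<delta>" "\<bar>sin (\<pi> * v)\<bar> \<le> \<delta>" "6 * B * \<delta> < 1 / 2"
  shows "\<bar>v - real (nat (round v))\<bar> \<le> 6 * B * \<delta>"
proof -
  define k where "k = round v"
  define t where "t = v - of_int k"
  have t: "\<bar>t\<bar> \<le> 1 / 2" using of_int_round_abs_le[of v] by (simp add: t_def k_def abs_minus_commute)
  have "pi * v = pi * t + of_int k * pi" by (simp add: t_def algebra_simps)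
  moreover have sin0: "sin (of_int k * pi) = 0" by (simp add: sin_times_pi_eq_0)
  moreover have "\<bar>cos (of_int k * pi)\<bar> = 1" by (rule sin_zero_abs_cos_one[OF sin0])
  ultimately have "\<bar>sin (pi * v)\<bar> = \<bar>sin (pi * t)\<bar>" by (simp add: sin_add abs_mult)
  moreover have "\<bar>sin (pi * v) - sin (\<pi> * v)\<bar> \<le> \<bar>pi * v - \<pi> * v\<bar>" by (rule abs_sin_diff_le)
  moreover have "\<bar>pi * v - \<pi> * v\<bar> \<le> 3 * \<delta> * B"
  proof -
    have "\<bar>pi * v - \<pi> * v\<bar> = \<bar>\<pi> - pi\<bar> * \<bar>v\<bar>" by (simp add: abs_mult[symmetric] abs_minus_commute left_diff_distrib)
    also have "\<dots> \<le> 3 * \<delta> * B" using assms by (intro mult_mono) auto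
    finally show ?thesis .
  qed
  moreover have "0 \<le> \<delta>" using assms(5) by linarith
  then have "\<delta> \<le> \<delta> * B" using assms(2) by (simp add: mult_le_cancel_left1)
  \<comment> \<open>\<open>\<delta>\<close> is the given error, and \<open>3 * \<delta> * B\<close>
    comes from the replacement of \<open>\<pi>\<close> by pi. Below,
    \<open>2 * \<bar>t\<bar> \<le> 3 * 4 * \<delta> * B\<close> explains the factor 6.\<close>
  ultimately have "\<bar>sin (pi * t)\<bar> \<le> 4 * (\<delta> * B)" using assms(5) by linarith
  moreover have "\<bar>pi * t\<bar> \<le> 2"
  proof -
    have "pi * \<bar>t\<bar> \<le> 4 * (1 / 2)" using t pi_less_4 by (intro mult_mono) auto
    then show ?thesis by (simp add: abs_mult)
  qed
  then have "\<bar>pi * t\<bar> \<le> 3 * \<bar>sin (pi * t)\<bar>" by (rule abs_le_3_abs_sin)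
  moreover have "2 * \<bar>t\<bar> \<le> \<bar>pi * t\<bar>" using pi_ge_two by (simp add: abs_mult mult_right_mono)
  ultimately have *: "\<bar>t\<bar> \<le> 6 * B * \<delta>" by (simp add: algebra_simps)
  then have "of_int k > (-1 :: real)" using assms(3,6) by (simp add: t_def abs_le_iff)
  then have "k \<ge> 0" by linarith
  then show ?thesis using * by (simp add: t_def k_def)
qed

lemma prod_diff_le: "\<bar>x * y - x' * y'\<bar> \<le> \<bar>x - x'\<bar> * \<bar>y\<bar> + \<bar>x'\<bar> * \<bar>y - y'\<bar>" for x y x' y' :: real
proof -
  have "x * y - x' * y' = (x - x') * y + x' * (y - y')" by (simp add: algebra_simps)
  then show ?thesis by (metis abs_mult abs_triangle_ineq)
qed

lemma nat_eqI: "\<bar>real a - real b\<bar> < 1 \<Longrightarrow> a = b"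
  by linarith

lemma square_diff_le:
  fixes U u :: real
  assumes "\<bar>U - u\<bar> \<le> \<eta>" "\<bar>U\<bar> \<le> B" "\<bar>u\<bar> \<le> 2 * B"
  shows "\<bar>U * U - u * u\<bar> \<le> 3 * B * \<eta>"
proof -
  have "0 \<le> \<eta>" "0 \<le> B" using assms by linarith+
  have "\<bar>U * U - u * u\<bar> \<le> \<bar>U - u\<bar> * \<bar>U\<bar> + \<bar>u\<bar> * \<bar>U - u\<bar>" by (rule prod_diff_le)
  also have "\<dots> \<le> \<eta> * B + 2 * B * \<eta>"
    using assms \<open>0 \<le> \<eta>\<close> \<open>0 \<le> B\<close> by (intro add_mono mult_mono) auto
  finally show ?thesis by (simp add: algebra_simps)
qed

text \<open>The angle of \<open>(u + i)^2 / (u^2 + 1)\<close>, whose coordinates are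
  \<open>(u^2 - 1) / (u^2 + 1)\<close> and \<open>2 * u / (u^2 + 1)\<close>.\<close>

definition rotation :: "nat \<Rightarrow> real \<Rightarrow> bool" where
  "rotation u \<theta> \<longleftrightarrow> 0 \<le> \<theta> \<and> \<theta> \<le> pi \<and> sin \<theta> * (real u * real u + 1) = 2 * real u \<and>
    cos \<theta> * (real u * real u + 1) + 1 = real u * real u"

lemma rotation_ex: "\<exists>\<theta>. rotation u \<theta>"
proof -
  let ?p = "real u * real u + 1"
  let ?c = "(real u * real u - 1) / ?p" and ?s = "2 * real u / ?p"
  have p: "?p > 0" by (simp add: add_nonneg_pos)
  have "?c\<^sup>2 + ?s\<^sup>2 = ((real u * real u - 1)\<^sup>2 + (2 * real u)\<^sup>2) / ?p\<^sup>2"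
    by (simp only: power_divide add_divide_distrib)
  also have "(real u * real u - 1)\<^sup>2 + (2 * real u)\<^sup>2 = ?p\<^sup>2" by (simp add: power2_eq_square algebra_simps)
  finally have "?c\<^sup>2 + ?s\<^sup>2 = 1" using p by simp
  moreover have "0 \<le> ?s" using p by simp
  ultimately obtain \<theta> where "0 \<le> \<theta>" "\<theta> \<le> pi" "?c = cos \<theta>" "?s = sin \<theta>"
    using sincos_total_pi by blast
  moreover have "?s * ?p = 2 * real u" "?c * ?p + 1 = real u * real u" using p by simp_all
  ultimately show ?thesis unfolding rotation_def by metis
qed

lemma rotation_power:
  assumes "rotation u \<theta>"
  shows "Complex (real u) 1 ^ (2 * n) = of_nat ((u * u + 1) ^ n) * cis \<theta> ^ n"
proof -
  have "Complex (real u) 1 ^ 2 = of_nat (u * u + 1) * cis \<theta>"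
    using assms by (simp add: rotation_def complex_eq_iff power2_eq_square algebra_simps)
  then show ?thesis by (simp add: power_mult power_mult_distrib)
qed

lemma gauss_eq_cis:
  assumes "rotation u \<theta>"
  shows "gauss_eq u n m A B \<longleftrightarrow> of_nat m * cis \<theta> ^ n = Complex (of_int A) (of_int B)"
proof -
  have "gauss_eq u n m A B \<longleftrightarrow> of_nat ((u * u + 1) ^ n) * (of_nat m * cis \<theta> ^ n)
      = of_nat ((u * u + 1) ^ n) * Complex (of_int A) (of_int B)"
    unfolding gauss_eq_def rotation_power[OF assms] by (simp only: mult_ac)
  moreover have "of_nat ((u * u + 1) ^ n) \<noteq> (0::complex)" by (simp only: of_nat_eq_0_iff power_not_zero) simp
  ultimately show ?thesis by (simp only: mult_cancel_left) simp
qed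

text \<open>Multiplied by \<open>(u * u + 1) ^ n\<close>, the difference becomes a Gaussian integer;
  having modulus below 1, it is 0.\<close>

lemma gauss_eq_approx:
  assumes rot: "rotation u \<theta>" and bound: "real ((u * u + 1) ^ n) * \<epsilon> < 1"
    and approx: "cmod (of_nat m * cis \<theta> ^ n - Complex (of_int A) (of_int B)) \<le> \<epsilon>"
  shows "gauss_eq u n m A B"
proof -
  let ?p = "(u * u + 1) ^ n" and ?X = "gauss_pow (int u) n"
  let ?z = "of_nat m * Complex (real u) 1 ^ (2 * n) - Complex (of_int A) (of_int B) * of_nat ?p"
  have "?z = of_nat ?p * (of_nat m * cis \<theta> ^ n - Complex (of_int A) (of_int B))"
    unfolding rotation_power[OF rot] by (simp only: right_diff_distrib mult_ac)
  then have "cmod ?z = real ?p * cmod (of_nat m * cis \<theta> ^ n - Complex (of_int A) (of_int B))"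
    by (simp only: norm_mult norm_of_nat)
  also have "\<dots> \<le> real ?p * \<epsilon>" by (intro mult_left_mono approx) simp
  finally have "cmod ?z < 1" using bound by linarith
  then have "\<bar>Re ?z\<bar> < 1" "\<bar>Im ?z\<bar> < 1" using abs_Re_le_cmod[of ?z] abs_Im_le_cmod[of ?z] by linarith+
  moreover have "Re ?z = of_int (int m * fst ?X - A * int ?p)" "Im ?z = of_int (int m * snd ?X - B * int ?p)"
    using gauss_pow_complex[of "int u" n] by (simp_all del: of_nat_power of_nat_add of_nat_mult)
  ultimately have "int m * fst ?X - A * int ?p = 0" "int m * snd ?X - B * int ?p = 0" by linarith+
  then show ?thesis by (simp add: gauss_eq_iff)
qed

text \<open>The language has only the sine, so the cosine appears as
  \<open>sin (\<theta> + h)\<close> with \<open>h\<close> close to pi / 2. Division by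
  \<open>u * u + 1 \<ge> 1\<close> does not enlarge the errors.\<close>

lemma rotation_approx:
  assumes \<phi>: "rotation u \<phi>" and B: "1 \<le> B" "\<bar>U\<bar> \<le> B" "real u \<le> 2 * B"
    and \<eta>: "\<bar>U - real u\<bar> \<le> \<eta>" "\<bar>h - pi / 2\<bar> \<le> \<eta>"
    and s: "\<bar>sin \<theta> * (U * U + 1) - (U + U)\<bar> \<le> \<eta>"
    and c: "\<bar>sin (\<theta> + h) * (U * U + 1) + 1 - U * U\<bar> \<le> \<eta>"
  shows "cmod (cis \<theta> - cis \<phi>) \<le> 17 * B\<^sup>2 * \<eta>"
proof -
  let ?p = "real u * real u + 1"
  have \<eta>0: "0 \<le> \<eta>" using \<eta> by linarith
  have BB: "B \<le> B\<^sup>2" "1 \<le> B\<^sup>2" using B(1) by (simp_all add: power2_eq_square mult_le_cancel_left1 mult_ge1_I)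
  have sq: "\<bar>U * U - real u * real u\<bar> \<le> 3 * B * \<eta>"
    by (rule square_diff_le) (use \<eta> B in auto)
  have B\<eta>: "\<eta> \<le> B\<^sup>2 * \<eta>" "B * \<eta> \<le> B\<^sup>2 * \<eta>"
    using BB \<eta>0 mult_right_mono[of 1 "B\<^sup>2" \<eta>] mult_right_mono[of B "B\<^sup>2" \<eta>] by simp_all
  have mul1: "\<bar>x * (U * U - real u * real u)\<bar> \<le> 3 * B * \<eta>" if "\<bar>x\<bar> \<le> 1" for x
  proof -
    have "\<bar>x\<bar> * \<bar>U * U - real u * real u\<bar> \<le> 1 * (3 * B * \<eta>)" using that sq by (intro mult_mono) auto
    then show ?thesis by (simp add: abs_mult)
  qed
  have "sin \<theta> * ?p - sin \<phi> * ?p = (sin \<theta> * (U * U + 1) - (U + U)) - sin \<theta> * (U * U - real u * real u) + 2 * (U - real u)"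
    using \<phi> by (simp add: rotation_def algebra_simps)
  then have s': "\<bar>sin \<theta> * ?p - sin \<phi> * ?p\<bar> \<le> \<eta> + 3 * B * \<eta> + 2 * \<eta>"
    using s mul1[of "sin \<theta>"] \<eta>(1) by simp
  have "\<bar>sin (\<theta> + h) - cos \<theta>\<bar> \<le> \<eta>"
    using abs_sin_diff_le[of "\<theta> + h" "\<theta> + pi / 2"] \<eta>(2) by (simp add: sin_add)
  moreover have "\<bar>U * U\<bar> \<le> B * B" using mult_mono[OF B(2) B(2)] B(1) by (simp add: abs_mult)
  then have "\<bar>U * U + 1\<bar> \<le> 2 * B\<^sup>2" using BB by (simp add: power2_eq_square)
  ultimately have "\<bar>sin (\<theta> + h) - cos \<theta>\<bar> * \<bar>U * U + 1\<bar> \<le> \<eta> * (2 * B\<^sup>2)" by (intro mult_mono) (use \<eta>0 in auto)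
  then have cU: "\<bar>(sin (\<theta> + h) - cos \<theta>) * (U * U + 1)\<bar> \<le> \<eta> * (2 * B\<^sup>2)" by (simp add: abs_mult)
  have "cos \<theta> * ?p - cos \<phi> * ?p = (sin (\<theta> + h) * (U * U + 1) + 1 - U * U) - (sin (\<theta> + h) - cos \<theta>) * (U * U + 1)
      - cos \<theta> * (U * U - real u * real u) + (U * U - real u * real u)"
    using \<phi> by (simp add: rotation_def algebra_simps)
  then have c': "\<bar>cos \<theta> * ?p - cos \<phi> * ?p\<bar> \<le> \<eta> + \<eta> * (2 * B\<^sup>2) + 3 * B * \<eta> + 3 * B * \<eta>"
    using c cU mul1[of "cos \<theta>"] sq by simp
  have div: "\<bar>x - y\<bar> \<le> \<bar>x * ?p - y * ?p\<bar>" for x y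
  proof -
    have "\<bar>x - y\<bar> * 1 \<le> \<bar>x - y\<bar> * ?p" by (intro mult_left_mono) auto
    then show ?thesis by (simp add: left_diff_distrib[symmetric] abs_mult)
  qed
  have "cmod (cis \<theta> - cis \<phi>) \<le> \<bar>cos \<theta> - cos \<phi>\<bar> + \<bar>sin \<theta> - sin \<phi>\<bar>"
    using cmod_le[of "cis \<theta> - cis \<phi>"] by simp
  also have "\<dots> \<le> (\<eta> + \<eta> * (2 * B\<^sup>2) + 3 * B * \<eta> + 3 * B * \<eta>) + (\<eta> + 3 * B * \<eta> + 2 * \<eta>)"
    using div[of "cos \<theta>" "cos \<phi>"] div[of "sin \<theta>" "sin \<phi>"] c' s' by linarith
  \<comment> \<open>Each summand is at most a multiple of \<open>B\<^sup>2 * \<eta>\<close>, and the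
    coefficients add up to 15.\<close>
  also have "\<dots> \<le> 17 * B\<^sup>2 * \<eta>" using B\<eta> \<eta>0 by (simp add: algebra_simps)
  finally show ?thesis .
qed

text \<open>Serves for both coordinates: \<open>\<alpha>\<close> is \<open>h\<close> for the cosine
  and 0 for the sine. The angle is off by \<open>5 * \<eta>\<close> since
  \<open>\<bar>\<theta>\<bar> \<le> 4\<close>, and this is multiplied by
  \<open>m \<le> 2 * B\<close>; the other errors amount to \<open>4 * \<eta>\<close>.\<close>

lemma multiple_angle_approx:
  assumes B: "1 \<le> B" "\<bar>N\<bar> \<le> B" "\<bar>M\<bar> \<le> B" "real m \<le> 2 * B" and \<theta>: "\<bar>\<theta>\<bar> \<le> 4"
    and \<eta>: "\<bar>N - real n\<bar> \<le> \<eta>" "\<bar>M - real m\<bar> \<le> \<eta>" "\<bar>A - real a\<bar> \<le> \<eta>" "\<bar>A' - real a'\<bar> \<le> \<eta>"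
      "\<bar>\<alpha> - \<beta>\<bar> \<le> \<eta>"
    and approx: "\<bar>M * sin (N * \<theta> + \<alpha>) + A' - A\<bar> \<le> \<eta>"
  shows "\<bar>real m * sin (real n * \<theta> + \<beta>) - (real a - real a')\<bar> \<le> 14 * B * \<eta>"
proof -
  have \<eta>0: "0 \<le> \<eta>" using \<eta> by linarith
  have B\<eta>: "\<eta> \<le> B * \<eta>" using B(1) \<eta>0 mult_right_mono[of 1 B \<eta>] by simp
  have "\<bar>sin (N * \<theta> + \<alpha>) - sin (real n * \<theta> + \<beta>)\<bar> \<le> \<bar>(N * \<theta> + \<alpha>) - (real n * \<theta> + \<beta>)\<bar>"
    by (rule abs_sin_diff_le)
  also have "(N * \<theta> + \<alpha>) - (real n * \<theta> + \<beta>) = (N - real n) * \<theta> + (\<alpha> - \<beta>)" by (simp add: algebra_simps)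
  also have "\<bar>\<dots>\<bar> \<le> \<bar>N - real n\<bar> * \<bar>\<theta>\<bar> + \<bar>\<alpha> - \<beta>\<bar>" by (metis abs_mult abs_triangle_ineq)
  also have "\<dots> \<le> \<eta> * 4 + \<eta>" using \<eta> \<theta> by (intro add_mono mult_mono) auto
  finally have sin: "\<bar>sin (N * \<theta> + \<alpha>) - sin (real n * \<theta> + \<beta>)\<bar> \<le> 5 * \<eta>" by simp
  have "\<bar>M * sin (N * \<theta> + \<alpha>) - real m * sin (real n * \<theta> + \<beta>)\<bar>
      \<le> \<bar>M - real m\<bar> * \<bar>sin (N * \<theta> + \<alpha>)\<bar> + \<bar>real m\<bar> * \<bar>sin (N * \<theta> + \<alpha>) - sin (real n * \<theta> + \<beta>)\<bar>"
    by (rule prod_diff_le)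
  also have "\<dots> \<le> \<eta> * 1 + (2 * B) * (5 * \<eta>)"
    using \<eta>(2) \<eta>0 B(1,4) sin by (intro add_mono mult_mono) auto
  finally have "\<bar>M * sin (N * \<theta> + \<alpha>) - real m * sin (real n * \<theta> + \<beta>)\<bar> \<le> \<eta> + 10 * (B * \<eta>)" by (simp add: algebra_simps)
  with approx \<eta>(3,4) B\<eta> have "\<bar>real m * sin (real n * \<theta> + \<beta>) - (real a - real a')\<bar> \<le> 14 * (B * \<eta>)" by linarith
  then show ?thesis by simp
qed

text \<open>The error of the rotation is multiplied by \<open>n\<close>, by \<open>m\<close> and
  finally by the denominator. All three are at most \<open>2 * B\<close>, the last one by the
  hypothesis on \<open>y\<close>, which accounts for the fifth power of \<open>B\<close>.\<close>

lemma gauss_eq_sound: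
  assumes B: "1 \<le> B" "\<bar>U\<bar> \<le> B" "\<bar>N\<bar> \<le> B" "\<bar>M\<bar> \<le> B"
      "real u \<le> 2 * B" "real n \<le> 2 * B" "real m \<le> 2 * B" "real y \<le> 2 * B"
    and \<theta>: "\<bar>\<theta>\<bar> \<le> 4"
    and \<eta>: "\<bar>U - real u\<bar> \<le> \<eta>" "\<bar>N - real n\<bar> \<le> \<eta>" "\<bar>M - real m\<bar> \<le> \<eta>" "\<bar>A - real a\<bar> \<le> \<eta>" "\<bar>A' - real a'\<bar> \<le> \<eta>"
      "\<bar>C - real c\<bar> \<le> \<eta>" "\<bar>C' - real c'\<bar> \<le> \<eta>" "\<bar>h - pi / 2\<bar> \<le> \<eta>"
    and s: "\<bar>sin \<theta> * (U * U + 1) - (U + U)\<bar> \<le> \<eta>"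
      "\<bar>sin (\<theta> + h) * (U * U + 1) + 1 - U * U\<bar> \<le> \<eta>"
      "\<bar>M * sin (N * \<theta> + h) + A' - A\<bar> \<le> \<eta>" "\<bar>M * sin (N * \<theta>) + C' - C\<bar> \<le> \<eta>"
    and y: "(u * u + 1) ^ n \<le> y" and small: "200 * B ^ 5 * \<eta> < 1"
  shows "gauss_eq u n m (int a - int a') (int c - int c')"
proof -
  obtain \<phi> where \<phi>: "rotation u \<phi>" using rotation_ex by blast
  have \<eta>0: "0 \<le> \<eta>" using \<eta> by linarith
  have d: "cmod (cis \<theta> - cis \<phi>) \<le> 17 * B\<^sup>2 * \<eta>"
    by (rule rotation_approx[OF \<phi> B(1,2,5) \<eta>(1,8) s(1,2)])
  have "cmod (cis \<theta> ^ n - cis \<phi> ^ n) \<le> real n * cmod (cis \<theta> - cis \<phi>)"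
    by (rule norm_power_diff) auto
  also have "\<dots> \<le> (2 * B) * (17 * B\<^sup>2 * \<eta>)" using B(1) by (intro mult_mono B(6) d) auto
  finally have dn: "cmod (cis \<theta> ^ n - cis \<phi> ^ n) \<le> 34 * B ^ 3 * \<eta>"
    by (simp add: power2_eq_square power3_eq_cube mult_ac)
  let ?Z = "Complex (of_int (int a - int a')) (of_int (int c - int c'))"
  have "\<bar>real m * sin (real n * \<theta> + pi / 2) - (real a - real a')\<bar> \<le> 14 * B * \<eta>"
    by (rule multiple_angle_approx[OF B(1,3,4,7) \<theta> \<eta>(2-5,8) s(3)])
  moreover have "\<bar>real m * sin (real n * \<theta> + 0) - (real c - real c')\<bar> \<le> 14 * B * \<eta>"
    by (rule multiple_angle_approx[OF B(1,3,4,7) \<theta> \<eta>(2,3,6,7), of 0]) (simp_all only: add_0_right diff_self abs_zero \<eta>0 s(4))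
  moreover have "cmod (of_nat m * cis \<theta> ^ n - ?Z)
      \<le> \<bar>real m * cos (real n * \<theta>) - (real a - real a')\<bar> + \<bar>real m * sin (real n * \<theta>) - (real c - real c')\<bar>"
    using cmod_le[of "of_nat m * cis \<theta> ^ n - ?Z"] by (simp add: DeMoivre)
  ultimately have z: "cmod (of_nat m * cis \<theta> ^ n - ?Z) \<le> 28 * B * \<eta>" by (simp add: sin_add)
  have "cmod (of_nat m * cis \<phi> ^ n - ?Z) \<le> cmod (of_nat m * (cis \<phi> ^ n - cis \<theta> ^ n)) + cmod (of_nat m * cis \<theta> ^ n - ?Z)"
    using norm_triangle_ineq[of "of_nat m * (cis \<phi> ^ n - cis \<theta> ^ n)" "of_nat m * cis \<theta> ^ n - ?Z"]
    by (simp add: algebra_simps)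
  also have "cmod (of_nat m * (cis \<phi> ^ n - cis \<theta> ^ n)) \<le> (2 * B) * (34 * B ^ 3 * \<eta>)"
    unfolding norm_mult norm_of_nat norm_minus_commute[of "cis \<phi> ^ n"]
    using B(1) by (intro mult_mono B(7) dn) auto
  finally have *: "cmod (of_nat m * cis \<phi> ^ n - ?Z) \<le> 68 * B ^ 4 * \<eta> + 28 * B * \<eta>"
    using z by (simp add: eval_nat_numeral mult_ac)
  also have "\<dots> \<le> 96 * B ^ 4 * \<eta>"
  proof -
    have "B ^ 1 \<le> B ^ 4" using B(1) by (intro power_increasing) auto
    then have "B * \<eta> \<le> B ^ 4 * \<eta>" using \<eta>0 by (simp add: mult_right_mono)
    then show ?thesis unfolding mult.assoc by linarith
  qed
  finally have e: "cmod (of_nat m * cis \<phi> ^ n - ?Z) \<le> 96 * B ^ 4 * \<eta>" .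
  have "real ((u * u + 1) ^ n) \<le> 2 * B" using y B(8) by (metis of_nat_le_iff order_trans)
  then have "real ((u * u + 1) ^ n) * (96 * B ^ 4 * \<eta>) \<le> (2 * B) * (96 * B ^ 4 * \<eta>)"
    using \<eta>0 B(1) by (intro mult_right_mono) auto
  also have "\<dots> = 192 * B ^ 5 * \<eta>" by (simp add: eval_nat_numeral mult_ac)
  also have "\<dots> \<le> 200 * B ^ 5 * \<eta>" using \<eta>0 B(1) by (intro mult_right_mono) auto
  finally have "real ((u * u + 1) ^ n) * (96 * B ^ 4 * \<eta>) < 1" using small by linarith
  from gauss_eq_approx[OF \<phi> this e] show ?thesis .
qed

section \<open>The reduction to strict sentences\<close>

primrec num :: "nat \<Rightarrow> sin_term" where
  "num 0 = Zero"
| "num (Suc n) = Add (num n) One"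

lemma term_val_num [simp]: "term_val e (num n) = real n"
  by (induction n) auto

lemma term_vars_num [simp]: "term_vars (num n) = {}"
  by (induction n) auto

text \<open>Expresses that \<open>\<bar>s - t\<bar> < 1 / c\<close> without using subtraction.\<close>

definition near :: "sin_term \<Rightarrow> sin_term \<Rightarrow> sin_term \<Rightarrow> ex_formula" where
  "near c s t = Conj (Less (Mult c s) (Add (Mult c t) One)) (Less (Mult c t) (Add (Mult c s) One))"

lemma holds_near:
  assumes "0 < term_val e c"
  shows "holds e (near c s t) \<longleftrightarrow> \<bar>term_val e s - term_val e t\<bar> < 1 / term_val e c"
proof -
  have "\<bar>term_val e s - term_val e t\<bar> < 1 / term_val e c \<longleftrightarrow> term_val e c * \<bar>term_val e s - term_val e t\<bar> < 1"
    using assms by (simp add: field_simps)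
  also have "term_val e c * \<bar>term_val e s - term_val e t\<bar> = \<bar>term_val e c * term_val e s - term_val e c * term_val e t\<bar>"
    using assms by (simp add: abs_mult right_diff_distrib[symmetric])
  finally show ?thesis by (auto simp: near_def abs_less_iff)
qed

lemma holds_near_eq: "term_val e s = term_val e t \<Longrightarrow> holds e (near c s t)"
  by (simp add: near_def)

lemma free_vars_near [simp]: "free_vars (near c s t) = term_vars c \<union> term_vars s \<union> term_vars t"
  by (auto simp: near_def)

lemma equality_free_near [simp]: "equality_free (near c s t)"
  by (simp add: near_def)

definition conjs :: "ex_formula list \<Rightarrow> ex_formula" where
  "conjs ps = foldr Conj ps (Less Zero One)"

lemma holds_conjs [simp]: "holds e (conjs ps) \<longleftrightarrow> (\<forall>p\<in>set ps. holds e p)"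
  by (induction ps) (auto simp: conjs_def)

lemma free_vars_conjs [simp]: "free_vars (conjs ps) = (\<Union>p\<in>set ps. free_vars p)"
  by (induction ps) (auto simp: conjs_def)

lemma equality_free_conjs [simp]: "equality_free (conjs ps) \<longleftrightarrow> (\<forall>p\<in>set ps. equality_free p)"
  by (induction ps) (auto simp: conjs_def)

definition exists_vars :: "nat list \<Rightarrow> ex_formula \<Rightarrow> ex_formula" where
  "exists_vars is p = foldr Exists is p"

lemma holds_exists_vars:
  "holds e (exists_vars is p) \<longleftrightarrow> (\<exists>e'. (\<forall>i. i \<notin> set is \<longrightarrow> e' i = e i) \<and> holds e' p)"
proof (induction "is" arbitrary: e)
  case Nil
  have "e' = e" if "\<forall>i. e' i = e i" for e' using that by auto
  then show ?case by (auto simp: exists_vars_def)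
next
  case (Cons j js)
  have "holds e (exists_vars (j # js) p) \<longleftrightarrow> (\<exists>x. holds (e(j := x)) (exists_vars js p))"
    by (simp add: exists_vars_def)
  also have "\<dots> \<longleftrightarrow> (\<exists>x e'. (\<forall>i. i \<notin> set js \<longrightarrow> e' i = (e(j := x)) i) \<and> holds e' p)"
    using Cons by simp
  also have "\<dots> \<longleftrightarrow> (\<exists>e'. (\<forall>i. i \<notin> set (j # js) \<longrightarrow> e' i = e i) \<and> holds e' p)"
  proof
    assume "\<exists>x e'. (\<forall>i. i \<notin> set js \<longrightarrow> e' i = (e(j := x)) i) \<and> holds e' p"
    then obtain x e' where "\<forall>i. i \<notin> set js \<longrightarrow> e' i = (e(j := x)) i" "holds e' p" by blast
    then have "(\<forall>i. i \<notin> set (j # js) \<longrightarrow> e' i = e i) \<and> holds e' p" by simp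
    then show "\<exists>e'. (\<forall>i. i \<notin> set (j # js) \<longrightarrow> e' i = e i) \<and> holds e' p" by blast
  next
    assume "\<exists>e'. (\<forall>i. i \<notin> set (j # js) \<longrightarrow> e' i = e i) \<and> holds e' p"
    then obtain e' where "\<forall>i. i \<notin> set (j # js) \<longrightarrow> e' i = e i" "holds e' p" by blast
    then have "(\<forall>i. i \<notin> set js \<longrightarrow> e' i = (e(j := e' j)) i) \<and> holds e' p" by simp
    then show "\<exists>x e'. (\<forall>i. i \<notin> set js \<longrightarrow> e' i = (e(j := x)) i) \<and> holds e' p" by blast
  qed
  finally show ?case .
qed

lemma free_vars_exists_vars [simp]: "free_vars (exists_vars is p) = free_vars p - set is"
  by (induction "is") (auto simp: exists_vars_def)

lemma equality_free_exists_vars [simp]: "equality_free (exists_vars is p) \<longleftrightarrow> equality_free p"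
  by (induction "is") (auto simp: exists_vars_def)

text \<open>
  The variables \<open>0, \<dots>, K - 1\<close> stand for approximate natural numbers below the value of variable
  \<open>K + 1\<close>. Variable \<open>K\<close> approximates \<open>\<pi> / 2\<close>, variable \<open>K + 2\<close> is the precision,
  and variable \<open>K + 3\<close> the angle of the rotation by \<open>(u + i)\<^sup>2 / (u\<^sup>2 + 1)\<close>.
\<close>

primrec con_formula :: "nat \<Rightarrow> nat con \<Rightarrow> ex_formula" where
  "con_formula K (COne i) = near (num 4) (Var i) One"
| "con_formula K (CAdd i j k) = near (num 4) (Add (Var i) (Var j)) (Var k)"
| "con_formula K (CMul i j k) = near (num 4) (Mult (Var i) (Var j)) (Var k)"
| "con_formula K (CRot u n m a a' b b' y) = Exists (K + 3) (conjs [
     Less (Var (K + 3)) (num 4), Less Zero (Add (Var (K + 3)) (num 4)),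
     near (Var (K + 2)) (Mult (Sin (Var (K + 3))) (Add (Mult (Var u) (Var u)) One)) (Add (Var u) (Var u)),
     near (Var (K + 2)) (Add (Mult (Sin (Add (Var (K + 3)) (Var K))) (Add (Mult (Var u) (Var u)) One)) One)
       (Mult (Var u) (Var u)),
     near (Var (K + 2)) (Add (Mult (Var m) (Sin (Add (Mult (Var n) (Var (K + 3))) (Var K)))) (Var a')) (Var a),
     near (Var (K + 2)) (Add (Mult (Var m) (Sin (Mult (Var n) (Var (K + 3))))) (Var b')) (Var b)])"

text \<open>Positivity of \<open>2 * v + 1\<close> excludes negative integers, which the zeros of
  the sine cannot distinguish from natural numbers.\<close>

definition nat_formula :: "nat \<Rightarrow> nat \<Rightarrow> ex_formula" where
  "nat_formula K i = conjs [Less (Var i) (Var (K + 1)), Less Zero (Add (Add (Var i) (Var i)) One),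
     near (Var (K + 2)) (Sin (Mult (Add (Var K) (Var K)) (Var i))) Zero]"

text \<open>The two bounds on \<open>h\<close> and the zero of the sine single out pi / 2. As to the
  threshold: rounding costs a factor \<open>6 * B\<close>, and \<open>gauss_eq_sound\<close> asks
  for another \<open>200 * B ^ 5\<close>, together \<open>1200 * B ^ 6\<close>.\<close>

definition precision_formula :: "nat \<Rightarrow> ex_formula" where
  "precision_formula K = conjs [Less One (Var K), Less (Var K) (num 2), Less One (Var (K + 1)),
     Less (Mult (num 2000) (Mult (Mult (Mult (Var (K + 1)) (Var (K + 1))) (Mult (Var (K + 1)) (Var (K + 1))))
       (Mult (Var (K + 1)) (Var (K + 1))))) (Var (K + 2)),
     near (Var (K + 2)) (Sin (Add (Var K) (Var K))) Zero]"

definition system_formula :: "nat \<Rightarrow> nat con list \<Rightarrow> ex_formula" where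
  "system_formula K cs = conjs (precision_formula K # map (nat_formula K) [0..<K] @ map (con_formula K) cs)"

text \<open>The input enters only through the numeral, while the constraints are fixed; so the code
  depends computably on \<open>x\<close>.\<close>

definition system_sentence :: "nat \<Rightarrow> nat con list \<Rightarrow> nat \<Rightarrow> ex_formula" where
  "system_sentence K cs x =
     Exists 0 (Conj (near (num 4) (Var 0) (num x)) (exists_vars [1..<K + 3] (system_formula K cs)))"

lemma equality_free_con_formula [simp]: "equality_free (con_formula K c)"
  by (cases c) simp_all

lemma equality_free_system_sentence: "equality_free (system_sentence K cs x)"
  by (auto simp: system_sentence_def system_formula_def nat_formula_def precision_formula_def)

lemma free_vars_con_formula: "set_con c \<subseteq> {..<K} \<Longrightarrow> free_vars (con_formula K c) \<subseteq> {..<K + 3}"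
  by (cases c) auto

lemma sentence_system_sentence:
  assumes "\<And>c. c \<in> set cs \<Longrightarrow> set_con c \<subseteq> {..<K}"
  shows "sentence (system_sentence K cs x)"
proof -
  have "free_vars (system_formula K cs) \<subseteq> {..<K + 3}"
    using free_vars_con_formula[OF assms]
    by (auto simp: system_formula_def nat_formula_def precision_formula_def)
  then show ?thesis by (auto simp: sentence_def system_sentence_def)
qed

lemma holds_system_sentence_iff:
  assumes "\<And>c. c \<in> set cs \<Longrightarrow> set_con c \<subseteq> {..<K}"
  shows "true_sentence (system_sentence K cs x) \<longleftrightarrow>
    (\<exists>e. \<bar>e 0 - real x\<bar> < 1 / 4 \<and> holds e (system_formula K cs))"
proof
  assume "true_sentence (system_sentence K cs x)"
  then have "holds (\<lambda>_. 0) (system_sentence K cs x)" by (simp add: true_sentence_def)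
  then obtain x0 e where "holds ((\<lambda>_. 0)(0 := x0)) (near (num 4) (Var 0) (num x))"
    "\<forall>i. i \<notin> set [1..<K + 3] \<longrightarrow> e i = ((\<lambda>_. 0)(0 := x0)) i" "holds e (system_formula K cs)"
    unfolding system_sentence_def holds.simps holds_exists_vars by blast
  moreover from this(2) have "e 0 = x0" by simp
  ultimately show "\<exists>e. \<bar>e 0 - real x\<bar> < 1 / 4 \<and> holds e (system_formula K cs)"
    by (intro exI[of _ e]) (simp add: holds_near)
next
  assume "\<exists>e. \<bar>e 0 - real x\<bar> < 1 / 4 \<and> holds e (system_formula K cs)"
  then obtain e where e: "\<bar>e 0 - real x\<bar> < 1 / 4" "holds e (system_formula K cs)" by blast
  have "holds (e(0 := e 0)) (near (num 4) (Var 0) (num x))" using e(1) by (simp add: holds_near)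
  moreover have "holds (e(0 := e 0)) (exists_vars [1..<K + 3] (system_formula K cs))"
    unfolding holds_exists_vars using e(2) by (intro exI[of _ e]) simp
  ultimately have "holds e (system_sentence K cs x)" unfolding system_sentence_def holds.simps by blast
  then show "true_sentence (system_sentence K cs x)"
    using true_sentence_iff_holds sentence_system_sentence[OF assms] by blast
qed

lemma recursive_formula_code_system_sentence:
  "recursive n f \<Longrightarrow> recursive n (\<lambda>xs. formula_code (system_sentence K cs (f xs)))"
proof -
  assume f: "recursive n f"
  have num: "recursive n (\<lambda>xs. term_code (num (f xs)))"
  proof -
    have "recursive n (\<lambda>xs. rec_nat (term_code Zero) (\<lambda>y r. prod_encode (3, prod_encode (r, term_code One))) (f xs))"
      by (intro recursive_nat_rec rec_intros f) simp_all
    moreover have "rec_nat (term_code Zero) (\<lambda>y r. prod_encode (3, prod_encode (r, term_code One))) k = term_code (num k)" for k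
      by (induction k) simp_all
    ultimately show ?thesis by simp
  qed
  show ?thesis
    unfolding system_sentence_def near_def formula_code.simps term_code.simps(1,3-5)
    by (intro rec_intros num)
qed

text \<open>An equation between naturals that fails is off by at least 1, so small errors cannot
  hide a failure. Exponential constraints are recovered in the weak reading.\<close>

lemma system_formula_sound:
  assumes holds: "holds e (system_formula K cs)" and vars: "\<And>c. c \<in> set cs \<Longrightarrow> set_con c \<subseteq> {..<K}"
  defines "k \<equiv> \<lambda>i. nat (round (e i))"
  shows "sats False cs k" "\<And>i. i < K \<Longrightarrow> \<bar>e i - real (k i)\<bar> < 1 / 4"
proof -
  define h B D where "h = e K" and "B = e (K + 1)" and "D = e (K + 2)"
  note hBD = h_def[symmetric] B_def[symmetric] D_def[symmetric]
  have prec: "1 < h" "h < 2" "1 < B" "2000 * (B * B * (B * B) * (B * B)) < D"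
    and sin_h: "holds e (near (Var (K + 2)) (Sin (Add (Var K) (Var K))) Zero)"
    using holds by (auto simp: system_formula_def precision_formula_def h_def B_def D_def)
  have B6: "B * B * (B * B) * (B * B) = B ^ 6" by (simp add: eval_nat_numeral)
  have "1 < B ^ 6" using prec(3) by (intro one_less_power) auto
  then have D: "0 < D" "2000 * B ^ 6 < D" using prec(4) unfolding B6 by linarith+
  define \<delta> where "\<delta> = 1 / D"
  have \<delta>: "0 < \<delta>" "2000 * B ^ 6 * \<delta> < 1" using D by (simp_all add: \<delta>_def)
  have near: "\<bar>term_val e' s - term_val e' t\<bar> < \<delta>"
    if "holds e' (near (Var (K + 2)) s t)" "e' (K + 2) = D" for e' s t
    using that D(1) by (simp add: holds_near \<delta>_def)
  define \<eta> where "\<eta> = 6 * B * \<delta>"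
  have "200 * B ^ 5 * \<eta> = 1200 * B ^ 6 * \<delta>" by (simp add: \<eta>_def eval_nat_numeral)
  also have "\<dots> \<le> 2000 * B ^ 6 * \<delta>" using \<delta>(1) prec(3) by (intro mult_right_mono) auto
  finally have small5: "200 * B ^ 5 * \<eta> < 1" using \<delta>(2) by linarith
  have \<delta>\<eta>: "3 * \<delta> \<le> \<eta>" using \<delta>(1) prec(3) by (simp add: \<eta>_def)
  have "B ^ 1 \<le> B ^ 5" using prec(3) by (intro power_increasing) auto
  then have "B * \<eta> \<le> B ^ 5 * \<eta>" using \<delta>(1) \<delta>\<eta> by (intro mult_right_mono) auto
  then have small1: "200 * (B * \<eta>) < 1" using small5 by linarith
  have "1 * \<eta> \<le> B * \<eta>" using \<delta>(1) \<delta>\<eta> prec(3) by (intro mult_right_mono) auto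
  then have small0: "200 * \<eta> < 1" "0 \<le> \<eta>" using small1 \<delta>(1) \<delta>\<eta> by linarith+
  have eD: "e (K + 2) = D" by (simp add: D_def)
  have "\<bar>sin (2 * h)\<bar> \<le> \<delta>" using near[OF sin_h eD] by (simp add: hBD)
  then have pi: "\<bar>2 * h - pi\<bar> \<le> 3 * \<delta>" by (rule pi_approximation[OF prec(1,2)])
  have nat: "\<bar>e i\<bar> \<le> B \<and> \<bar>e i - real (k i)\<bar> \<le> \<eta> \<and> real (k i) \<le> 2 * B" if "i < K" for i
  proof -
    have "holds e (nat_formula K i)" using holds that by (auto simp: system_formula_def)
    then have i: "e i < B" "- 1 / 2 < e i"
      and "holds e (near (Var (K + 2)) (Sin (Mult (Add (Var K) (Var K)) (Var i))) Zero)"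
      by (auto simp: nat_formula_def B_def)
    from near[OF this(3) eD] have sin: "\<bar>sin (2 * h * e i)\<bar> \<le> \<delta>" by (simp add: hBD)
    have "\<bar>e i\<bar> \<le> B" "1 \<le> B" using i prec(3) by linarith+
    moreover have "\<eta> < 1 / 2" using small0(1) by linarith
    ultimately have "\<bar>e i - real (k i)\<bar> \<le> \<eta>" unfolding k_def \<eta>_def
      by (intro nat_approximation[OF _ _ i(2) pi sin])
    then show ?thesis using \<open>\<bar>e i\<bar> \<le> B\<close> small0(1) prec(3) by linarith
  qed
  show "\<bar>e i - real (k i)\<bar> < 1 / 4" if "i < K" for i using nat[OF that] small0(1) by linarith
  have "sat False k c" if c: "c \<in> set cs" for c
  proof -
    have hc: "holds e (con_formula K c)" using holds c by (simp add: system_formula_def)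
    show ?thesis
    proof (cases c)
      case (COne i)
      then have "i < K" using vars[OF c] by simp
      moreover have "\<bar>e i - 1\<bar> < 1 / 4" using hc COne by (simp add: holds_near)
      ultimately have "k i = 1" using nat[of i] small0(1) by (intro nat_eqI) linarith
      then show ?thesis using COne by simp
    next
      case (CAdd i j l)
      then have "i < K" "j < K" "l < K" using vars[OF c] by simp_all
      moreover have "\<bar>e i + e j - e l\<bar> < 1 / 4" using hc CAdd by (simp add: holds_near)
      ultimately have "k i + k j = k l"
        using nat[of i] nat[of j] nat[of l] small0(1) by (intro nat_eqI) linarith
      then show ?thesis using CAdd by simp
    next
      case (CMul i j l)
      then have ijl: "i < K" "j < K" "l < K" using vars[OF c] by simp_all
      have "\<bar>e i * e j - real (k i) * real (k j)\<bar> \<le> \<bar>e i - real (k i)\<bar> * \<bar>e j\<bar> + \<bar>real (k i)\<bar> * \<bar>e j - real (k j)\<bar>"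
        by (rule prod_diff_le)
      also have "\<dots> \<le> \<eta> * B + (2 * B) * \<eta>"
        using nat[OF ijl(1)] nat[OF ijl(2)] small0(2) prec(3) by (intro add_mono mult_mono) auto
      also have "\<dots> = 3 * (B * \<eta>)" by simp
      finally have "\<bar>e i * e j - real (k i) * real (k j)\<bar> < 1 / 4" using small1 by linarith
      moreover have "\<bar>e i * e j - e l\<bar> < 1 / 4" using hc CMul by (simp add: holds_near)
      ultimately have "\<bar>real (k i * k j) - real (k l)\<bar> < 1"
        using nat[OF ijl(3)] small0(1) unfolding of_nat_mult by linarith
      then have "k i * k j = k l" by (rule nat_eqI)
      then show ?thesis using CMul by simp
    next
      case (CRot u n m a a' b b' y)
      then have K: "u < K" "n < K" "m < K" "a < K" "a' < K" "b < K" "b' < K" "y < K"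
        using vars[OF c] by simp_all
      from hc CRot obtain \<theta> where \<theta>: "\<theta> < 4" "0 < \<theta> + 4"
        and near\<theta>: "holds (e(K + 3 := \<theta>)) (near (Var (K + 2)) (Mult (Sin (Var (K + 3))) (Add (Mult (Var u) (Var u)) One)) (Add (Var u) (Var u)))"
        "holds (e(K + 3 := \<theta>)) (near (Var (K + 2)) (Add (Mult (Sin (Add (Var (K + 3)) (Var K))) (Add (Mult (Var u) (Var u)) One)) One)
          (Mult (Var u) (Var u)))"
        "holds (e(K + 3 := \<theta>)) (near (Var (K + 2)) (Add (Mult (Var m) (Sin (Add (Mult (Var n) (Var (K + 3))) (Var K)))) (Var a')) (Var a))"
        "holds (e(K + 3 := \<theta>)) (near (Var (K + 2)) (Add (Mult (Var m) (Sin (Mult (Var n) (Var (K + 3))))) (Var b')) (Var b))"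
        by auto
      have "(e(K + 3 := \<theta>)) (K + 2) = D" by (simp add: D_def)
      note near\<theta> = near\<theta>[THEN near, OF this]
      have less: "\<bar>x\<bar> \<le> \<eta>" if "\<bar>x\<bar> < \<delta>" for x using that \<delta>\<eta> \<delta>(1) by linarith
      have "\<bar>h - pi / 2\<bar> \<le> \<eta>" using pi \<delta>\<eta> \<delta>(1) by linarith
      moreover have "\<bar>sin \<theta> * (e u * e u + 1) - (e u + e u)\<bar> \<le> \<eta>"
        "\<bar>sin (\<theta> + h) * (e u * e u + 1) + 1 - e u * e u\<bar> \<le> \<eta>"
        "\<bar>e m * sin (e n * \<theta> + h) + e a' - e a\<bar> \<le> \<eta>" "\<bar>e m * sin (e n * \<theta>) + e b' - e b\<bar> \<le> \<eta>"
        using near\<theta> K by (auto simp: hBD intro!: less)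
      moreover have "1 \<le> B" "\<bar>\<theta>\<bar> \<le> 4" using prec(3) \<theta> by linarith+
      ultimately have "gauss_eq (k u) (k n) (k m) (int (k a) - int (k a')) (int (k b) - int (k b'))"
        if "(k u * k u + 1) ^ k n \<le> k y"
        using that small5 nat K by (intro gauss_eq_sound[where B = B and \<theta> = \<theta> and \<eta> = \<eta> and h = h and y = "k y"
          and U = "e u" and N = "e n" and M = "e m" and A = "e a" and A' = "e a'" and C = "e b" and C' = "e b'"]) blast+
      then show ?thesis using CRot by simp
    qed
  qed
  then show "sats False cs k" by (simp add: sats_def)
qed

text \<open>From \<open>sin (pi / 6) = 1 / 2\<close>. It gives the strict inequality
  \<open>1 < pi / 2\<close> that \<open>precision_formula\<close> demands.\<close>

lemma pi_ge_3: "3 \<le> pi"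
  using sin_x_le_x[of "pi / 6"] by (simp add: sin_30)

text \<open>The exact values, with pi / 2 for \<open>h\<close> and exact rotation angles, satisfy
  every \<open>near\<close> formula as an equation, whatever the precision.\<close>

lemma system_formula_complete:
  assumes w: "sats True cs w" and vars: "\<And>c. c \<in> set cs \<Longrightarrow> set_con c \<subseteq> {..<K}"
  shows "\<exists>e. (\<forall>i<K. e i = real (w i)) \<and> holds e (system_formula K cs)"
proof -
  \<comment> \<open>Larger than 1 and than every value; \<open>D\<close> then lies just above the
    required threshold.\<close>
  define B where "B = 2 + (\<Sum>i<K. real (w i))"
  define D where "D = 2000 * (B * B * (B * B) * (B * B)) + 1"
  define e where "e i = (if i < K then real (w i) else if i = K then pi / 2 else if i = K + 1 then B else D)" for i
  have e: "e K = pi / 2" "e (K + 1) = B" "e (Suc K) = B" "e (K + 2) = D" "e (Suc (Suc K)) = D"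
    "\<And>i. i < K \<Longrightarrow> e i = real (w i)"
    by (auto simp: e_def)
  have wB: "real (w i) < B" if "i < K" for i
    using member_le_sum[of i "{..<K}" "\<lambda>i. real (w i)"] that by (simp add: B_def)
  have "0 \<le> (\<Sum>i<K. real (w i))" by (intro sum_nonneg) auto
  then have "1 < B" by (simp add: B_def)
  have "holds e (precision_formula K)"
    using pi_less_4 pi_ge_3 \<open>1 < B\<close>
    by (auto simp: precision_formula_def e D_def intro!: holds_near_eq)
  moreover have "holds e (nat_formula K i)" if "i < K" for i
    using wB[OF that] that
    by (auto simp: nat_formula_def e sin_times_pi_eq_0 intro!: holds_near_eq)
  moreover have "holds e (con_formula K c)" if c: "c \<in> set cs" for c
  proof -
    have s: "sat True w c" using w c by (simp add: sats_def)
    show ?thesis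
    proof (cases c)
      case (COne i)
      then show ?thesis using s vars[OF c] by (auto simp: e intro!: holds_near_eq)
    next
      case (CAdd i j l)
      then show ?thesis using s vars[OF c] by (auto simp: e simp flip: of_nat_add intro!: holds_near_eq)
    next
      case (CMul i j l)
      then show ?thesis using s vars[OF c] by (auto simp: e simp flip: of_nat_mult intro!: holds_near_eq)
    next
      case (CRot u n m a a' b b' y)
      then have K: "u < K" "n < K" "m < K" "a < K" "a' < K" "b < K" "b' < K" "y < K"
        using vars[OF c] by simp_all
      obtain \<theta> where rot: "rotation (w u) \<theta>" using rotation_ex by blast
      have "gauss_eq (w u) (w n) (w m) (int (w a) - int (w a')) (int (w b) - int (w b'))"
        using s CRot by simp
      then have "of_nat (w m) * cis \<theta> ^ w n = Complex (of_int (int (w a) - int (w a'))) (of_int (int (w b) - int (w b')))"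
        unfolding gauss_eq_cis[OF rot] .
      then have eq: "real (w m) * cos (real (w n) * \<theta>) + real (w a') = real (w a)"
        "real (w m) * sin (real (w n) * \<theta>) + real (w b') = real (w b)"
        by (simp_all add: DeMoivre complex_eq_iff)
      have "\<theta> < 4" "0 < \<theta> + 4" using rot pi_less_4 by (auto simp: rotation_def)
      then have "holds (e(K + 3 := \<theta>)) (conjs [
         Less (Var (K + 3)) (num 4), Less Zero (Add (Var (K + 3)) (num 4)),
         near (Var (K + 2)) (Mult (Sin (Var (K + 3))) (Add (Mult (Var u) (Var u)) One)) (Add (Var u) (Var u)),
         near (Var (K + 2)) (Add (Mult (Sin (Add (Var (K + 3)) (Var K))) (Add (Mult (Var u) (Var u)) One)) One)
           (Mult (Var u) (Var u)),
         near (Var (K + 2)) (Add (Mult (Var m) (Sin (Add (Mult (Var n) (Var (K + 3))) (Var K)))) (Var a')) (Var a),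
         near (Var (K + 2)) (Add (Mult (Var m) (Sin (Mult (Var n) (Var (K + 3))))) (Var b')) (Var b)])"
        using eq rot K by (auto simp: e rotation_def sin_add intro!: holds_near_eq)
      then show ?thesis unfolding CRot con_formula.simps holds.simps by blast
    qed
  qed
  ultimately have "holds e (system_formula K cs)" by (auto simp: system_formula_def)
  then show ?thesis using e(6) by blast
qed

text \<open>The sentence lies between the two readings: strong solutions make it true, and its truth
  yields weak solutions. Definability says that both mean membership in \<open>A\<close>.\<close>

lemma dfn_imp_reduction:
  assumes "dfn (\<lambda>v. v 0 \<in> A)"
  obtains K cs where "\<And>x. x \<in> A \<longleftrightarrow> true_sentence (system_sentence K cs x)"
proof -
  obtain cs where cs: "realizes cs (\<lambda>v. v 0 \<in> A) (\<lambda>v. v 0 \<in> A)" using assms unfolding dfn2_def by blast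
  \<comment> \<open>All given variables are merged into variable 0, since \<open>realizes\<close>
    can be applied to constant stores; the auxiliary variables follow.\<close>
  let ?f = "case_sum (\<lambda>_. 0) Suc :: nat + nat \<Rightarrow> nat"
  let ?cs = "map (map_con ?f) cs"
  define K where "K = Suc (\<Sum>i\<in>(\<Union>c\<in>set ?cs. set_con c). i)"
  have fin: "finite (set_con c)" for c :: "nat con" by (cases c) simp_all
  have vars: "set_con c \<subseteq> {..<K}" if "c \<in> set ?cs" for c
  proof
    fix i assume "i \<in> set_con c"
    then have "i \<le> (\<Sum>i\<in>(\<Union>c\<in>set ?cs. set_con c). i)"
      using that fin by (intro member_le_sum[of i _ "\<lambda>i. i"]) auto
    then show "i \<in> {..<K}" by (simp add: K_def)
  qed
  have iff: "true_sentence (system_sentence K ?cs x) \<longleftrightarrow>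
      (\<exists>e. \<bar>e 0 - real x\<bar> < 1 / 4 \<and> holds e (system_formula K ?cs))" for x
    by (rule holds_system_sentence_iff) (rule vars)
  have "x \<in> A \<longleftrightarrow> true_sentence (system_sentence K ?cs x)" for x
  proof
    assume "x \<in> A"
    then obtain w where "sats True cs (case_sum (\<lambda>_. x) w)" using realizesD1[OF cs, of "\<lambda>_. x"] by auto
    moreover have "case_sum (\<lambda>_. x) w = (\<lambda>i. case_nat x w (?f i))" by (auto simp: fun_eq_iff split: sum.split)
    ultimately have "sats True ?cs (case_nat x w)" unfolding sats_map by simp
    from system_formula_complete[OF this vars] obtain e where
      e: "\<And>i. i < K \<Longrightarrow> e i = real (case_nat x w i)" "holds e (system_formula K ?cs)" by blast
    have "e 0 = real x" using e(1)[of 0] by (simp add: K_def)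
    then have "\<bar>e 0 - real x\<bar> < 1 / 4 \<and> holds e (system_formula K ?cs)" using e(2) by simp
    then have "\<exists>e. \<bar>e 0 - real x\<bar> < 1 / 4 \<and> holds e (system_formula K ?cs)" by (intro exI)
    then show "true_sentence (system_sentence K ?cs x)"
      unfolding iff .
  next
    assume "true_sentence (system_sentence K ?cs x)"
    then have "\<exists>e. \<bar>e 0 - real x\<bar> < 1 / 4 \<and> holds e (system_formula K ?cs)"
      unfolding iff .
    then obtain e where e: "\<bar>e 0 - real x\<bar> < 1 / 4" "holds e (system_formula K ?cs)" by blast
    let ?k = "\<lambda>i. nat (round (e i))"
    have "sats False ?cs ?k" by (rule system_formula_sound[OF e(2) vars])
    moreover have "(\<lambda>i. ?k (?f i)) = case_sum (\<lambda>_. ?k 0) (\<lambda>i. ?k (Suc i))" by (auto simp: fun_eq_iff split: sum.split)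
    ultimately have "sats False cs (case_sum (\<lambda>_. ?k 0) (\<lambda>i. ?k (Suc i)))" unfolding sats_map by simp
    from realizesD2[OF cs this] have "?k 0 \<in> A" .
    moreover have "\<bar>e 0 - real (?k 0)\<bar> < 1 / 4"
      by (rule system_formula_sound(2)[OF e(2) vars]) (simp_all add: K_def)
    then have "?k 0 = x" using e(1) by (intro nat_eqI) linarith
    ultimately show "x \<in> A" by simp
  qed
  then show ?thesis by (rule that)
qed

text \<open>The sentences are equality-free, so their codes belong to both sets or to
  neither.\<close>

lemma Sigma0_1_reduction:
  assumes "A \<in> Sigma0 1"
  shows "A \<le>\<^sub>m Th_sin" "A \<le>\<^sub>m Th_sin_less"
proof -
  obtain K cs where red: "\<And>x. x \<in> A \<longleftrightarrow> true_sentence (system_sentence K cs x)"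
    using dfn_imp_reduction[OF Sigma0_1_dfn[OF assms]] by blast
  let ?f = "\<lambda>x. formula_code (system_sentence K cs x)"
  have f: "computable ?f" unfolding computable_def
    by (intro recursive_formula_code_system_sentence rec_intros) simp
  have "x \<in> A \<longleftrightarrow> ?f x \<in> Th_sin" "x \<in> A \<longleftrightarrow> ?f x \<in> Th_sin_less" for x
    unfolding red Th_sin_def Th_sin_less_def using equality_free_system_sentence
    by (auto simp: formula_code_inject)
  with f show "A \<le>\<^sub>m Th_sin" "A \<le>\<^sub>m Th_sin_less"
    unfolding many_one_reducible_def by blast+
qed

theorem theorem13:
  "Sigma0 1 \<subseteq> ER_sin \<and> ER_sin \<subseteq> Sigma0 3 \<and> ER_sin_less = Sigma0 1"
  using ER_sin_subset ER_sin_less_subset Sigma0_1_reduction unfolding ER_sin_def ER_sin_less_def by blast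

end
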